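(* Let $\Gamma<\mathsf{PGL}_d(\mathbb R)$ be a projective Anosov subgroup, and let $\Theta\subset\Pi=\{\mathsf a_1,\dots,\mathsf a_{d-1}\}$ be a set of simple roots with $\mathsf a_1\in\Theta$. Let $\varphi\in(E_\Theta)^*$. If there exists a $(\Gamma,\varphi)$-Patterson-Sullivan measure on $\mathcal F_\Theta$ whose support is not contained in a complementary subspace of $\mathcal F_\Theta$, then $$h_\Gamma(\varphi)\le 1 .$$
   Context: Fix a scalar product on $\mathbb R^d$; elements of $\mathsf{PGL}_d(\mathbb R)$ are represented by matrices with $|\det|=1$. Let $\sigma_1(g)\ge\dots\ge\sigma_d(g)$ be the singular values, $E=\{a\in\mathbb R^d:\sum a_i=0\}$, and $a(g)=(\log\sigma_1(g),\dots,\log\sigma_d(g))\in E$. Simple roots: $\mathsf a_i(a)=a_i-a_{i+1}$; fundamental weights: $\omega_i(a)=a_1+\dots+a_i$. Projective Anosov: $\Gamma$ is a discrete, word-hyperbolic subgroup and, for the word length $|\cdot|$ of a finite symmetric generating set, there are $c,\mu>0$ with $\frac{\sigma_2}{\sigma_1}(\gamma)\le ce^{-\mu|\gamma|}$ for all $\gamma\in\Gamma$. For $\Theta\subset\Pi$, $\mathcal F_\Theta$ is the manifold of partial flags $x=(x^p)_{\mathsf a_p\in\Theta}$ of subspaces of $\mathbb R^d$ with $\dim x^p=p$, and $E_\Theta=\bigcap_{\mathsf a_p\notin\Theta}\ker\mathsf a_p$. The dual $(E_\Theta)^*$ is identified with the subspace of $E^*$ spanned by $\{\omega_p:\mathsf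 a_p\in\Theta\}$. The Iwasawa cocycle $b_\Theta:\mathsf{PGL}_d(\mathbb R)\times\mathcal F_\Theta\to E_\Theta$ is determined by $$\omega_p(b_\Theta(g,x))=\log\frac{\|gv_1\wedge\dots\wedge gv_p\|}{\|v_1\wedge\dots\wedge v_p\|},\qquad \mathsf a_p\in\Theta,$$ for any basis $v_1,\dots,v_p$ of $x^p$. A $(\Gamma,\varphi)$-Patterson-Sullivan measure on $\mathcal F_\Theta$ is a finite Radon measure $\mu$ such that for every $g\in\Gamma$, $\frac{d g_*\mu}{d\mu}(x)=e^{-\varphi(b_\Theta(g^{-1},x))}$. Let $\mathrm i\Theta=\{\mathsf a_{d-p}:\mathsf a_p\in\Theta\}$. Flags $x\in\mathcal F_\Theta$, $y\in\mathcal F_{\mathrm i\Theta}$ are transverse if $x^p\cap y^{d-p}=\{0\}$ for all $\mathsf a_p\in\Theta$. A complementary subspace of $\mathcal F_\Theta$ is a set of the form $\{x\in\mathcal F_\Theta: x\text{ not transverse to }y_0\}$ for some $y_0\in\mathcal F_{\mathrm i\Theta}$. Critical exponent of $\varphi\in E^*$: $h_\Gamma(\varphi)=\limsup_{T\to\infty}\frac1T\log\#\{\gamma\in\Gamma:\varphi(a(\gamma))<T\}$.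
   Formalization: Γ is additionally assumed not to be virtually infinite cyclic (finite groups are allowed); otherwise the claim fails, e.g. for Γ generated by diag(2,1/2), φ=0 and the sum of Dirac masses at its two fixed points in the projective line, where h_Γ(φ)=∞. *)

theory Defs
  imports
    "HOL-Analysis.Analysis"
    "HOL-Algebra.Generated_Groups"
    "HOL-Library.Multiset"
begin

section \<open>Scalar products and singular values\<close>

definition is_scalar_product :: "(real^'n \<Rightarrow> real^'n \<Rightarrow> real) \<Rightarrow> bool" where
  "is_scalar_product ip \<longleftrightarrow>
     bilinear ip \<and> (\<forall>v w. ip v w = ip w v) \<and> (\<forall>v. v \<noteq> 0 \<longrightarrow> ip v v > 0)"

text \<open>
  With the adjoint taken with respect to \<open>ip\<close>, this is the eigenspace of \<open>A\<^sup>* A\<close>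
  for the eigenvalue \<open>s\<^sup>2\<close>, because \<open>ip (A\<^sup>* A v) w = ip (A v) (A w)\<close>.
\<close>

definition singular_space ::
    "(real^'n \<Rightarrow> real^'n \<Rightarrow> real) \<Rightarrow> real^'n^'n \<Rightarrow> real \<Rightarrow> (real^'n) set" where
  "singular_space ip A s = {v. \<forall>w. ip (A *v v) (A *v w) = s\<^sup>2 * ip v w}"

text \<open>
  All singular values, repeated according to multiplicity, in decreasing order. As \<open>A\<^sup>* A\<close> is
  self-adjoint, the multiplicity of an eigenvalue is the dimension of its eigenspace.
\<close>

definition singular_values ::
    "(real^'n \<Rightarrow> real^'n \<Rightarrow> real) \<Rightarrow> real^'n^'n \<Rightarrow> real list" where
  "singular_values ip A =
     rev (sorted_list_of_multiset
       (\<Sum>s\<in>{s. s \<ge> 0 \<and> singular_space ip A s \<noteq> {0}}.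
          replicate_mset (dim (singular_space ip A s)) s))"


section \<open>The projective linear group\<close>

definition GL :: "(real^'n^'n) monoid" where
  "GL = \<lparr>carrier = {A. invertible A}, monoid.mult = (**), one = mat 1\<rparr>"

definition scalars :: "(real^'n^'n) set" where
  "scalars = {c *\<^sub>R mat 1 | c. c \<noteq> 0}"

definition PGL :: "(real^'n^'n) set monoid" where
  "PGL = GL Mod scalars"

text \<open>
  A representative of determinant \<open>\<plusminus>1\<close>. It is unique up to sign, and nothing below depends
  on the sign.
\<close>

definition rep :: "(real^'n^'n) set \<Rightarrow> real^'n^'n" where
  "rep g = (SOME A. A \<in> g \<and> \<bar>det A\<bar> = 1)"

text \<open>The quotient topology: the union of a set of cosets is its preimage in \<open>GL\<close>.\<close>

definition PGL_topology :: "(real^'n^'n) set topology" where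
  "PGL_topology = topology (\<lambda>U. U \<subseteq> carrier PGL \<and> open (\<Union>U))"

definition sing_val :: "(real^'n \<Rightarrow> real^'n \<Rightarrow> real) \<Rightarrow> nat \<Rightarrow> (real^'n^'n) set \<Rightarrow> real" where
  "sing_val ip i g = singular_values ip (rep g) ! (i - 1)"


section \<open>Cartan subspace, roots and weights\<close>

text \<open>
  Vectors \<open>(a\<^sub>1, \<dots>, a\<^sub>d)\<close> are functions on \<open>nat\<close> that vanish outside \<open>{1..d}\<close>. The simple root
  with index \<open>p\<close> is represented by \<open>p \<in> {1..d-1}\<close>, and a set of simple roots by
  a set of indices.
\<close>

definition cartan :: "nat \<Rightarrow> (nat \<Rightarrow> real) set" where
  "cartan d = {a. (\<forall>i. i \<notin> {1..d} \<longrightarrow> a i = 0) \<and> (\<Sum>i=1..d. a i) = 0}"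

definition simple_root :: "nat \<Rightarrow> (nat \<Rightarrow> real) \<Rightarrow> real" where
  "simple_root p a = a p - a (p + 1)"

definition weight :: "nat \<Rightarrow> (nat \<Rightarrow> real) \<Rightarrow> real" where
  "weight p a = (\<Sum>i=1..p. a i)"

definition cartan_sub :: "nat \<Rightarrow> nat set \<Rightarrow> (nat \<Rightarrow> real) set" where
  "cartan_sub d \<Theta> = {a \<in> cartan d. \<forall>p\<in>{1..d-1} - \<Theta>. simple_root p a = 0}"

text \<open>
  The dual of \<open>cartan_sub d \<Theta>\<close>, identified with the span of the fundamental weights with index
  in \<open>\<Theta>\<close> inside the dual of \<open>cartan d\<close>. Only the values of \<open>\<phi>\<close> on \<open>cartan d\<close> are relevant.
\<close>

definition cartan_sub_dual :: "nat \<Rightarrow> nat set \<Rightarrow> ((nat \<Rightarrow> real) \<Rightarrow> real) set" where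
  "cartan_sub_dual d \<Theta> =
     {\<phi>. \<exists>c. \<forall>a\<in>cartan d. \<phi> a = (\<Sum>p\<in>\<Theta>. c p * weight p a)}"

definition cartan_projection ::
    "(real^'n \<Rightarrow> real^'n \<Rightarrow> real) \<Rightarrow> (real^'n^'n) set \<Rightarrow> nat \<Rightarrow> real" where
  "cartan_projection ip g = (\<lambda>i. if i \<in> {1..CARD('n)} then ln (sing_val ip i g) else 0)"


section \<open>Word metrics, hyperbolicity and projective Anosov subgroups\<close>

definition symmetric_generating_set :: "('g, 'b) monoid_scheme \<Rightarrow> 'g set \<Rightarrow> 'g set \<Rightarrow> bool" where
  "symmetric_generating_set G \<Gamma> S \<longleftrightarrow>
     finite S \<and> S \<subseteq> carrier G \<and> (\<forall>s\<in>S. inv\<^bsub>G\<^esub> s \<in> S) \<and> generate G S = \<Gamma>"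

definition word_length :: "('g, 'b) monoid_scheme \<Rightarrow> 'g set \<Rightarrow> 'g \<Rightarrow> nat" where
  "word_length G S g =
     (LEAST n. \<exists>ws. set ws \<subseteq> S \<and> length ws = n \<and> foldr (mult G) ws \<one>\<^bsub>G\<^esub> = g)"

definition word_dist :: "('g, 'b) monoid_scheme \<Rightarrow> 'g set \<Rightarrow> 'g \<Rightarrow> 'g \<Rightarrow> real" where
  "word_dist G S x y = real (word_length G S (inv\<^bsub>G\<^esub> x \<otimes>\<^bsub>G\<^esub> y))"

definition gromov_product ::
    "('g, 'b) monoid_scheme \<Rightarrow> 'g set \<Rightarrow> 'g \<Rightarrow> 'g \<Rightarrow> 'g \<Rightarrow> real" where
  "gromov_product G S w x y =
     (word_dist G S x w + word_dist G S y w - word_dist G S x y) / 2"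

definition word_hyperbolic :: "('g, 'b) monoid_scheme \<Rightarrow> 'g set \<Rightarrow> bool" where
  "word_hyperbolic G \<Gamma> \<longleftrightarrow>
     (\<exists>S. symmetric_generating_set G \<Gamma> S \<and>
       (\<exists>\<delta>. \<forall>w\<in>\<Gamma>. \<forall>x\<in>\<Gamma>. \<forall>y\<in>\<Gamma>. \<forall>z\<in>\<Gamma>.
          min (gromov_product G S w x y) (gromov_product G S w y z) - \<delta>
            \<le> gromov_product G S w x z))"

text \<open>
  The two-ended groups, which a non-elementary group is not. The bound on the critical exponent
  fails for them: let \<open>\<Gamma>\<close> be generated by the class of the diagonal matrix with entries \<open>2\<close>
  and \<open>1/2\<close>, and \<open>\<phi> = 0\<close>. The sum of the Dirac masses at the two fixed points in the
  projective line is a Patterson--Sullivan measure, its support is not a single point, and the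
  critical exponent is infinite. Finite groups are not excluded by this condition.
\<close>

definition virtually_infinite_cyclic :: "('g, 'b) monoid_scheme \<Rightarrow> 'g set \<Rightarrow> bool" where
  "virtually_infinite_cyclic G \<Gamma> \<longleftrightarrow>
     (\<exists>\<gamma>\<in>\<Gamma>. infinite (generate G {\<gamma>}) \<and>
        finite (rcosets\<^bsub>G\<lparr>carrier := \<Gamma>\<rparr>\<^esub> (generate G {\<gamma>})))"

definition projective_anosov ::
    "(real^'n \<Rightarrow> real^'n \<Rightarrow> real) \<Rightarrow> (real^'n^'n) set set \<Rightarrow> bool" where
  "projective_anosov ip \<Gamma> \<longleftrightarrow>
     subgroup \<Gamma> PGL \<and>
     subtopology PGL_topology \<Gamma> = discrete_topology \<Gamma> \<and>
     word_hyperbolic PGL \<Gamma> \<and>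
     (\<exists>S c \<mu>. symmetric_generating_set PGL \<Gamma> S \<and> c > 0 \<and> \<mu> > 0 \<and>
        (\<forall>\<gamma>\<in>\<Gamma>. sing_val ip 2 \<gamma> / sing_val ip 1 \<gamma> \<le> c * exp (- \<mu> * real (word_length PGL S \<gamma>))))"


section \<open>Partial flags\<close>

definition flags :: "nat set \<Rightarrow> (nat \<Rightarrow> (real^'n) set) set" where
  "flags \<Theta> = {x \<in> extensional \<Theta>.
     (\<forall>p\<in>\<Theta>. subspace (x p) \<and> dim (x p) = p) \<and>
     (\<forall>p\<in>\<Theta>. \<forall>q\<in>\<Theta>. p \<le> q \<longrightarrow> x p \<subseteq> x q)}"

definition flag_action ::
    "nat set \<Rightarrow> (real^'n^'n) set \<Rightarrow> (nat \<Rightarrow> (real^'n) set) \<Rightarrow> nat \<Rightarrow> (real^'n) set" where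
  "flag_action \<Theta> g x = (\<lambda>p\<in>\<Theta>. (\<lambda>v. rep g *v v) ` x p)"

definition is_basis :: "nat \<Rightarrow> (nat \<Rightarrow> real^'n) \<Rightarrow> (real^'n) set \<Rightarrow> bool" where
  "is_basis p v V \<longleftrightarrow>
     inj_on v {1..p} \<and> independent (v ` {1..p}) \<and> span (v ` {1..p}) = V"

definition frame_flag :: "nat set \<Rightarrow> (nat \<Rightarrow> real^'n) \<Rightarrow> nat \<Rightarrow> (real^'n) set" where
  "frame_flag \<Theta> v = (\<lambda>p\<in>\<Theta>. span (v ` {1..p}))"

text \<open>
  The manifold topology, as the quotient topology of the space of bases \<open>v\<^sub>1, \<dots>, v\<^sub>d\<close> of the
  ambient space. That space is open in \<open>nat \<Rightarrow> real^'n\<close> with the product topology; the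
  coordinates outside \<open>{1..d}\<close> are dummies.
\<close>

definition flag_topology :: "nat set \<Rightarrow> (nat \<Rightarrow> (real^'n) set) topology" where
  "flag_topology \<Theta> = topology (\<lambda>U. U \<subseteq> flags \<Theta> \<and>
     open {v :: nat \<Rightarrow> real^'n. is_basis CARD('n) v UNIV \<and> frame_flag \<Theta> v \<in> U})"

definition opp :: "nat \<Rightarrow> nat set \<Rightarrow> nat set" where
  "opp d \<Theta> = (\<lambda>p. d - p) ` \<Theta>"

definition transverse ::
    "nat set \<Rightarrow> (nat \<Rightarrow> (real^'n) set) \<Rightarrow> (nat \<Rightarrow> (real^'n) set) \<Rightarrow> bool" where
  "transverse \<Theta> x y \<longleftrightarrow> (\<forall>p\<in>\<Theta>. x p \<inter> y (CARD('n) - p) = {0})"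

definition complementary_subspace :: "nat set \<Rightarrow> (nat \<Rightarrow> (real^'n) set) set \<Rightarrow> bool" where
  "complementary_subspace \<Theta> C \<longleftrightarrow>
     (\<exists>y0\<in>flags (opp CARD('n) \<Theta>). C = {x \<in> flags \<Theta>. \<not> transverse \<Theta> x y0})"


section \<open>The Iwasawa cocycle\<close>

text \<open>
  The norm of \<open>v\<^sub>1 \<and> \<dots> \<and> v\<^sub>p\<close> for the scalar product induced by \<open>ip\<close> on the exterior power,
  that is, the square root of the Gram determinant, written with the Leibniz formula.
\<close>

definition wedge_norm ::
    "(real^'n \<Rightarrow> real^'n \<Rightarrow> real) \<Rightarrow> nat \<Rightarrow> (nat \<Rightarrow> real^'n) \<Rightarrow> real" where
  "wedge_norm ip p v =
     sqrt (\<Sum>\<pi> | \<pi> permutes {1..p}. of_int (sign \<pi>) * (\<Prod>i=1..p. ip (v i) (v (\<pi> i))))"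

definition iwasawa ::
    "(real^'n \<Rightarrow> real^'n \<Rightarrow> real) \<Rightarrow> nat set \<Rightarrow> (real^'n^'n) set \<Rightarrow>
     (nat \<Rightarrow> (real^'n) set) \<Rightarrow> nat \<Rightarrow> real" where
  "iwasawa ip \<Theta> g x = (THE b. b \<in> cartan_sub CARD('n) \<Theta> \<and>
     (\<forall>p\<in>\<Theta>. \<forall>v. is_basis p v (x p) \<longrightarrow>
        weight p b = ln (wedge_norm ip p (\<lambda>i. rep g *v v i) / wedge_norm ip p v)))"


section \<open>Patterson--Sullivan measures and the critical exponent\<close>

definition finite_radon_measure :: "'a topology \<Rightarrow> 'a measure \<Rightarrow> bool" where
  "finite_radon_measure X \<mu> \<longleftrightarrow>
     space \<mu> = topspace X \<and> sets \<mu> = sigma_sets (topspace X) {U. openin X U} \<and>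
     finite_measure \<mu> \<and>
     (\<forall>A\<in>sets \<mu>. emeasure \<mu> A = (SUP K\<in>{K \<in> sets \<mu>. K \<subseteq> A \<and> compactin X K}. emeasure \<mu> K))"

definition measure_support :: "'a topology \<Rightarrow> 'a measure \<Rightarrow> 'a set" where
  "measure_support X \<mu> =
     {x \<in> topspace X. \<forall>U. openin X U \<and> x \<in> U \<longrightarrow> emeasure \<mu> U > 0}"

definition patterson_sullivan ::
    "(real^'n \<Rightarrow> real^'n \<Rightarrow> real) \<Rightarrow> nat set \<Rightarrow> (real^'n^'n) set set \<Rightarrow>
     ((nat \<Rightarrow> real) \<Rightarrow> real) \<Rightarrow> (nat \<Rightarrow> (real^'n) set) measure \<Rightarrow> bool" where
  "patterson_sullivan ip \<Theta> \<Gamma> \<phi> \<mu> \<longleftrightarrow>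
     finite_radon_measure (flag_topology \<Theta>) \<mu> \<and>
     (\<forall>g\<in>\<Gamma>. distr \<mu> \<mu> (flag_action \<Theta> g) =
        density \<mu> (\<lambda>x. ennreal (exp (- \<phi> (iwasawa ip \<Theta> (inv\<^bsub>PGL\<^esub> g) x)))))"

definition log_card :: "'a set \<Rightarrow> ereal" where
  "log_card A =
     (if infinite A then \<infinity> else if A = {} then -\<infinity> else ereal (ln (real (card A))))"

definition critical_exponent ::
    "(real^'n \<Rightarrow> real^'n \<Rightarrow> real) \<Rightarrow> (real^'n^'n) set set \<Rightarrow> ((nat \<Rightarrow> real) \<Rightarrow> real) \<Rightarrow> ereal" where
  "critical_exponent ip \<Gamma> \<phi> =
     Limsup at_top
       (\<lambda>T::real. log_card {\<gamma> \<in> \<Gamma>. \<phi> (cartan_projection ip \<gamma>) < T} / ereal T)"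


section \<open>Basic facts\<close>

lemma group_GL: "group (GL :: (real^'n^'n) monoid)"
proof (rule groupI)
  fix x :: "real^'n^'n" assume "x \<in> carrier GL"
  then show "\<exists>y\<in>carrier GL. y \<otimes>\<^bsub>GL\<^esub> x = \<one>\<^bsub>GL\<^esub>"
    unfolding GL_def invertible_def by auto
next
  show "\<one>\<^bsub>GL\<^esub> \<in> carrier (GL :: (real^'n^'n) monoid)"
    unfolding GL_def invertible_def by (auto intro: exI[of _ "mat 1"])
qed (auto simp: GL_def invertible_mult matrix_mul_assoc)

lemma scalar_mult_left: "(c *\<^sub>R mat 1) ** A = c *\<^sub>R (A :: real^'n^'n)"
  proof -
  have "(c *\<^sub>R B) ** A = c *\<^sub>R (B ** A)" for B :: "real^'n^'n"
    by (simp add: matrix_matrix_mult_def vec_eq_iff sum_distrib_left mult.assoc)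
  then show ?thesis by simp
qed

lemma scalar_mult_right: "A ** (c *\<^sub>R mat 1) = c *\<^sub>R (A :: real^'n^'n)"
  proof -
  have "A ** (c *\<^sub>R B) = c *\<^sub>R (A ** B)" for B :: "real^'n^'n"
    by (simp add: matrix_matrix_mult_def vec_eq_iff sum_distrib_left mult_ac)
  then show ?thesis by simp
qed

lemma invertible_scalar:
  assumes "c \<noteq> 0"
  shows "invertible (c *\<^sub>R mat 1 :: real^'n^'n)"
  unfolding invertible_def
  by (rule exI[of _ "(1/c) *\<^sub>R mat 1"]) (use assms in \<open>simp add: scalar_mult_left\<close>)

lemma normal_scalars: "scalars \<lhd> (GL :: (real^'n^'n) monoid)"
proof -
  have sub: "subgroup (scalars :: (real^'n^'n) set) GL"
  proof (rule group.subgroupI[OF group_GL])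
    show "(scalars :: (real^'n^'n) set) \<subseteq> carrier GL"
      using invertible_scalar by (auto simp: GL_def scalars_def)
    show "(scalars :: (real^'n^'n) set) \<noteq> {}"
      unfolding scalars_def by (auto intro: exI[of _ 1])
    show "a \<otimes>\<^bsub>GL\<^esub> b \<in> scalars" if ab: "a \<in> scalars" "b \<in> scalars" for a b :: "real^'n^'n"
    proof -
      obtain c e where "a = c *\<^sub>R mat 1" "b = e *\<^sub>R mat 1" "c \<noteq> 0" "e \<noteq> 0"
        using ab unfolding scalars_def by blast
      then have "a \<otimes>\<^bsub>GL\<^esub> b = (c * e) *\<^sub>R mat 1" "c * e \<noteq> 0"
        by (auto simp: GL_def scalar_mult_left)
      then show ?thesis unfolding scalars_def by blast
    qed
    show "inv\<^bsub>GL\<^esub> a \<in> scalars" if a: "a \<in> scalars" for a :: "real^'n^'n"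
    proof -
      obtain c where c: "a = c *\<^sub>R mat 1" "c \<noteq> 0"
        using a unfolding scalars_def by blast
      have "inv\<^bsub>GL\<^esub> a = (1/c) *\<^sub>R mat 1"
        by (rule group.inv_equality[OF group_GL])
           (use c invertible_scalar[of c] invertible_scalar[of "1/c"] in
             \<open>auto simp: GL_def scalar_mult_left\<close>)
      moreover have "1 / c \<noteq> 0" using c by simp
      ultimately show ?thesis unfolding scalars_def by blast
    qed
  qed
  show ?thesis
  proof (rule group.normalI[OF group_GL sub], intro ballI)
    fix x :: "real^'n^'n" assume "x \<in> carrier GL"
    show "scalars #>\<^bsub>GL\<^esub> x = x <#\<^bsub>GL\<^esub> scalars"
      unfolding r_coset_def l_coset_def scalars_def GL_def
      by (auto simp: scalar_mult_left scalar_mult_right)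
  qed
qed

lemma group_PGL: "group (PGL :: (real^'n^'n) set monoid)"
  unfolding PGL_def by (rule normal.factorgroup_is_group[OF normal_scalars])

lemma PGL_disjoint:
  assumes "g \<in> carrier PGL" "h \<in> carrier PGL" "A \<in> g" "A \<in> h"
  shows "g = h"
  using group.rcos_disjoint[OF group_GL normal_imp_subgroup[OF normal_scalars]] assms
  by (auto simp: PGL_def FactGroup_def pairwise_def disjnt_def)

lemma openin_PGL_topology:
  fixes U :: "(real^'n^'n) set set"
  shows "openin PGL_topology U \<longleftrightarrow> U \<subseteq> carrier PGL \<and> open (\<Union>U)"
proof -
  have "istopology (\<lambda>U. U \<subseteq> carrier (PGL :: (real^'n^'n) set monoid) \<and> open (\<Union>U))"
    unfolding istopology_def
  proof (intro conjI allI impI)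
    fix U V :: "(real^'n^'n) set set"
    assume U: "U \<subseteq> carrier PGL \<and> open (\<Union>U)" and V: "V \<subseteq> carrier PGL \<and> open (\<Union>V)"
    then show "U \<inter> V \<subseteq> carrier PGL" by blast
    have "\<Union>(U \<inter> V) = \<Union>U \<inter> \<Union>V"
    proof
      show "\<Union>U \<inter> \<Union>V \<subseteq> \<Union>(U \<inter> V)"
      proof
        fix A assume "A \<in> \<Union>U \<inter> \<Union>V"
        then obtain g h where gh: "g \<in> U" "h \<in> V" "A \<in> g" "A \<in> h" by blast
        then have "g = h" using PGL_disjoint U V by blast
        then show "A \<in> \<Union>(U \<inter> V)" using gh by blast
      qed
    qed blast
    then show "open (\<Union>(U \<inter> V))" using U V by auto
  next
    fix K :: "(real^'n^'n) set set set"
    assume K: "\<forall>U\<in>K. U \<subseteq> carrier PGL \<and> open (\<Union>U)"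
    then show "\<Union>K \<subseteq> carrier PGL" by blast
    have "\<Union>(\<Union>K) = (\<Union>U\<in>K. \<Union>U)" by blast
    then show "open (\<Union>(\<Union>K))" using K by auto
  qed
  then show ?thesis by (simp add: PGL_topology_def topology_inverse')
qed

lemma topspace_PGL_topology: "topspace PGL_topology = carrier (PGL :: (real^'n^'n) set monoid)"
proof -
  have "\<Union>(carrier PGL) = (carrier GL :: (real^'n^'n) set)"
    using group.rcosets_part_G[OF group_GL normal_imp_subgroup[OF normal_scalars]]
    by (auto simp: PGL_def FactGroup_def)
  also have "\<dots> = {A. det A \<noteq> 0}"
    by (simp add: GL_def invertible_det_nz)
  also have "open \<dots>"
    unfolding det_def by (intro open_Collect_neq continuous_intros)
  finally have "openin PGL_topology (carrier (PGL :: (real^'n^'n) set monoid))"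
    by (simp add: openin_PGL_topology)
  then show ?thesis
    by (metis openin_PGL_topology openin_subset openin_topspace subset_antisym)
qed

lemma openin_flag_topology:
  fixes U :: "(nat \<Rightarrow> (real^'n) set) set"
  shows "openin (flag_topology \<Theta>) U \<longleftrightarrow> U \<subseteq> flags \<Theta> \<and>
     open {v :: nat \<Rightarrow> real^'n. is_basis CARD('n) v UNIV \<and> frame_flag \<Theta> v \<in> U}"
proof -
  have "istopology (\<lambda>U. U \<subseteq> flags \<Theta> \<and>
     open {v :: nat \<Rightarrow> real^'n. is_basis CARD('n) v UNIV \<and> frame_flag \<Theta> v \<in> U})"
    unfolding istopology_def
  proof (intro conjI allI impI)
    fix U V :: "(nat \<Rightarrow> (real^'n) set) set"
    let ?pre = "\<lambda>U. {v :: nat \<Rightarrow> real^'n. is_basis CARD('n) v UNIV \<and> frame_flag \<Theta> v \<in> U}"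
    assume U: "U \<subseteq> flags \<Theta> \<and> open (?pre U)" and V: "V \<subseteq> flags \<Theta> \<and> open (?pre V)"
    then show "U \<inter> V \<subseteq> flags \<Theta>" by blast
    have "?pre (U \<inter> V) = ?pre U \<inter> ?pre V" by blast
    then show "open (?pre (U \<inter> V))" using U V by auto
  next
    fix K :: "(nat \<Rightarrow> (real^'n) set) set set"
    let ?pre = "\<lambda>U. {v :: nat \<Rightarrow> real^'n. is_basis CARD('n) v UNIV \<and> frame_flag \<Theta> v \<in> U}"
    assume K: "\<forall>U\<in>K. U \<subseteq> flags \<Theta> \<and> open (?pre U)"
    then show "\<Union>K \<subseteq> flags \<Theta>" by blast
    have "?pre (\<Union>K) = (\<Union>U\<in>K. ?pre U)" by blast
    then show "open (?pre (\<Union>K))" using K by auto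
  qed
  then show ?thesis by (simp add: flag_topology_def topology_inverse')
qed

lemma is_basis_UNIV_iff:
  fixes v :: "nat \<Rightarrow> real^'n"
  shows "is_basis CARD('n) v UNIV \<longleftrightarrow> span (v ` {1..CARD('n)}) = UNIV"
proof
  assume sp: "span (v ` {1..CARD('n)}) = UNIV"
  let ?B = "v ` {1..CARD('n)}"
  have le: "card ?B \<le> CARD('n)" using card_image_le[of "{1..CARD('n)}" v] by simp
  have "dim (UNIV :: (real^'n) set) \<le> card ?B"
    by (rule dim_le_card) (use sp in auto)
  then have eq: "card ?B = CARD('n)" using le by simp
  then have "inj_on v {1..CARD('n)}" by (intro eq_card_imp_inj_on) auto
  moreover have "independent ?B"
    by (rule card_le_dim_spanning[of _ UNIV]) (use sp eq in auto)
  ultimately show "is_basis CARD('n) v UNIV" using sp by (simp add: is_basis_def)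
qed (simp add: is_basis_def)

lemma open_bases: "open {v :: nat \<Rightarrow> real^'n. is_basis CARD('n) v UNIV}"
proof -
  obtain e where e: "bij_betw e (UNIV :: 'n set) {1..CARD('n)}"
    using finite_same_card_bij[of "UNIV :: 'n set" "{1..CARD('n)}"] by auto
  define M where "M = (\<lambda>v :: nat \<Rightarrow> real^'n. \<chi> i j. v (e j) $ i)"
  have "columns (M v) = v ` {1..CARD('n)}" for v
  proof -
    have "column j (M v) = v (e j)" for j
      by (simp add: column_def M_def vec_eq_iff)
    then have "columns (M v) = v ` range e" by (auto simp: columns_def)
    then show ?thesis using e by (simp add: bij_betw_def)
  qed
  then have "is_basis CARD('n) v UNIV \<longleftrightarrow> det (M v) \<noteq> 0" for v
    unfolding is_basis_UNIV_iff invertible_det_nz[symmetric] invertible_right_inverse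
      matrix_right_invertible_span_columns span_vec_eq by simp
  moreover have "continuous_on UNIV (\<lambda>v. det (M v))"
    unfolding det_def M_def
    by (simp, intro continuous_intros continuous_on_component)
       (auto intro: continuous_on_product_coordinates)
  ultimately show ?thesis
    by (simp add: open_Collect_neq continuous_on_const)
qed

lemma frame_flag_in_flags:
  fixes v :: "nat \<Rightarrow> real^'n"
  assumes "\<Theta> \<subseteq> {1..CARD('n)}" "is_basis CARD('n) v UNIV"
  shows "frame_flag \<Theta> v \<in> flags \<Theta>"
proof -
  have "dim (v ` {1..p}) = p" if "p \<in> \<Theta>" for p
  proof -
    have sub: "{1..p} \<subseteq> {1..CARD('n)}" using that assms(1) by auto
    have "independent (v ` {1..p})"
      by (rule independent_mono[of "v ` {1..CARD('n)}"])
         (use assms(2) sub in \<open>auto simp: is_basis_def\<close>)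
    moreover have "card (v ` {1..p}) = p"
      using assms(2) sub by (subst card_image) (auto simp: is_basis_def intro: inj_on_subset)
    ultimately show ?thesis by (simp add: dim_eq_card_independent)
  qed
  moreover have "span (v ` {1..p}) \<subseteq> span (v ` {1..q})" if "p \<le> q" for p q
    by (rule span_mono) (use that in auto)
  ultimately show ?thesis
    by (simp add: flags_def frame_flag_def)
qed

lemma topspace_flag_topology:
  assumes "\<Theta> \<subseteq> {1..CARD('n)}"
  shows "topspace (flag_topology \<Theta>) = (flags \<Theta> :: (nat \<Rightarrow> (real^'n) set) set)"
proof -
  have "{v :: nat \<Rightarrow> real^'n. is_basis CARD('n) v UNIV \<and> frame_flag \<Theta> v \<in> flags \<Theta>}
      = {v. is_basis CARD('n) v UNIV}"
    using frame_flag_in_flags[OF assms] by blast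
  then have "openin (flag_topology \<Theta>) (flags \<Theta> :: (nat \<Rightarrow> (real^'n) set) set)"
    by (simp add: openin_flag_topology open_bases)
  then show ?thesis
    by (metis openin_flag_topology openin_subset openin_topspace subset_antisym)
qed

end

theory Submission
  imports Defs "Jordan_Normal_Form.Determinant"
begin

text \<open>
  Let \<open>u\<^sub>1, \<dots>, u\<^sub>d\<close> be the right singular vectors of \<open>g\<close>, and let the basin of \<open>g\<close> consist of the flags \<open>x\<close>
  with every \<open>x\<^sup>p\<close> uniformly transverse to the span of the \<open>u\<^sub>i\<close> with \<open>i > p\<close>. There the Iwasawa cocycle of
  \<open>g\<close> is \<open>a(g)\<close> up to a bounded error. Since the support of the measure lies in no complementary
  subspace, compactness bounds the measure of basins from below, so the shadow \<open>O(g) = g \<cdot> basin(g)\<close>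
  has measure at least a constant times \<open>exp(-\<phi>(a(g)))\<close>.

  By the Anosov property, if \<open>O(g)\<close> and \<open>O(h)\<close> meet, then the shorter of \<open>g\<close>, \<open>h\<close> is close to a
  geodesic from \<open>1\<close> to the longer one. The shadows of the elements of one word length would thus overlap
  with bounded multiplicity, but the measure decays along \<open>\<phi>(a(g))\<close> and not along the word length. So
  let \<open>m(g)\<close> be the measure of the union of the shadows of all elements behind \<open>g\<close>. As the group is not
  elementary, a fixed finite set contains, for every \<open>g\<close>, two elements \<open>k\<close> for which the shadows behind \<open>g k\<close>
  are disjoint, so one of them satisfies \<open>m(g k) \<le> m(g) / 2\<close>. Hence, with this choice of \<open>k = k(g)\<close>,
  the shadows \<open>O(g k(g))\<close> of all \<open>g\<close> with \<open>m(g)\<close>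
  in a dyadic interval overlap with bounded multiplicity. Summing over the \<open>O(1 + T)\<close> intervals that
  are relevant for \<open>\<phi>(a(g)) < T\<close> gives \<open>#{g. \<phi>(a(g)) < T} \<le> C (1 + T) exp T\<close>.
\<close>

text \<open>The number \<phi>(a(g)) is not assumed to grow with the word length, so elements with
  similar values of \<phi>(a(g)) may have very different lengths and nested shadows. Mass levels
  cure this. Suppose that \<open>g\<close> and \<open>h\<close> have masses within a factor two and
  that the shadows of \<open>g k(g)\<close> and \<open>h k(h)\<close> meet. If \<open>h\<close> were
  much longer than \<open>g\<close>, every shadow behind \<open>h\<close> would also lie behind
  \<open>g k(g)\<close>, so m(h) would be at most m(g k(g)), hence at most m(g) / 2, a
  contradiction. So the lengths are comparable, and a large Gromov product then keeps
  \<open>g\<close> and \<open>h\<close> at bounded distance. Passing from \<open>g\<close> to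
  \<open>g k(g)\<close> changes exp(-\<phi>(a(g))) by a bounded factor only, because
  \<open>k(g)\<close> ranges over a finite set and the weights of the Cartan projection are
  subadditive. The level is confined to O(1 + T) values because m(g) is at least a multiple of
  exp(-\<phi>(a(g))) and at most the total mass. The two branches are two legs of a tripod, which
  exists in every infinite hyperbolic group that is not virtually cyclic.\<close>

no_notation vec_index (infixl "$" 100)
hide_const (open) Matrix.mat Matrix.vec Determinant.det
hide_fact (open) Matrix.vec_eq_iff Matrix.mat_def

section \<open>Hyperbolic groups\<close>

text \<open>Abstracts a word metric: \<open>len (inv x \<otimes> y)\<close> is a left-invariant
  integer distance, \<open>prefix\<close> provides points at every intermediate distance on the way
  to an element (discrete geodesics), and \<open>hyp\<close> is the four-point inequality at the
  base point 1, from which left translation reaches any other.\<close>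

locale hyperbolic_group = group G for G (structure) +
  fixes \<Gamma> :: "'a set" and len :: "'a \<Rightarrow> nat" and \<delta> :: real
  assumes sub: "subgroup \<Gamma> G"
    and len_one: "len \<one> = 0"
    and len_mult: "\<And>x y. x \<in> \<Gamma> \<Longrightarrow> y \<in> \<Gamma> \<Longrightarrow> len (x \<otimes> y) \<le> len x + len y"
    and len_inv: "\<And>x. x \<in> \<Gamma> \<Longrightarrow> len (inv x) = len x"
    and prefix: "\<And>x n. x \<in> \<Gamma> \<Longrightarrow> n \<le> len x \<Longrightarrow>
        \<exists>y\<in>\<Gamma>. len y = n \<and> len (inv y \<otimes> x) = len x - n"
    and finite_ball: "\<And>n. finite {x \<in> \<Gamma>. len x \<le> n}"
    and hyp: "\<And>x y z. x \<in> \<Gamma> \<Longrightarrow> y \<in> \<Gamma> \<Longrightarrow> z \<in> \<Gamma> \<Longrightarrow>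
        min ((real (len x) + real (len y) - real (len (inv x \<otimes> y))) / 2)
            ((real (len y) + real (len z) - real (len (inv y \<otimes> z))) / 2) - \<delta>
        \<le> (real (len x) + real (len z) - real (len (inv x \<otimes> z))) / 2"
begin

text \<open>The Gromov product at the identity: up to a multiple of \<delta>, the length that
  geodesics from 1 to \<open>x\<close> and to \<open>y\<close> share.\<close>

definition gp :: "'a \<Rightarrow> 'a \<Rightarrow> real" where
  "gp x y = (real (len x) + real (len y) - real (len (inv x \<otimes> y))) / 2"

section \<open>Lengths and Gromov products under left translation\<close>

lemma carrier [simp, intro]: "x \<in> \<Gamma> \<Longrightarrow> x \<in> carrier G"
  using sub by (meson subgroup.mem_carrier)

lemma closed [simp, intro]:
  "x \<in> \<Gamma> \<Longrightarrow> y \<in> \<Gamma> \<Longrightarrow> x \<otimes> y \<in> \<Gamma>" "x \<in> \<Gamma> \<Longrightarrow> inv x \<in> \<Gamma>" "\<one> \<in> \<Gamma>"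
  using sub by (auto intro: subgroup.m_closed subgroup.m_inv_closed subgroup.one_closed)

lemma inv_mult_cancel:
  assumes "g \<in> \<Gamma>" "x \<in> \<Gamma>" "y \<in> \<Gamma>"
  shows "inv (g \<otimes> x) \<otimes> (g \<otimes> y) = inv x \<otimes> y"
proof -
  have "inv g \<otimes> (g \<otimes> y) = y" using assms by (simp add: m_assoc[symmetric])
  then show ?thesis using assms by (simp add: inv_mult_group m_assoc)
qed

lemma len_dist_sym: "x \<in> \<Gamma> \<Longrightarrow> y \<in> \<Gamma> \<Longrightarrow> len (inv x \<otimes> y) = len (inv y \<otimes> x)"
  using len_inv[of "inv x \<otimes> y"] by (simp add: inv_mult_group)

lemma len_dist_tri:
  assumes "x \<in> \<Gamma>" "y \<in> \<Gamma>" "z \<in> \<Gamma>"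
  shows "len (inv x \<otimes> z) \<le> len (inv x \<otimes> y) + len (inv y \<otimes> z)"
proof -
  have "(inv x \<otimes> y) \<otimes> (inv y \<otimes> z) = inv x \<otimes> z"
    using assms by (metis carrier closed(2) inv_closed m_assoc m_closed r_inv r_one l_one)
  then show ?thesis using len_mult[of "inv x \<otimes> y" "inv y \<otimes> z"] assms by simp
qed

lemma len_diff: "x \<in> \<Gamma> \<Longrightarrow> y \<in> \<Gamma> \<Longrightarrow> len x \<le> len y + len (inv x \<otimes> y)"
  using len_dist_tri[of \<one> y x] by (simp add: len_dist_sym)

lemma gp_sym: "x \<in> \<Gamma> \<Longrightarrow> y \<in> \<Gamma> \<Longrightarrow> gp x y = gp y x"
  by (simp add: gp_def len_dist_sym)

lemma gp_nonneg: "x \<in> \<Gamma> \<Longrightarrow> y \<in> \<Gamma> \<Longrightarrow> 0 \<le> gp x y"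
  using len_mult[of "inv x" y] by (simp add: gp_def len_inv)

lemma gp_le: "x \<in> \<Gamma> \<Longrightarrow> y \<in> \<Gamma> \<Longrightarrow> gp x y \<le> len x" "x \<in> \<Gamma> \<Longrightarrow> y \<in> \<Gamma> \<Longrightarrow> gp x y \<le> len y"
  using len_diff[of x y] len_diff[of y x] by (auto simp: gp_def len_dist_sym)

lemma gp_self: "x \<in> \<Gamma> \<Longrightarrow> gp x x = len x"
  by (simp add: gp_def len_one)

lemma gp_hyp: "x \<in> \<Gamma> \<Longrightarrow> y \<in> \<Gamma> \<Longrightarrow> z \<in> \<Gamma> \<Longrightarrow> min (gp x y) (gp y z) - \<delta> \<le> gp x z"
  using hyp by (simp add: gp_def)

lemma delta_nonneg: "0 \<le> \<delta>"
  using gp_hyp[of \<one> \<one> \<one>] by simp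

lemma len_mult_gp: "g \<in> \<Gamma> \<Longrightarrow> x \<in> \<Gamma> \<Longrightarrow> real (len (g \<otimes> x)) = len g + len x - 2 * gp (inv g) x"
  by (simp add: gp_def len_inv field_simps)

text \<open>Left translation by \<open>g\<close> turns the product based at 1 into the one based at
  \<open>inv g\<close>; the remaining terms are the change of base point.\<close>

lemma gp_mult:
  "g \<in> \<Gamma> \<Longrightarrow> x \<in> \<Gamma> \<Longrightarrow> y \<in> \<Gamma> \<Longrightarrow>
    gp (g \<otimes> x) (g \<otimes> y) = len g + gp x y - gp (inv g) x - gp (inv g) y"
  unfolding gp_def[of "g \<otimes> x"] gp_def[of x] by (simp add: inv_mult_cancel len_mult_gp field_simps)

text \<open>The products at the two ends of the side [1, g] of the triangle with vertices 1, g, g x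
  add up to the length of that side. So a small \<open>gp (inv g) x\<close> means that
  \<open>g\<close> is near a geodesic from 1 to \<open>g \<otimes> x\<close>.\<close>

lemma gp_mult_self: "g \<in> \<Gamma> \<Longrightarrow> x \<in> \<Gamma> \<Longrightarrow> gp g (g \<otimes> x) = len g - gp (inv g) x"
  using gp_mult[of g \<one> x] by (simp add: gp_def len_one len_inv field_simps)

text \<open>Cut a geodesic of length \<open>2 * n\<close> at its midpoint \<open>c\<close> and
  translate the midpoint to 1: the two ends become elements that point in opposite
  directions.\<close>

lemma opposite_pair:
  assumes "infinite \<Gamma>"
  obtains p q where "p \<in> \<Gamma>" "q \<in> \<Gamma>" "len p = n" "len q = n" "gp p q = 0"
proof -
  have "\<not> \<Gamma> \<subseteq> {x \<in> \<Gamma>. len x \<le> 2 * n}"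
    using finite_ball finite_subset assms by blast
  then obtain x where x: "x \<in> \<Gamma>" "2 * n \<le> len x" by fastforce
  obtain y where y: "y \<in> \<Gamma>" "len y = 2 * n" using prefix[OF x] by blast
  obtain c where c: "c \<in> \<Gamma>" "len c = n" "len (inv c \<otimes> y) = n"
    using prefix[of y n] y by (auto simp: mult_2)
  have "inv (inv c \<otimes> y) \<otimes> inv c = inv y"
    using c y by (simp add: inv_mult_group m_assoc)
  then have "gp (inv c \<otimes> y) (inv c) = 0"
    using c y by (simp add: gp_def len_inv)
  then show ?thesis using that[of "inv c \<otimes> y" "inv c"] c y by (simp add: len_inv)
qed

text \<open>If neither of two opposite elements \<open>p\<close>, \<open>q\<close> diverges from its
  own inverse, then \<open>inv p\<close> follows \<open>p\<close> and \<open>inv q\<close> follows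
  \<open>q\<close>, so \<open>inv p\<close> and \<open>inv q\<close> diverge. The product
  \<open>inv p \<otimes> q\<close> starts along \<open>inv p\<close> and its inverse starts along
  \<open>inv q\<close>, so these two diverge as well.\<close>

lemma axial_element:
  assumes "infinite \<Gamma>"
  obtains h where "h \<in> \<Gamma>" "n \<le> len h" "gp h (inv h) \<le> 4 * \<delta> + 1"
proof -
  \<comment> \<open>The lower bound 4\<delta> + 1 prevents the products that equal \<open>m\<close>
    from attaining the minimum in the hyperbolic inequality, so that the other product is the
    bounded one.\<close>
  define m where "m = max n (nat \<lceil>4 * \<delta> + 1\<rceil>)"
  have m: "n \<le> m" "4 * \<delta> + 1 \<le> real m" unfolding m_def by linarith+
  obtain p q where pq: "p \<in> \<Gamma>" "q \<in> \<Gamma>" "len p = m" "len q = m" "gp p q = 0"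
    by (rule opposite_pair[OF assms])
  consider "gp p (inv p) \<le> 4 * \<delta> + 1" | "gp q (inv q) \<le> 4 * \<delta> + 1"
    | "gp p (inv p) > 4 * \<delta> + 1" "gp q (inv q) > 4 * \<delta> + 1" by linarith
  then show ?thesis
  proof cases
    case 3
    define h where "h = inv p \<otimes> q"
    have h: "h \<in> \<Gamma>" "inv h = inv q \<otimes> p"
      using pq by (auto simp: h_def inv_mult_group)
    have lh: "len h = 2 * m" using pq by (simp add: gp_def h_def)
    have "p \<otimes> h = q" "q \<otimes> inv h = p"
      using pq h by (auto simp: h_def inv_solve_left m_assoc[symmetric])
    then have a: "gp (inv p) h = m" "gp (inv q) (inv h) = m"
      using pq lh len_inv[OF h(1)] by (auto simp: gp_def len_inv)
    have "gp (inv p) (inv q) \<le> 2 * \<delta>"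
      using gp_hyp[of p "inv p" q] gp_hyp[of "inv p" "inv q" q] pq 3 delta_nonneg
      by (simp add: gp_sym)
    then have "gp h (inv h) \<le> 4 * \<delta>"
      using gp_hyp[of "inv p" h "inv q"] gp_hyp[of h "inv h" "inv q"] gp_sym[of "inv h" "inv q"]
        pq(1-4) h(1) a m delta_nonneg
      by auto
    then show ?thesis using that[of h] h lh m by simp
  qed (use that pq m in auto)
qed

text \<open>Descent: multiplication by \<open>h\<close> or \<open>inv h\<close> shortens an element
  until its length is at most \<open>B\<close>, so every right coset of the group generated by
  \<open>h\<close> meets a finite ball. Its index is therefore finite, and it is infinite because
  \<Gamma> is.\<close>

lemma virtually_cyclicI:
  assumes inf: "infinite \<Gamma>" and h: "h \<in> \<Gamma>"
    and desc: "\<And>g. g \<in> \<Gamma> \<Longrightarrow> B < len g \<Longrightarrow> len (inv h \<otimes> g) < len g \<or> len (h \<otimes> g) < len g"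
  shows "virtually_infinite_cyclic G \<Gamma>"
proof -
  let ?H = "generate G {h}" and ?B = "{x \<in> \<Gamma>. len x \<le> B}"
  have H: "subgroup ?H G" using h by (intro generate_is_subgroup) auto
  have hH: "h \<in> ?H" "inv h \<in> ?H" by (auto intro: generate.incl generate.inv)
  have H\<Gamma>: "?H \<subseteq> \<Gamma>" by (rule generate_subgroup_incl) (use h sub in auto)
  have near: "\<exists>k\<in>?H. \<exists>b\<in>?B. g = k \<otimes> b" if "g \<in> \<Gamma>" for g
    using that
  proof (induction "len g" arbitrary: g rule: less_induct)
    case less
    consider "len g \<le> B" | "len (inv h \<otimes> g) < len g" | "len (h \<otimes> g) < len g"
      using desc[OF less.prems] by linarith
    then show ?case
    proof cases
      case 1
      then show ?thesis using less.prems subgroup.one_closed[OF H] by force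
    next
      case 2
      then obtain k b where kb: "k \<in> ?H" "b \<in> ?B" "inv h \<otimes> g = k \<otimes> b"
        using less.hyps[OF 2] less.prems h by blast
      have "g = (h \<otimes> k) \<otimes> b"
        using kb h less.prems H\<Gamma> by (metis (no_types, lifting) carrier inv_closed inv_inv inv_solve_left m_assoc m_closed mem_Collect_eq subsetD)
      then show ?thesis using kb hH subgroup.m_closed[OF H] by blast
    next
      case 3
      then obtain k b where kb: "k \<in> ?H" "b \<in> ?B" "h \<otimes> g = k \<otimes> b"
        using less.hyps[OF 3] less.prems h by blast
      have "g = (inv h \<otimes> k) \<otimes> b"
        using kb h less.prems H\<Gamma> by (metis (no_types, lifting) carrier inv_closed inv_solve_left m_assoc m_closed mem_Collect_eq subsetD)
      then show ?thesis using kb hH subgroup.m_closed[OF H] by blast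
    qed
  qed
  have "infinite ?H"
  proof
    assume "finite ?H"
    then have "finite ((\<lambda>(k, b). k \<otimes> b) ` (?H \<times> ?B))" using finite_ball by blast
    moreover have "\<Gamma> \<subseteq> (\<lambda>(k, b). k \<otimes> b) ` (?H \<times> ?B)"
    proof
      fix g assume "g \<in> \<Gamma>"
      from near[OF this] obtain k b where "k \<in> ?H" "b \<in> ?B" "g = k \<otimes> b" by blast
      then show "g \<in> (\<lambda>(k, b). k \<otimes> b) ` (?H \<times> ?B)" by (intro image_eqI[of _ _ "(k, b)"]) auto
    qed
    ultimately show False using inf finite_subset by blast
  qed
  moreover have "finite (rcosets\<^bsub>G\<lparr>carrier := \<Gamma>\<rparr>\<^esub> ?H)"
  proof (rule finite_subset)
    show "rcosets\<^bsub>G\<lparr>carrier := \<Gamma>\<rparr>\<^esub> ?H \<subseteq> (\<lambda>b. ?H #> b) ` ?B"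
    proof
      fix C assume "C \<in> rcosets\<^bsub>G\<lparr>carrier := \<Gamma>\<rparr>\<^esub> ?H"
      then obtain g where g: "g \<in> \<Gamma>" "C = ?H #> g" by (auto simp: RCOSETS_def r_coset_def)
      from near[OF g(1)] obtain k b where kb: "k \<in> ?H" "b \<in> ?B" "g = k \<otimes> b" by blast
      have "g \<in> ?H #> b" using kb by (auto simp: r_coset_def)
      then have "?H #> b = ?H #> g" using kb H by (intro repr_independence) auto
      then show "C \<in> (\<lambda>b. ?H #> b) ` ?B" using g kb by auto
    qed
  qed (use finite_ball in blast)
  ultimately show ?thesis using h by (auto simp: virtually_infinite_cyclic_def)
qed

text \<open>Seen from 1, \<open>h\<close> and \<open>inv h\<close> diverge and so do
  \<open>inv h\<close> and \<open>g\<close>, but \<open>h\<close> and \<open>g\<close> may share up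
  to half of \<open>h\<close>. The base point moves along [1, h] to the point \<open>c\<close> where
  \<open>g\<close> branches off; from there all three legs are long and pairwise divergent.\<close>

lemma recentred_tripod:
  assumes h: "h \<in> \<Gamma>" and g: "g \<in> \<Gamma>"
    and hh: "gp h (inv h) \<le> e" and hg: "gp (inv h) g \<le> e + \<delta>" and s: "gp h g \<le> real (len h) / 2"
    and big: "2 * E + 4 \<le> len h" "E + len h \<le> len g"
  obtains c where "c \<in> \<Gamma>" "E \<le> len (inv c \<otimes> h)" "E \<le> len (inv c \<otimes> inv h)" "E \<le> len (inv c \<otimes> g)"
    "gp (inv c \<otimes> h) (inv c \<otimes> inv h) \<le> e + 2 * \<delta> + 1" "gp (inv c \<otimes> h) (inv c \<otimes> g) \<le> e + 2 * \<delta> + 1"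
    "gp (inv c \<otimes> inv h) (inv c \<otimes> g) \<le> e + 2 * \<delta> + 1"
proof -
  define n where "n = nat \<lceil>gp h g\<rceil>"
  have n: "gp h g \<le> n" "n < gp h g + 1" unfolding n_def using gp_nonneg[OF h g] by linarith+
  have "n \<le> len h" using n s big by linarith
  then obtain c where c: "c \<in> \<Gamma>" "len c = n" "len (inv c \<otimes> h) = len h - n"
    using prefix[OF h] by blast
  have ch: "real (len (inv c \<otimes> h)) = len h - real n" using c \<open>n \<le> len h\<close> by simp
  \<comment> \<open>On the geodesic to \<open>h\<close>, \<open>c\<close> lies just beyond the depth
    \<open>gp h g\<close>, so \<open>gp c h = n\<close> is not the smaller of the two products and
    \<open>gp c g\<close> is at least \<open>gp h g - \<delta>\<close>.\<close>
  have cg: "len (inv c \<otimes> g) \<le> real n + len g - 2 * gp h g + 2 * \<delta>"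
    using gp_hyp[OF c(1) h g] n ch c by (simp add: gp_def[of c])
  have ci: "len (inv c \<otimes> inv h) \<le> real n + len h"
    using len_mult[of "inv c" "inv h"] c h by (simp add: len_inv)
  have e0: "0 \<le> e" using hh gp_nonneg[of h "inv h"] h by simp
  note d = delta_nonneg
  have gp_c: "gp (inv c \<otimes> x) (inv c \<otimes> y) = (real (len (inv c \<otimes> x)) + len (inv c \<otimes> y) - len (inv x \<otimes> y)) / 2"
    if "x \<in> \<Gamma>" "y \<in> \<Gamma>" for x y
    using that c unfolding gp_def by (simp add: inv_mult_cancel)
  have hhe: "len (inv h \<otimes> inv h) \<ge> 2 * real (len h) - 2 * e"
    using hh h by (simp add: gp_def len_inv)
  have hg': "len (inv h \<otimes> g) = len h + len g - 2 * gp h g" by (simp add: gp_def field_simps)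
  have ihg: "len (inv (inv h) \<otimes> g) \<ge> len h + len g - 2 * (e + \<delta>)"
    using hg h by (simp add: gp_def len_inv)
  show ?thesis
  proof (rule that[OF c(1)])
    show "E \<le> len (inv c \<otimes> h)" using ch n s big by linarith
    have "len (inv h) \<le> len c + len (inv (inv h) \<otimes> c)" using len_diff[of "inv h" c] c h by simp
    then show "E \<le> len (inv c \<otimes> inv h)" 
      using len_dist_sym[of "inv h" c] len_inv[OF h] c h n s big by simp
    have "len g \<le> len c + len (inv g \<otimes> c)" using len_diff[of g c] c g by simp
    then show "E \<le> len (inv c \<otimes> g)" 
      using len_dist_sym[of g c] c g n s big by simp
    show "gp (inv c \<otimes> h) (inv c \<otimes> inv h) \<le> e + 2 * \<delta> + 1"
      using gp_c[of h "inv h"] h ch ci hhe e0 d by simp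
    show "gp (inv c \<otimes> h) (inv c \<otimes> g) \<le> e + 2 * \<delta> + 1"
      using gp_c[of h g] h g ch cg hg' e0 d by simp
    show "gp (inv c \<otimes> inv h) (inv c \<otimes> g) \<le> e + 2 * \<delta> + 1"
      using gp_c[of "inv h" g] h g ci cg ihg n e0 d by (simp add: field_simps)
  qed
qed

text \<open>The first two legs are \<open>h\<close> and \<open>inv h\<close>. If one of them
  shortened every long element, \<Gamma> would be virtually cyclic; an element \<open>g\<close> that
  neither shortens gives the third leg. Not being shortened bounds both of its products by half of
  \<open>len h\<close>, and one of them is bounded independently of \<open>h\<close> because
  \<open>h\<close> and \<open>inv h\<close> diverge.\<close>

lemma tripod:
  assumes inf: "infinite \<Gamma>" and nvc: "\<not> virtually_infinite_cyclic G \<Gamma>"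
  obtains x y z where "x \<in> \<Gamma>" "y \<in> \<Gamma>" "z \<in> \<Gamma>" "E \<le> len x" "E \<le> len y" "E \<le> len z"
    "gp x y \<le> 6 * \<delta> + 2" "gp x z \<le> 6 * \<delta> + 2" "gp y z \<le> 6 * \<delta> + 2"
proof -
  define e where "e = 4 * \<delta> + 1"
  obtain h where h: "h \<in> \<Gamma>" "2 * E + 4 \<le> len h" "gp h (inv h) \<le> e"
    unfolding e_def by (rule axial_element[OF inf])
  have "\<not> (\<forall>g\<in>\<Gamma>. E + len h < len g \<longrightarrow> len (inv h \<otimes> g) < len g \<or> len (h \<otimes> g) < len g)"
    using virtually_cyclicI[OF inf h(1), of "E + len h"] nvc by blast
  then obtain g where g: "g \<in> \<Gamma>" "E + len h \<le> len g" "len g \<le> len (inv h \<otimes> g)" "len g \<le> len (h \<otimes> g)"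
    by (metis not_less less_imp_le)
  have half: "gp h g \<le> real (len h) / 2" "gp (inv h) g \<le> real (len h) / 2"
    using g h by (auto simp: gp_def len_inv)
  have e: "e + 2 * \<delta> + 1 = 6 * \<delta> + 2" by (simp add: e_def)
  have "gp h g \<le> e + \<delta> \<or> gp (inv h) g \<le> e + \<delta>"
    using gp_hyp[of h g "inv h"] h g by (auto simp: gp_sym[of g "inv h"])
  then show ?thesis
  proof
    assume "gp (inv h) g \<le> e + \<delta>"
    from recentred_tripod[OF h(1) g(1) h(3) this half(1) h(2) g(2)] that show ?thesis
      unfolding e using h g by (metis closed)
  next
    \<comment> \<open>The mirrored case, with \<open>inv h\<close> in the role of
      \<open>h\<close>.\<close>
    assume *: "gp h g \<le> e + \<delta>"
    have "gp (inv h) (inv (inv h)) \<le> e" using h by (simp add: gp_sym)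
    from recentred_tripod[OF closed(2)[OF h(1)] g(1) this, of E] * half(2) h g len_inv[OF h(1)] that show ?thesis
      unfolding e by (metis closed inv_inv carrier)
  qed
qed

end

section \<open>Orbit counting from overlapping shadows\<close>

text \<open>The sum of the measures is the integral of the number of sets that contain a given
  point.\<close>

lemma sum_measure_bounded_multiplicity:
  assumes M: "finite_measure M" and J: "finite J" and A: "\<And>j. j \<in> J \<Longrightarrow> A j \<in> sets M"
    and N: "\<And>x. card {j \<in> J. x \<in> A j} \<le> N"
  shows "(\<Sum>j\<in>J. measure M (A j)) \<le> real N * measure M (space M)"
proof -
  interpret finite_measure M by (rule M)
  have "(\<Sum>j\<in>J. measure M (A j)) = (\<integral>x. (\<Sum>j\<in>J. indicator (A j) x) \<partial>M)"
    using A by (subst Bochner_Integration.integral_sum) (auto intro!: sum.cong simp: less_top[symmetric])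
  also have "\<dots> \<le> (\<integral>x. real N \<partial>M)"
  proof (rule integral_mono)
    show "integrable M (\<lambda>x. \<Sum>j\<in>J. indicator (A j) x :: real)"
      using A by (intro Bochner_Integration.integrable_sum) (auto simp: less_top[symmetric])
    fix x
    have "(\<Sum>j\<in>J. indicator (A j) x :: real) = real (card {j \<in> J. x \<in> A j})"
      using J by (simp add: indicator_def sum.If_cases Int_def)
    then show "(\<Sum>j\<in>J. indicator (A j) x) \<le> real N" using N[of x] by simp
  qed simp
  finally show ?thesis by (simp add: mult.commute)
qed

context hyperbolic_group
begin

text \<open>The same three legs serve for all \<open>g\<close>: if \<open>g\<close> shared more than
  7\<delta> + 2 with two of them, those two would share more than 6\<delta> + 2. Hence at least two
  legs diverge from \<open>g\<close>.\<close>

lemma two_branches: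
  assumes inf: "infinite \<Gamma>" and nvc: "\<not> virtually_infinite_cyclic G \<Gamma>"
  shows "\<exists>F. finite F \<and> F \<subseteq> \<Gamma> \<and> (\<forall>k\<in>F. E \<le> real (len k)) \<and>
    (\<forall>g\<in>\<Gamma>. \<exists>x\<in>F. \<exists>y\<in>F. gp g x \<le> 7 * \<delta> + 2 \<and> gp g y \<le> 7 * \<delta> + 2 \<and> gp x y \<le> 6 * \<delta> + 2)"
proof -
  obtain x y z where xyz: "x \<in> \<Gamma>" "y \<in> \<Gamma>" "z \<in> \<Gamma>"
    "nat \<lceil>E\<rceil> \<le> len x" "nat \<lceil>E\<rceil> \<le> len y" "nat \<lceil>E\<rceil> \<le> len z"
    "gp x y \<le> 6 * \<delta> + 2" "gp x z \<le> 6 * \<delta> + 2" "gp y z \<le> 6 * \<delta> + 2"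
    by (rule tripod[OF inf nvc])
  show ?thesis
  proof (intro exI[of _ "{x, y, z}"] conjI ballI)
    show "E \<le> real (len k)" if "k \<in> {x, y, z}" for k using that xyz by (auto simp: nat_le_iff ceiling_le_iff)
    fix g assume g: "g \<in> \<Gamma>"
    have 1: "gp g x \<le> 7 * \<delta> + 2 \<or> gp g y \<le> 7 * \<delta> + 2"
      and 2: "gp g x \<le> 7 * \<delta> + 2 \<or> gp g z \<le> 7 * \<delta> + 2"
      and 3: "gp g y \<le> 7 * \<delta> + 2 \<or> gp g z \<le> 7 * \<delta> + 2"
      using gp_hyp[of x g y] gp_hyp[of x g z] gp_hyp[of y g z] xyz g gp_sym[of g x] gp_sym[of g y] by auto
    then show "\<exists>x'\<in>{x,y,z}. \<exists>y'\<in>{x,y,z}. gp g x' \<le> 7 * \<delta> + 2 \<and> gp g y' \<le> 7 * \<delta> + 2 \<and> gp x' y' \<le> 6 * \<delta> + 2"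
      using xyz(7-9) by blast
  qed (use xyz in auto)
qed

text \<open>A product \<open>gp g z\<close> close to \<open>len g\<close> means that
  \<open>g\<close> is near a geodesic from 1 to \<open>z\<close>. So this is the union of the
  shadows of all elements behind \<open>g\<close>, with tolerance \<open>K\<close>; its measure is
  the m(g) of the overview.\<close>

definition wide :: "('a \<Rightarrow> 'x set) \<Rightarrow> real \<Rightarrow> 'a \<Rightarrow> 'x set" where
  "wide sh K g = (\<Union>z\<in>{z \<in> \<Gamma>. real (len g) - K \<le> gp g z}. sh z)"

lemma countable_\<Gamma>: "countable \<Gamma>"
proof -
  have "\<Gamma> = (\<Union>n. {x \<in> \<Gamma>. len x \<le> n})" by auto
  also have "countable \<dots>" using finite_ball by (intro countable_UN) (auto intro: countable_finite)
  finally show ?thesis .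
qed

text \<open>
  The levels of the wide shadow's mass replace the levels of \<open>len\<close>: among two disjoint branches one
  halves the mass, so passing to it separates the shadows of elements in the same level.
\<close>

lemma branch_selection:
  fixes sh :: "'a \<Rightarrow> 'x set"
  assumes inf: "infinite \<Gamma>" and nvc: "\<not> virtually_infinite_cyclic G \<Gamma>"
    and M: "finite_measure M" and sh: "\<And>g. g \<in> \<Gamma> \<Longrightarrow> sh g \<in> sets M"
    and R: "0 \<le> R" and meet: "\<And>g h. g \<in> \<Gamma> \<Longrightarrow> h \<in> \<Gamma> \<Longrightarrow> sh g \<inter> sh h \<noteq> {} \<Longrightarrow>
      min (real (len g)) (real (len h)) - R \<le> gp g h"
  shows "\<exists>F \<kappa> K B. finite F \<and> F \<subseteq> \<Gamma> \<and> (\<forall>g\<in>\<Gamma>. \<kappa> g \<in> F) \<and> 0 \<le> K \<and>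
    (\<forall>g\<in>\<Gamma>. \<forall>h\<in>\<Gamma>. sh (g \<otimes> \<kappa> g) \<inter> sh (h \<otimes> \<kappa> h) \<noteq> {} \<longrightarrow>
      measure M (wide sh K g) < 2 * measure M (wide sh K h) \<longrightarrow>
      measure M (wide sh K h) < 2 * measure M (wide sh K g) \<longrightarrow> len (inv g \<otimes> h) \<le> B)"
proof -
  interpret finite_measure M by (rule M)
  \<comment> \<open>\<open>D\<close> bounds the backtracking from \<open>g\<close> to
    \<open>g \<otimes> k\<close>, \<open>K1\<close> and \<open>K2\<close> are the tolerances behind
    \<open>g\<close> and behind \<open>g \<otimes> k\<close>, and \<open>E\<close> makes the
    branches longer than the sum of all errors in the disjointness argument below.\<close>
  define D where "D = 7 * \<delta> + 2"
  define K1 where "K1 = D + \<delta>"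
  define K2 where "K2 = R + 2 * \<delta>"
  define E where "E = 6 * \<delta> + 2 + 2 * D + K2 + R + 2 * \<delta> + 1"
  note d = delta_nonneg
  have DE: "0 \<le> D" "D + K2 \<le> E" "2 * D \<le> E" "6 * \<delta> + 2 + 2 * D + K2 + R + 2 * \<delta> < E"
    using d R by (auto simp: E_def D_def K2_def)
  obtain F where F0: "finite F \<and> F \<subseteq> \<Gamma> \<and> (\<forall>k\<in>F. E \<le> real (len k)) \<and>
      (\<forall>g\<in>\<Gamma>. \<exists>x\<in>F. \<exists>y\<in>F. gp g x \<le> D \<and> gp g y \<le> D \<and> gp x y \<le> 6 * \<delta> + 2)"
    using two_branches[OF inf nvc, of E] unfolding D_def by (elim exE)
  have F: "finite F" "F \<subseteq> \<Gamma>" "\<And>k. k \<in> F \<Longrightarrow> E \<le> real (len k)"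
    "\<And>g. g \<in> \<Gamma> \<Longrightarrow> \<exists>x\<in>F. \<exists>y\<in>F. gp g x \<le> D \<and> gp g y \<le> D \<and> gp x y \<le> 6 * \<delta> + 2"
    using F0 by blast+
  have wide_sets: "wide sh K g \<in> sets M" for K g
    unfolding wide_def using sh countable_\<Gamma> by (intro sets.countable_UN'') (auto intro: countable_subset)
  \<comment> \<open>Two legs that diverge from \<open>inv g\<close> extend \<open>g\<close> almost
    without backtracking. Their wide shadows are disjoint subsets of that of \<open>g\<close>, so
    one of them has at most half of its mass.\<close>
  have "\<exists>k\<in>F. gp (inv g) k \<le> D \<and> 2 * measure M (wide sh K2 (g \<otimes> k)) \<le> measure M (wide sh K1 g)"
    if g: "g \<in> \<Gamma>" for g
  proof -
    obtain x y where xy: "x \<in> F" "y \<in> F" "gp (inv g) x \<le> D" "gp (inv g) y \<le> D" "gp x y \<le> 6 * \<delta> + 2"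
      using F(4)[of "inv g"] g by blast
    then have xy\<Gamma>: "x \<in> \<Gamma>" "y \<in> \<Gamma>" using F by auto
    have sub1: "wide sh K2 (g \<otimes> k) \<subseteq> wide sh K1 g" if k: "k \<in> F" "gp (inv g) k \<le> D" for k
    proof -
      have "k \<in> \<Gamma>" using k F by auto
      have "real (len g) - K1 \<le> gp g z" if z: "z \<in> \<Gamma>" "real (len (g \<otimes> k)) - K2 \<le> gp (g \<otimes> k) z" for z
        using gp_hyp[OF g closed(1)[OF g \<open>k \<in> \<Gamma>\<close>] z(1)] gp_mult_self[OF g \<open>k \<in> \<Gamma>\<close>]
          len_mult_gp[OF g \<open>k \<in> \<Gamma>\<close>] z(2) k(2) F(3)[OF k(1)] DE unfolding K1_def by linarith
      then show ?thesis by (auto simp: wide_def)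
    qed
    have gx: "g \<otimes> x \<in> \<Gamma>" and gy: "g \<otimes> y \<in> \<Gamma>" using g xy\<Gamma> by auto
    have lx: "len (g \<otimes> x) \<ge> len g + E - 2 * D" "len (g \<otimes> y) \<ge> len g + E - 2 * D"
      using len_mult_gp[OF g xy\<Gamma>(1)] len_mult_gp[OF g xy\<Gamma>(2)] xy F(3)[OF xy(1)] F(3)[OF xy(2)] by linarith+
    have gxy: "gp (g \<otimes> x) (g \<otimes> y) \<le> len g + (6 * \<delta> + 2)"
      using gp_mult[OF g xy\<Gamma>] gp_nonneg[of "inv g" x] gp_nonneg[of "inv g" y] g xy\<Gamma> xy(5) by simp
    \<comment> \<open>If the shadows of some \<open>a\<close> behind \<open>g \<otimes> x\<close>
      and \<open>b\<close> behind \<open>g \<otimes> y\<close> met, the product of \<open>a\<close>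
      and \<open>b\<close> would be large, and then that of \<open>g \<otimes> x\<close> and
      \<open>g \<otimes> y\<close> too; but the legs part near \<open>g\<close>, which is
      \<open>gxy\<close>.\<close>
    have "wide sh K2 (g \<otimes> x) \<inter> wide sh K2 (g \<otimes> y) = {}"
    proof (rule ccontr)
      assume "\<not> ?thesis"
      then obtain a b where ab: "a \<in> \<Gamma>" "b \<in> \<Gamma>" "sh a \<inter> sh b \<noteq> {}"
        "len (g \<otimes> x) - K2 \<le> gp (g \<otimes> x) a" "len (g \<otimes> y) - K2 \<le> gp (g \<otimes> y) b"
        unfolding wide_def by blast
      have la: "gp (g \<otimes> x) a \<le> len a" "gp (g \<otimes> y) b \<le> len b" using g xy\<Gamma> ab by (auto intro: gp_le)
      have "gp (g \<otimes> x) b \<ge> len g + E - 2 * D - K2 - R - \<delta>"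
        using gp_hyp[OF gx ab(1,2)] meet[OF ab(1-3)] ab(4,5) la lx R d by linarith
      then have "gp (g \<otimes> x) (g \<otimes> y) \<ge> len g + E - 2 * D - K2 - R - 2 * \<delta>"
        using gp_hyp[OF gx ab(2) gy] gp_sym[OF ab(2) gy] ab(5) lx R d by linarith
      then show False using gxy DE by linarith
    qed
    then have "measure M (wide sh K2 (g \<otimes> x)) + measure M (wide sh K2 (g \<otimes> y))
        = measure M (wide sh K2 (g \<otimes> x) \<union> wide sh K2 (g \<otimes> y))"
      using wide_sets by (intro finite_measure_Union[symmetric]) auto
    also have "\<dots> \<le> measure M (wide sh K1 g)"
      using wide_sets sub1[OF xy(1,3)] sub1[OF xy(2,4)] by (intro finite_measure_mono) auto
    finally have "2 * measure M (wide sh K2 (g \<otimes> x)) \<le> measure M (wide sh K1 g) \<or>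
      2 * measure M (wide sh K2 (g \<otimes> y)) \<le> measure M (wide sh K1 g)" by linarith
    then show ?thesis using xy by blast
  qed
  then obtain \<kappa> where \<kappa>: "\<And>g. g \<in> \<Gamma> \<Longrightarrow> \<kappa> g \<in> F" "\<And>g. g \<in> \<Gamma> \<Longrightarrow> gp (inv g) (\<kappa> g) \<le> D"
    "\<And>g. g \<in> \<Gamma> \<Longrightarrow> 2 * measure M (wide sh K2 (g \<otimes> \<kappa> g)) \<le> measure M (wide sh K1 g)"
    by metis
  have \<kappa>\<Gamma>: "\<kappa> g \<in> \<Gamma>" if "g \<in> \<Gamma>" for g using \<kappa>(1)[OF that] F by auto
  define L where "L = Max (insert 0 (len ` F))"
  have L: "len (\<kappa> g) \<le> L" if "g \<in> \<Gamma>" for g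
    using \<kappa>(1)[OF that] F(1) by (auto simp: L_def intro: Max_ge)
  \<comment> \<open>\<open>B0\<close> bounds the excess of \<open>len h\<close> over
    \<open>len g\<close>; \<open>B\<close> also allows for the branch elements, of length at most
    \<open>L\<close>, and for the error \<open>R\<close> in the overlap estimate.\<close>
  define B0 where "B0 = L + K1 + D"
  define B where "B = nat \<lceil>B0 + 4 * real L + 2 * R\<rceil>"
  have B0: "L + K1 \<le> B0" "L + D \<le> B0" using d DE by (auto simp: B0_def K1_def)
  have main: "len (inv g \<otimes> h) \<le> B" if g: "g \<in> \<Gamma>" and h: "h \<in> \<Gamma>"
    and ne: "sh (g \<otimes> \<kappa> g) \<inter> sh (h \<otimes> \<kappa> h) \<noteq> {}"
    and lt: "measure M (wide sh K1 g) < 2 * measure M (wide sh K1 h)" and le: "len g \<le> len h" for g h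
  proof -
    let ?k = "\<kappa> g" and ?l = "\<kappa> h"
    have kl: "?k \<in> \<Gamma>" "?l \<in> \<Gamma>" using \<kappa>\<Gamma> g h by auto
    have gk: "g \<otimes> ?k \<in> \<Gamma>" and hl: "h \<otimes> ?l \<in> \<Gamma>" using g h kl by auto
    have lk: "len (g \<otimes> ?k) \<le> len g + L" using len_mult[OF g kl(1)] L[OF g] by linarith
    have ll: "len (h \<otimes> ?l) \<le> len h + L" using len_mult[OF h kl(2)] L[OF h] by linarith
    have ll': "len (h \<otimes> ?l) \<ge> len h"
      using len_mult_gp[OF h kl(2)] \<kappa>(2)[OF h] F(3)[OF \<kappa>(1)[OF h]] DE by linarith
    have lk': "len (g \<otimes> ?k) \<ge> len g"
      using len_mult_gp[OF g kl(1)] \<kappa>(2)[OF g] F(3)[OF \<kappa>(1)[OF g]] DE by linarith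
    have m: "min (real (len (g \<otimes> ?k))) (real (len (h \<otimes> ?l))) - R \<le> gp (g \<otimes> ?k) (h \<otimes> ?l)"
      using meet[OF _ _ ne] g h kl by auto
    \<comment> \<open>This is where masses replace lengths: a much longer \<open>h\<close> would
      have its wide shadow inside that of \<open>g \<otimes> \<kappa> g\<close>, hence at most half
      of the mass belonging to \<open>g\<close>.\<close>
    have near: "len h \<le> len g + B0"
    proof (rule ccontr)
      assume far: "\<not> ?thesis"
      have "gp (g \<otimes> ?k) h \<ge> len (g \<otimes> ?k) - R - \<delta>"
        using gp_hyp[OF gk hl h] gp_sym[OF hl h] gp_mult_self[OF h kl(2)]
          m \<kappa>(2)[OF h] far lk ll' R B0 DE(1) d by linarith
      then have "real (len (g \<otimes> ?k)) - K2 \<le> gp (g \<otimes> ?k) z"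
        if "z \<in> \<Gamma>" "real (len h) - K1 \<le> gp h z" for z
        using gp_hyp[OF gk h that(1)] that(2) far lk R d B0 unfolding K2_def by linarith
      then have "wide sh K1 h \<subseteq> wide sh K2 (g \<otimes> ?k)" by (auto simp: wide_def)
      then have "measure M (wide sh K1 h) \<le> measure M (wide sh K2 (g \<otimes> ?k))"
        using wide_sets by (intro finite_measure_mono)
      then show False using \<kappa>(3)[OF g] lt by linarith
    qed
    \<comment> \<open>Once the lengths are comparable, a Gromov product within \<open>R\<close> of
      the smaller length leaves only a bounded distance.\<close>
    have "len (inv (g \<otimes> ?k) \<otimes> (h \<otimes> ?l)) \<le> B0 + 2 * real L + 2 * R"
    proof (cases "len (g \<otimes> ?k) \<le> len (h \<otimes> ?l)")
      case True
      then show ?thesis using m lk ll lk' ll' near le R unfolding gp_def by simp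
    next
      case False
      then show ?thesis using m lk ll lk' ll' near le R d B0 DE(1) unfolding gp_def K1_def by simp
    qed
    moreover have "len (inv g \<otimes> h) \<le> len (inv g \<otimes> (g \<otimes> ?k)) + len (inv (g \<otimes> ?k) \<otimes> (h \<otimes> ?l)) + len (inv (h \<otimes> ?l) \<otimes> h)"
      using len_dist_tri[OF g gk h] len_dist_tri[OF gk hl h] by linarith
    moreover have "inv g \<otimes> (g \<otimes> ?k) = ?k" "inv h \<otimes> (h \<otimes> ?l) = ?l"
      using g h kl by (auto simp: m_assoc[symmetric])
    ultimately have "len (inv g \<otimes> h) \<le> B0 + 4 * real L + 2 * R"
      using L[OF g] L[OF h] len_dist_sym[OF h hl] by simp
    then show ?thesis unfolding B_def by linarith
  qed
  show ?thesis
  proof (intro exI[of _ F] exI[of _ \<kappa>] exI[of _ K1] exI[of _ B] conjI ballI impI F(1,2) \<kappa>(1))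
    show "0 \<le> K1" using DE d by (simp add: K1_def)
    fix g h assume *: "g \<in> \<Gamma>" "h \<in> \<Gamma>" "sh (g \<otimes> \<kappa> g) \<inter> sh (h \<otimes> \<kappa> h) \<noteq> {}"
      "measure M (wide sh K1 g) < 2 * measure M (wide sh K1 h)"
      "measure M (wide sh K1 h) < 2 * measure M (wide sh K1 g)"
    show "len (inv g \<otimes> h) \<le> B"
      using main[of g h] main[of h g] * len_dist_sym[of g h] by (cases "len g \<le> len h") (auto simp: Int_commute)
  qed
qed

text \<open>On one mass level the branch shadows have bounded multiplicity, so the weights
  \<open>w\<close> of the level have a bounded sum. An element with weight above
  \<open>exp (- T)\<close> contributes more than \<open>exp (- T)\<close> to the sum of its level,
  and only O(1 + T) levels contain such elements. In the application \<open>w g\<close> is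
  \<open>exp (- \<phi> (cp g))\<close>.\<close>

lemma orbit_counting:
  fixes sh :: "'a \<Rightarrow> 'x set" and w :: "'a \<Rightarrow> real"
  assumes inf: "infinite \<Gamma>" and nvc: "\<not> virtually_infinite_cyclic G \<Gamma>"
    and M: "finite_measure M" and sh: "\<And>g. g \<in> \<Gamma> \<Longrightarrow> sh g \<in> sets M"
    and R: "0 \<le> R" and meet: "\<And>g h. g \<in> \<Gamma> \<Longrightarrow> h \<in> \<Gamma> \<Longrightarrow> sh g \<inter> sh h \<noteq> {} \<Longrightarrow>
      min (real (len g)) (real (len h)) - R \<le> gp g h"
    and w: "\<And>g. g \<in> \<Gamma> \<Longrightarrow> 0 < w g" and C: "0 < C" "\<And>g. g \<in> \<Gamma> \<Longrightarrow> w g \<le> C * measure M (sh g)"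
    and wk: "\<And>k. k \<in> \<Gamma> \<Longrightarrow> \<exists>c. \<forall>g\<in>\<Gamma>. w g \<le> c * w (g \<otimes> k)"
  obtains A where "\<And>T. 0 \<le> T \<Longrightarrow> finite {g \<in> \<Gamma>. exp (- T) < w g}"
    "\<And>T. 0 \<le> T \<Longrightarrow> card {g \<in> \<Gamma>. exp (- T) < w g} \<le> A * (1 + T) * exp T"
proof -
  interpret finite_measure M by (rule M)
  have "\<exists>F \<kappa> K B. finite F \<and> F \<subseteq> \<Gamma> \<and> (\<forall>g\<in>\<Gamma>. \<kappa> g \<in> F) \<and> 0 \<le> K \<and>
    (\<forall>g\<in>\<Gamma>. \<forall>h\<in>\<Gamma>. sh (g \<otimes> \<kappa> g) \<inter> sh (h \<otimes> \<kappa> h) \<noteq> {} \<longrightarrow>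
      measure M (wide sh K g) < 2 * measure M (wide sh K h) \<longrightarrow>
      measure M (wide sh K h) < 2 * measure M (wide sh K g) \<longrightarrow> len (inv g \<otimes> h) \<le> B)"
    by (rule branch_selection[OF inf nvc M sh R meet])
  then obtain F \<kappa> K B where F0: "finite F \<and> F \<subseteq> \<Gamma> \<and> (\<forall>g\<in>\<Gamma>. \<kappa> g \<in> F) \<and> 0 \<le> K \<and>
    (\<forall>g\<in>\<Gamma>. \<forall>h\<in>\<Gamma>. sh (g \<otimes> \<kappa> g) \<inter> sh (h \<otimes> \<kappa> h) \<noteq> {} \<longrightarrow>
      measure M (wide sh K g) < 2 * measure M (wide sh K h) \<longrightarrow>
      measure M (wide sh K h) < 2 * measure M (wide sh K g) \<longrightarrow> len (inv g \<otimes> h) \<le> B)"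
    by (elim exE)
  have F: "finite F" "F \<subseteq> \<Gamma>" and \<kappa>: "\<And>g. g \<in> \<Gamma> \<Longrightarrow> \<kappa> g \<in> F" and K: "0 \<le> K"
    and sep: "\<And>g h. g \<in> \<Gamma> \<Longrightarrow> h \<in> \<Gamma> \<Longrightarrow> sh (g \<otimes> \<kappa> g) \<inter> sh (h \<otimes> \<kappa> h) \<noteq> {} \<Longrightarrow>
      measure M (wide sh K g) < 2 * measure M (wide sh K h) \<Longrightarrow>
      measure M (wide sh K h) < 2 * measure M (wide sh K g) \<Longrightarrow> len (inv g \<otimes> h) \<le> B"
    using F0 by blast+
  obtain c where c: "\<And>k g. k \<in> \<Gamma> \<Longrightarrow> g \<in> \<Gamma> \<Longrightarrow> w g \<le> c k * w (g \<otimes> k)" using wk by metis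
  \<comment> \<open>One constant for all branch moves, as \<open>\<kappa>\<close> takes values in
    the finite set \<open>F\<close>; the inserted 1 keeps it positive.\<close>
  define c' where "c' = Max (insert 1 (c ` F))"
  have c'1: "1 \<le> c'" using F(1) by (simp add: c'_def)
  have c': "w g \<le> c' * w (g \<otimes> \<kappa> g)" if g: "g \<in> \<Gamma>" for g
  proof -
    have "c (\<kappa> g) \<le> c'" using F(1) \<kappa>[OF g] by (simp add: c'_def)
    then show ?thesis using c[of "\<kappa> g" g] w[of "g \<otimes> \<kappa> g"] g \<kappa>[OF g] F(2)
      by (meson closed(1) mult_right_mono order_trans less_imp_le subsetD)
  qed
  define m where "m g = measure M (wide sh K g)" for g
  have wide_sets: "wide sh K g \<in> sets M" for g
    unfolding wide_def using sh countable_\<Gamma> by (intro sets.countable_UN'') (auto intro: countable_subset)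
  have wm: "w g \<le> C * m g" if g: "g \<in> \<Gamma>" for g
  proof -
    have "sh g \<subseteq> wide sh K g" using g K gp_self[OF g] by (auto simp: wide_def)
    then have "measure M (sh g) \<le> m g" unfolding m_def using wide_sets by (intro finite_measure_mono)
    then show ?thesis using C g by (meson mult_left_mono order_trans less_imp_le)
  qed
  have mpos: "0 < m g" if "g \<in> \<Gamma>" for g
    using wm[OF that] w[OF that] C(1) by (smt (verit) mult_nonneg_nonpos)
  \<comment> \<open>The dyadic level of the mass: equal levels mean masses within a factor of
    two.\<close>
  define lev where "lev g = \<lfloor>log 2 (m g)\<rfloor>" for g
  have lev: "m g < 2 * m h" if "g \<in> \<Gamma>" "h \<in> \<Gamma>" "lev g = lev h" for g h
  proof -
    have "log 2 (m g) < 1 + log 2 (m h)" using that(3) unfolding lev_def by linarith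
    also have "\<dots> = log 2 (2 * m h)" using mpos[OF that(2)] by (simp add: log_mult)
    finally show ?thesis using mpos that by simp
  qed
  define N where "N = card {x \<in> \<Gamma>. len x \<le> B}"
  define Q where "Q = c' * C * (real N * measure M (space M))"
  have Q0: "0 \<le> Q" using c'1 C by (simp add: Q_def)
  have level_sum: "(\<Sum>g\<in>J. w g) \<le> Q" if J: "finite J" "J \<subseteq> {g \<in> \<Gamma>. lev g = t}" for J t
  proof -
    have "card {g \<in> J. x \<in> sh (g \<otimes> \<kappa> g)} \<le> N" for x
    proof (cases "\<exists>g\<in>J. x \<in> sh (g \<otimes> \<kappa> g)")
      case True
      then obtain g where g: "g \<in> J" "x \<in> sh (g \<otimes> \<kappa> g)" by blast
      \<comment> \<open>All elements of the level whose branch shadow contains \<open>x\<close> lie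
        in the ball of radius \<open>B\<close> around one of them.\<close>
      have "{h \<in> J. x \<in> sh (h \<otimes> \<kappa> h)} \<subseteq> (\<lambda>b. g \<otimes> b) ` {x \<in> \<Gamma>. len x \<le> B}"
      proof
        fix h assume h: "h \<in> {h \<in> J. x \<in> sh (h \<otimes> \<kappa> h)}"
        have gh: "g \<in> \<Gamma>" "h \<in> \<Gamma>" "lev g = lev h" using g h J by auto
        have "sh (g \<otimes> \<kappa> g) \<inter> sh (h \<otimes> \<kappa> h) \<noteq> {}" using g h by blast
        then have "len (inv g \<otimes> h) \<le> B"
          using sep gh lev[OF gh(1,2)] lev[OF gh(2,1)] by (simp add: m_def)
        moreover have "h = g \<otimes> (inv g \<otimes> h)" using gh by (simp add: m_assoc[symmetric])
        ultimately show "h \<in> (\<lambda>b. g \<otimes> b) ` {x \<in> \<Gamma>. len x \<le> B}" using gh by blast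
      qed
      from card_mono[OF finite_imageI[OF finite_ball] this] card_image_le[OF finite_ball[of B]]
      show ?thesis unfolding N_def by (rule order_trans)
    next
      case False
      then have e: "{g \<in> J. x \<in> sh (g \<otimes> \<kappa> g)} = {}" by blast
      show ?thesis unfolding e by simp
    qed
    moreover have \<kappa>in: "g \<in> \<Gamma> \<and> g \<otimes> \<kappa> g \<in> \<Gamma>" if "g \<in> J" for g using that J \<kappa>[of g] F(2) by auto
    ultimately have "(\<Sum>g\<in>J. measure M (sh (g \<otimes> \<kappa> g))) \<le> real N * measure M (space M)"
      using J(1) sh by (intro sum_measure_bounded_multiplicity[OF M]) auto
    moreover have "(\<Sum>g\<in>J. w g) \<le> c' * C * (\<Sum>g\<in>J. measure M (sh (g \<otimes> \<kappa> g)))"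
      unfolding sum_distrib_left
    proof (rule sum_mono)
      fix g assume g: "g \<in> J"
      have "w g \<le> c' * w (g \<otimes> \<kappa> g)" using c' \<kappa>in[OF g] by blast
      also have "\<dots> \<le> c' * (C * measure M (sh (g \<otimes> \<kappa> g)))"
        using C(2)[of "g \<otimes> \<kappa> g"] \<kappa>in[OF g] c'1 by (intro mult_left_mono) auto
      finally show "w g \<le> c' * C * measure M (sh (g \<otimes> \<kappa> g))" by (simp add: mult.assoc)
    qed
    ultimately show ?thesis unfolding Q_def using c'1 C(1)
      by (meson mult_left_mono order_trans mult_nonneg_nonneg less_imp_le zero_le_one)
  qed
  define P where "P = measure M (space M)"
  define top where "top = \<lfloor>log 2 (P + 1)\<rfloor>"
  have lev_le: "lev g \<le> top" if "g \<in> \<Gamma>" for g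
  proof -
    have "m g \<le> P" unfolding m_def P_def by (rule bounded_measure)
    then have "log 2 (m g) \<le> log 2 (P + 1)" using mpos[OF that] by simp
    then show ?thesis unfolding lev_def top_def by (rule floor_mono)
  qed
  \<comment> \<open>Collects the constants so that \<open>I\<close> below has at most
    \<open>lc * (1 + T)\<close> elements; \<open>1 / ln 2\<close> is the slope in \<open>T\<close>
    of its lower end.\<close>
  define lc where "lc = \<bar>log 2 C\<bar> + \<bar>log 2 (P + 1)\<bar> + 1 / ln 2 + 3"
  have lc0: "0 \<le> lc" by (simp add: lc_def)
  have count: "finite {g \<in> \<Gamma>. exp (- T) < w g} \<and> card {g \<in> \<Gamma>. exp (- T) < w g} \<le> lc * Q * (1 + T) * exp T"
    if T: "0 \<le> T" for T
  proof -
    define S where "S t = {g \<in> \<Gamma>. exp (- T) < w g \<and> lev g = t}" for t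
    \<comment> \<open>Finiteness is part of the claim, so the bound is proved for finite subsets,
      where \<open>level_sum\<close> applies.\<close>
    have S: "finite (S t) \<and> card (S t) \<le> nat \<lfloor>Q * exp T\<rfloor>" for t
    proof (rule finite_if_finite_subsets_card_bdd)
      fix J assume J: "J \<subseteq> S t" "finite J"
      have "real (card J) * exp (- T) = (\<Sum>g\<in>J. exp (- T))" by simp
      also have "\<dots> \<le> (\<Sum>g\<in>J. w g)" using J by (intro sum_mono) (auto simp: S_def)
      also have "\<dots> \<le> Q" using level_sum[of J t] J by (auto simp: S_def)
      finally have "real (card J) \<le> Q * exp T" by (simp add: exp_minus field_simps)
      then show "card J \<le> nat \<lfloor>Q * exp T\<rfloor>" by linarith
    qed
    \<comment> \<open>Because \<open>w g \<le> C * m g\<close>, the levels start at the binary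
      logarithm of \<open>exp (- T) / C\<close>.\<close>
    define I where "I = {\<lfloor>- T / ln 2 - log 2 C\<rfloor>..top}"
    have eq: "{g \<in> \<Gamma>. exp (- T) < w g} = (\<Union>t\<in>I. S t)"
    proof
      show "{g \<in> \<Gamma>. exp (- T) < w g} \<subseteq> (\<Union>t\<in>I. S t)"
      proof
        fix g assume g: "g \<in> {g \<in> \<Gamma>. exp (- T) < w g}"
        then have "exp (- T) < C * m g" using wm[of g] by auto
        then have "ln (exp (- T)) < ln (C * m g)" by (rule ln_less_cancel_iff[THEN iffD2, rotated 2])
            (use g mpos[of g] C(1) in auto)
        then have "log 2 (exp (- T)) < log 2 (C * m g)" unfolding log_def by (intro divide_strict_right_mono) auto
        then have "- T / ln 2 - log 2 C < log 2 (m g)" using g mpos[of g] C(1)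
          by (simp add: log_def ln_mult add_divide_distrib)
        then have "\<lfloor>- T / ln 2 - log 2 C\<rfloor> \<le> lev g" unfolding lev_def by (intro floor_mono) simp
        then show "g \<in> (\<Union>t\<in>I. S t)" using g lev_le[of g] by (auto simp: I_def S_def)
      qed
    qed (auto simp: S_def)
    have fin: "finite {g \<in> \<Gamma>. exp (- T) < w g}" unfolding eq using S by (auto simp: I_def)
    have "card {g \<in> \<Gamma>. exp (- T) < w g} \<le> (\<Sum>t\<in>I. card (S t))"
      unfolding eq by (rule card_UN_le) (simp add: I_def)
    also have "\<dots> \<le> card I * nat \<lfloor>Q * exp T\<rfloor>" using S sum_bounded_above[of I "\<lambda>t. card (S t)"] by simp
    finally have "real (card {g \<in> \<Gamma>. exp (- T) < w g}) \<le> real (card I) * real (nat \<lfloor>Q * exp T\<rfloor>)"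
      by (metis of_nat_le_iff of_nat_mult)
    also have "\<dots> \<le> (lc * (1 + T)) * (Q * exp T)"
    proof (rule mult_mono)
      have "real (card I) \<le> \<bar>log 2 (P + 1)\<bar> + T / ln 2 + \<bar>log 2 C\<bar> + 2"
      proof -
        have "0 \<le> T / ln 2" using T by simp
        then show ?thesis unfolding I_def top_def card_atLeastAtMost_int by linarith
      qed
      also have "\<dots> \<le> lc * (1 + T)"
        using T by (auto simp: lc_def field_simps)
      finally show "real (card I) \<le> lc * (1 + T)" .
      show "real (nat \<lfloor>Q * exp T\<rfloor>) \<le> Q * exp T" using Q0 by simp
    qed (use lc0 T Q0 in auto)
    finally show ?thesis using fin by (simp add: mult_ac)
  qed
  show ?thesis using that[of "lc * Q"] count by blast
qed

end

section \<open>Singular frames\<close>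

text \<open>Otherwise the simplifier turns the index sets \<open>{1..p}\<close> into \<open>{Suc 0..p}\<close>.\<close>

declare One_nat_def [simp del]

lemma one_le_CARD [simp]: "1 \<le> CARD('n::finite)"
  by (simp add: Suc_leI One_nat_def)

locale scalar_product =
  fixes ip :: "real^'n \<Rightarrow> real^'n \<Rightarrow> real"
  assumes is_sp: "is_scalar_product ip"
begin

section \<open>Elementary geometry of the scalar product\<close>

lemma bilin: "bilinear ip" and ip_sym: "ip v w = ip w v" and ip_pos: "v \<noteq> 0 \<Longrightarrow> 0 < ip v v"
  using is_sp by (auto simp: is_scalar_product_def)

lemma lin_right: "linear (ip v)" and lin_left: "linear (\<lambda>v. ip v w)"
  using bilin by (auto simp: bilinear_def)

lemmas ip_simps [simp] = linear_add[OF lin_right] linear_add[OF lin_left] linear_diff[OF lin_right]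
  linear_diff[OF lin_left] linear_scale[OF lin_right] linear_scale[OF lin_left]
  linear_0[OF lin_right] linear_0[OF lin_left] linear_neg[OF lin_right] linear_neg[OF lin_left]

lemmas ip_sum_right = linear_sum[OF lin_right] and ip_sum_left = linear_sum[OF lin_left]

lemma ip_nonneg [simp]: "0 \<le> ip v v"
  using ip_pos[of v] by (cases "v = 0") auto

lemma ip_eq_0 [simp]: "ip v v = 0 \<longleftrightarrow> v = 0"
  using ip_pos[of v] by fastforce

definition nrm :: "real^'n \<Rightarrow> real" where "nrm v = sqrt (ip v v)"

lemma nrm_nonneg [simp]: "0 \<le> nrm v" and nrm_sq: "(nrm v)\<^sup>2 = ip v v"
  and nrm_pos: "v \<noteq> 0 \<Longrightarrow> 0 < nrm v" and nrm_scale: "nrm (c *\<^sub>R v) = \<bar>c\<bar> * nrm v"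
  by (auto simp: nrm_def ip_pos real_sqrt_mult mult.assoc[symmetric])

lemma Cauchy_Schwarz: "\<bar>ip v w\<bar> \<le> nrm v * nrm w"
proof (cases "w = 0")
  case False
  then have p: "0 < ip w w" by (rule ip_pos)
  define t where "t = ip v w / ip w w"
  have "0 \<le> ip (v - t *\<^sub>R w) (v - t *\<^sub>R w)" by (rule ip_nonneg)
  also have "\<dots> = ip v v - (ip v w)\<^sup>2 / ip w w"
    using p by (simp add: t_def ip_sym[of w v] power2_eq_square field_simps)
  finally have "(ip v w)\<^sup>2 \<le> (nrm v * nrm w)\<^sup>2"
    using p by (simp add: power_mult_distrib nrm_sq field_simps)
  then show ?thesis by (metis abs_le_square_iff abs_of_nonneg mult_nonneg_nonneg nrm_nonneg)
qed (simp add: nrm_def)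

lemma bounded_bilinear_ip: "bounded_bilinear ip"
  using bilin bilinear_conv_bounded_bilinear by blast

lemmas continuous_on_ip [continuous_intros] = bounded_bilinear.continuous_on[OF bounded_bilinear_ip]
lemmas tendsto_ip [tendsto_intros] = bounded_bilinear.tendsto[OF bounded_bilinear_ip]

text \<open>Compactness of the unit sphere: the form attains a positive minimum there.\<close>

lemma norm_le_nrm: obtains c where "0 < c" "\<And>v. norm v \<le> c * nrm v"
proof -
  have "\<exists>x\<in>sphere 0 1. \<forall>y\<in>sphere 0 1. ip x x \<le> ip y (y :: real^'n)"
  proof (rule continuous_attains_inf)
    show "sphere 0 1 \<noteq> ({} :: (real^'n) set)"
      using vector_choose_size[of 1] by force
  qed (auto intro!: continuous_intros)
  then obtain x :: "real^'n" where x: "norm x = 1" "\<And>y. norm y = 1 \<Longrightarrow> ip x x \<le> ip y y" by auto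
  have px: "0 < nrm x" using x(1) nrm_pos[of x] by fastforce
  show ?thesis
  proof (rule that[of "1 / nrm x"])
    fix v :: "real^'n"
    show "norm v \<le> 1 / nrm x * nrm v"
    proof (cases "v = 0")
      case False
      have "nrm x \<le> nrm ((1 / norm v) *\<^sub>R v)"
        unfolding nrm_def by (rule real_sqrt_le_mono) (use x(2)[of "(1 / norm v) *\<^sub>R v"] False in simp)
      then show ?thesis using px False by (simp add: nrm_scale field_simps)
    qed simp
  qed (use px in simp)
qed

definition orthonormal :: "nat \<Rightarrow> (nat \<Rightarrow> real^'n) \<Rightarrow> bool" where
  "orthonormal k u \<longleftrightarrow> (\<forall>i\<in>{1..k}. \<forall>j\<in>{1..k}. ip (u i) (u j) = (if i = j then 1 else 0))"

lemma orthonormal_inj: "orthonormal k u \<Longrightarrow> inj_on u {1..k}"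
  unfolding inj_on_def orthonormal_def by (metis zero_neq_one)

lemma orthonormal_independent:
  assumes u: "orthonormal k u" and I: "I \<subseteq> {1..k}"
  shows "independent (u ` I)"
proof (rule independent_if_scalars_zero)
  fix f x assume z: "(\<Sum>x\<in>u ` I. f x *\<^sub>R x) = 0" and "x \<in> u ` I"
  then obtain i where i: "i \<in> I" "x = u i" by blast
  have inj: "inj_on u I" using orthonormal_inj[OF u] I inj_on_subset by blast
  have "0 = ip (\<Sum>x\<in>u ` I. f x *\<^sub>R x) (u i)" by (simp add: z)
  also have "\<dots> = (\<Sum>j\<in>I. f (u j) * ip (u j) (u i))"
    by (simp add: ip_sum_left sum.reindex[OF inj])
  also have "\<dots> = (\<Sum>j\<in>I. if j = i then f (u i) else 0)"
    using u I i by (intro sum.cong) (auto simp: orthonormal_def subset_eq)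
  also have "\<dots> = f x" using i I finite_subset[OF I] by simp
  finally show "f x = 0" ..
qed (use I finite_subset in auto)

lemma orthonormal_basis:
  assumes u: "orthonormal CARD('n) u"
  shows "is_basis CARD('n) u UNIV"
proof -
  have "card (u ` {1..CARD('n)}) = CARD('n)" using orthonormal_inj[OF u] by (simp add: card_image)
  then have "span (u ` {1..CARD('n)}) = UNIV"
    using orthonormal_independent[OF u order_refl] card_ge_dim_independent[of "u ` {1..CARD('n)}" UNIV] by auto
  then show ?thesis by (simp add: is_basis_UNIV_iff)
qed

lemma ip_span_0: "v \<in> span S \<Longrightarrow> (\<And>x. x \<in> S \<Longrightarrow> ip w x = 0) \<Longrightarrow> ip w v = 0"
  using linear_eq_0_on_span[OF lin_right[of w]] by blast

lemma orthonormal_expansion: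
  assumes u: "orthonormal CARD('n) u"
  shows "(\<Sum>i=1..CARD('n). ip v (u i) *\<^sub>R u i) = v"
proof -
  define r where "r = v - (\<Sum>i=1..CARD('n). ip v (u i) *\<^sub>R u i)"
  have z: "ip r (u j) = 0" if j: "j \<in> {1..CARD('n)}" for j
  proof -
    have "(\<Sum>i=1..CARD('n). ip v (u i) * ip (u i) (u j)) = (\<Sum>i=1..CARD('n). if i = j then ip v (u j) else 0)"
      using u j by (intro sum.cong) (auto simp: orthonormal_def)
    then show ?thesis using j by (simp add: r_def ip_sum_left)
  qed
  have "r \<in> span (u ` {1..CARD('n)})" using orthonormal_basis[OF u] by (simp add: is_basis_def)
  then have "ip r r = 0" by (rule ip_span_0) (use z in blast)
  then have "r = 0" by (simp only: ip_eq_0)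
  then show ?thesis unfolding r_def by simp
qed

lemma ip_expansion:
  assumes u: "orthonormal CARD('n) u"
  shows "ip v w = (\<Sum>i=1..CARD('n). ip v (u i) * ip w (u i))"
  using arg_cong[OF orthonormal_expansion[OF u, of w], of "ip v"] by (simp add: ip_sum_right mult.commute)

text \<open>The equation says that \<open>u i\<close> is an eigenvector of the adjoint of
  \<open>A\<close> times \<open>A\<close>, for the square of \<open>s i\<close>, in a weak form in
  which no adjoint has to be constructed. So the \<open>u i\<close> are right singular
  vectors.\<close>

definition singular_frame :: "real^'n^'n \<Rightarrow> (nat \<Rightarrow> real^'n) \<Rightarrow> (nat \<Rightarrow> real) \<Rightarrow> bool" where
  "singular_frame A u s \<longleftrightarrow> orthonormal CARD('n) u \<and>
     (\<forall>i\<in>{1..CARD('n)}. 0 \<le> s i \<and> (\<forall>w. ip (A *v u i) (A *v w) = (s i)\<^sup>2 * ip (u i) w)) \<and>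
     (\<forall>i\<in>{1..CARD('n)}. \<forall>j\<in>{1..CARD('n)}. i \<le> j \<longrightarrow> s j \<le> s i)"

text \<open>The next vector maximises the quotient of \<open>ip (A *v w) (A *v w)\<close> by
  \<open>ip w w\<close> on the orthogonal complement of the earlier ones. The last conjunct carries
  this maximality along; it makes \<open>s\<close> decreasing.\<close>

lemma partial_singular_frame:
  assumes "k \<le> CARD('n)"
  shows "\<exists>u s. orthonormal k u \<and>
     (\<forall>i\<in>{1..k}. 0 \<le> s i \<and> (\<forall>w. ip (A *v u i) (A *v w) = (s i)\<^sup>2 * ip (u i) w)) \<and>
     (\<forall>i\<in>{1..k}. \<forall>j\<in>{1..k}. i \<le> j \<longrightarrow> s j \<le> s i) \<and>
     (\<forall>w. (\<forall>i\<in>{1..k}. ip (u i) w = 0) \<longrightarrow> (\<forall>i\<in>{1..k}. ip (A *v w) (A *v w) \<le> (s i)\<^sup>2 * ip w w))"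
  using assms
proof (induction k)
  case (Suc k)
  have "k \<le> CARD('n)" using Suc.prems by simp
  from Suc.IH[OF this] obtain u s where us: "orthonormal k u \<and>
     (\<forall>i\<in>{1..k}. 0 \<le> s i \<and> (\<forall>w. ip (A *v u i) (A *v w) = (s i)\<^sup>2 * ip (u i) w)) \<and>
     (\<forall>i\<in>{1..k}. \<forall>j\<in>{1..k}. i \<le> j \<longrightarrow> s j \<le> s i) \<and>
     (\<forall>w. (\<forall>i\<in>{1..k}. ip (u i) w = 0) \<longrightarrow> (\<forall>i\<in>{1..k}. ip (A *v w) (A *v w) \<le> (s i)\<^sup>2 * ip w w))"
    by (elim exE)
  have u: "orthonormal k u"
    and s: "\<And>i. i \<in> {1..k} \<Longrightarrow> 0 \<le> s i" "\<And>i w. i \<in> {1..k} \<Longrightarrow> ip (A *v u i) (A *v w) = (s i)\<^sup>2 * ip (u i) w"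
    and dec: "\<And>i j. i \<in> {1..k} \<Longrightarrow> j \<in> {1..k} \<Longrightarrow> i \<le> j \<Longrightarrow> s j \<le> s i"
    and max: "\<And>w i. (\<forall>i\<in>{1..k}. ip (u i) w = 0) \<Longrightarrow> i \<in> {1..k} \<Longrightarrow> ip (A *v w) (A *v w) \<le> (s i)\<^sup>2 * ip w w"
    using us by blast+
  define W where "W = {w. \<forall>i\<in>{1..k}. ip (u i) w = 0}"
  have W: "subspace W" unfolding W_def by (auto simp: subspace_def)
  define pr where "pr w = w - (\<Sum>i=1..k. ip w (u i) *\<^sub>R u i)" for w
  have pr: "pr w \<in> W" for w
  proof -
    have "(\<Sum>i=1..k. ip w (u i) * ip (u j) (u i)) = ip w (u j)" if "j \<in> {1..k}" for j
    proof -
      have "(\<Sum>i=1..k. ip w (u i) * ip (u j) (u i)) = (\<Sum>i=1..k. if i = j then ip w (u j) else 0)"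
        using u that by (intro sum.cong) (auto simp: orthonormal_def)
      then show ?thesis using that by simp
    qed
    then show ?thesis by (auto simp: W_def pr_def ip_sum_right ip_sym)
  qed
  have "span (u ` {1..k}) \<noteq> UNIV"
  proof
    assume "span (u ` {1..k}) = UNIV"
    then have "dim (UNIV :: (real^'n) set) \<le> card (u ` {1..k})" by (intro dim_le_card) auto
    also have "\<dots> \<le> k" using card_image_le[of "{1..k}" u] by simp
    finally show False using Suc.prems by simp
  qed
  then obtain w0 where w0: "w0 \<notin> span (u ` {1..k})" by blast
  have "(\<Sum>i=1..k. ip w0 (u i) *\<^sub>R u i) \<in> span (u ` {1..k})"
    by (intro span_sum span_scale span_base) auto
  then have "pr w0 \<noteq> 0" using w0 by (auto simp: pr_def)
  have K: "compact (sphere 0 1 \<inter> W)" using closed_subspace[OF W] by (intro compact_Int_closed) auto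
  have ne: "sphere 0 1 \<inter> W \<noteq> {}"
  proof -
    have "(1 / norm (pr w0)) *\<^sub>R pr w0 \<in> sphere 0 1 \<inter> W"
      using \<open>pr w0 \<noteq> 0\<close> pr[of w0] W by (auto simp: subspace_scale)
    then show ?thesis by blast
  qed
  have cont: "continuous_on (sphere 0 1 \<inter> W) (\<lambda>w. ip (A *v w) (A *v w) / ip w w)"
    by (intro continuous_intros matrix_vector_mult_linear_continuous_on) auto
  obtain x where x: "x \<in> sphere 0 1 \<inter> W"
    and xmax: "\<And>y. y \<in> sphere 0 1 \<inter> W \<Longrightarrow> ip (A *v y) (A *v y) / ip y y \<le> ip (A *v x) (A *v x) / ip x x"
    using continuous_attains_sup[OF K ne cont] by blast
  define M where "M = ip (A *v x) (A *v x) / ip x x"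
  have xW: "x \<in> W" and px: "0 < ip x x" using x by (auto intro!: ip_pos)
  have M: "0 \<le> M" "ip (A *v x) (A *v x) = M * ip x x" using px by (auto simp: M_def)
  have le: "ip (A *v w) (A *v w) \<le> M * ip w w" if "w \<in> W" for w
  proof (cases "w = 0")
    case False
    let ?y = "(1 / norm w) *\<^sub>R w"
    have "?y \<in> sphere 0 1 \<inter> W" using False that W by (auto simp: subspace_scale)
    then have "ip (A *v ?y) (A *v ?y) / ip ?y ?y \<le> M" using xmax unfolding M_def by blast
    moreover have "A *v ?y = (1 / norm w) *\<^sub>R (A *v w)" by (rule matrix_vector_mult_scaleR)
    ultimately have "ip (A *v w) (A *v w) / ip w w \<le> M" using False by simp
    then show ?thesis using ip_pos[OF False] by (simp add: pos_divide_le_eq)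
  qed simp
  \<comment> \<open>First variation: at a maximum the derivative of the quotient vanishes in every
    direction of \<open>W\<close>.\<close>
  have var: "ip (A *v x) (A *v w) = M * ip x w" if w: "w \<in> W" for w
  proof (rule ccontr)
    define b where "b = ip (A *v x) (A *v w) - M * ip x w"
    define c where "c = ip (A *v w) (A *v w) - M * ip w w"
    assume "\<not> ?thesis"
    then have b: "b \<noteq> 0" by (simp add: b_def)
    have q: "2 * t * b + t\<^sup>2 * c \<le> 0" for t
    proof -
      have "x + t *\<^sub>R w \<in> W" using xW w W by (simp add: subspace_add subspace_scale)
      from le[OF this] show ?thesis using M(2)
        by (simp add: matrix_vector_right_distrib matrix_vector_mult_scaleR b_def c_def
            ip_sym[of w x] ip_sym[of "A *v w" "A *v x"] power2_eq_square algebra_simps)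
    qed
    \<comment> \<open>With this \<open>t\<close> the quadratic expression is at least
      \<open>t * b\<close>, which is positive.\<close>
    define t where "t = b / (\<bar>c\<bar> + 1)"
    have "t\<^sup>2 * c \<ge> - (t\<^sup>2 * \<bar>c\<bar>)" by (simp add: abs_if)
    moreover have "t\<^sup>2 * \<bar>c\<bar> \<le> t\<^sup>2 * (\<bar>c\<bar> + 1)" by (intro mult_left_mono) auto
    moreover have "t\<^sup>2 * (\<bar>c\<bar> + 1) = t * b" by (simp add: t_def power2_eq_square)
    moreover have "0 < t * b" using b by (simp add: t_def power2_eq_square[symmetric])
    ultimately show False using q[of t] by linarith
  qed
  \<comment> \<open>Outside \<open>W\<close> only the earlier \<open>u i\<close> remain to be
    tested, and there both sides vanish by the eigenvector equation of \<open>u i\<close>.\<close>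
  have all: "ip (A *v x) (A *v w) = M * ip x w" for w
  proof -
    have w: "w = pr w + (\<Sum>i=1..k. ip w (u i) *\<^sub>R u i)" by (simp add: pr_def)
    have z: "ip (A *v x) (A *v u i) = 0" "ip x (u i) = 0" if "i \<in> {1..k}" for i
      using that s(2)[OF that, of x] xW by (auto simp: W_def ip_sym)
    have "ip (A *v x) (A *v w) = ip (A *v x) (A *v pr w)"
      by (subst w) (simp add: matrix_vector_right_distrib linear_sum[OF matrix_vector_mul_linear] o_def
          matrix_vector_mult_scaleR ip_sum_right z)
    moreover have "ip x w = ip x (pr w)" by (subst w) (simp add: ip_sum_right z)
    ultimately show ?thesis using var[OF pr[of w]] by simp
  qed
  define u' where "u' = u(Suc k := (1 / nrm x) *\<^sub>R x)"
  define s' where "s' = s(Suc k := sqrt M)"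
  have old: "u' i = u i" "s' i = s i" if "i \<in> {1..k}" for i using that by (auto simp: u'_def s'_def)
  have pn: "0 < nrm x" using px by (simp add: nrm_def)
  have new: "u' (Suc k) = (1 / nrm x) *\<^sub>R x" "s' (Suc k) = sqrt M" by (auto simp: u'_def s'_def)
  have cases: "i \<in> {1..k} \<or> i = Suc k" if "i \<in> {1..Suc k}" for i using that by auto
  have xu: "ip x (u i) = 0" "ip (u i) x = 0" if "i \<in> {1..k}" for i
    using xW that by (auto simp: W_def ip_sym)
  have sk: "sqrt M \<le> s i" if "i \<in> {1..k}" for i
  proof -
    have "M * ip x x \<le> (s i)\<^sup>2 * ip x x" using max[OF _ that, of x] xW M(2) by (simp add: W_def)
    then have "M \<le> (s i)\<^sup>2" using px by simp
    then show ?thesis using real_le_lsqrt[of "s i" M] s(1)[OF that] by simp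
  qed
  show ?case
  proof (intro exI[of _ u'] exI[of _ s'] conjI ballI allI impI)
    show "orthonormal (Suc k) u'" unfolding orthonormal_def
    proof (intro ballI)
      fix i j assume ij: "i \<in> {1..Suc k}" "j \<in> {1..Suc k}"
      have n1: "ip (u' (Suc k)) (u' (Suc k)) = 1"
        using pn nrm_sq[of x] unfolding new by (simp add: power2_eq_square) (use px in fastforce)
      consider "i \<in> {1..k}" "j \<in> {1..k}" | "i \<in> {1..k}" "j = Suc k" | "i = Suc k" "j \<in> {1..k}"
        | "i = Suc k" "j = Suc k" using cases[OF ij(1)] cases[OF ij(2)] by blast
      then show "ip (u' i) (u' j) = (if i = j then 1 else 0)"
      proof cases
        case 1
        then show ?thesis using u unfolding old[OF 1(1)] old[OF 1(2)] orthonormal_def by blast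
      next
        case 2
        then show ?thesis unfolding 2 old[OF 2(1)] new using xu[OF 2(1)] by simp
      next
        case 3
        then show ?thesis unfolding 3 old[OF 3(2)] new using xu[OF 3(2)] by simp
      next
        case 4
        then show ?thesis using n1 by simp
      qed
    qed
    fix i assume i: "i \<in> {1..Suc k}"
    show "0 \<le> s' i"
      using cases[OF i] s(1)[of i] old(2)[of i] M(1) new(2) by (elim disjE) simp_all
    show "ip (A *v u' i) (A *v w) = (s' i)\<^sup>2 * ip (u' i) w" for w
    proof (cases "i = Suc k")
      case True
      have "A *v u' i = (1 / nrm x) *\<^sub>R (A *v x)" unfolding True new by (rule matrix_vector_mult_scaleR)
      then have "ip (A *v u' i) (A *v w) = (1 / nrm x) * (M * ip x w)"
        using all[of w] by (simp only: linear_scale[OF lin_left] real_scaleR_def)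
      moreover have "(s' i)\<^sup>2 * ip (u' i) w = M * ((1 / nrm x) * ip x w)"
        using M(1) by (simp only: True new linear_scale[OF lin_left] real_scaleR_def real_sqrt_pow2)
      ultimately show ?thesis by (simp only: mult.left_commute)
    next
      case False
      then have "i \<in> {1..k}" using cases[OF i] by blast
      then show ?thesis using s(2) old by simp
    qed
    show "s' j \<le> s' i" if j: "j \<in> {1..Suc k}" "i \<le> j" for j
    proof (cases "j = Suc k")
      case True
      show ?thesis
      proof (cases "i = Suc k")
        case False
        then have "i \<in> {1..k}" using cases[OF i] by blast
        then show ?thesis using sk[of i] old(2)[of i] new(2) True by simp
      qed (use True in simp)
    next
      case False
      then have "i \<in> {1..k}" "j \<in> {1..k}" using cases[OF i] cases[OF j(1)] j by auto
      then show ?thesis using dec[OF _ _ j(2)] old(2) by simp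
    qed
    fix w assume w: "\<forall>i\<in>{1..Suc k}. ip (u' i) w = 0"
    then have "\<forall>i\<in>{1..k}. ip (u i) w = 0" using old(1) by force
    then show "ip (A *v w) (A *v w) \<le> (s' i)\<^sup>2 * ip w w"
      using cases[OF i] max[of w i] le[of w] old(2)[of i] new(2) M(1) unfolding W_def by (elim disjE) simp_all
  qed
next
  case 0
  have e: "{1..0::nat} = {}" by simp
  show ?case unfolding orthonormal_def e by blast
qed

lemma singular_frame_exists: "\<exists>u s. singular_frame A u s"
  using partial_singular_frame[of "CARD('n)" A] unfolding singular_frame_def by blast

section \<open>Norms, singular values and the determinant in a singular frame\<close>

context
  fixes A u s assumes f: "singular_frame A u s"
begin

lemma frame_orthonormal: "orthonormal CARD('n) u" using f by (simp add: singular_frame_def)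

lemma frame_nonneg: "i \<in> {1..CARD('n)} \<Longrightarrow> 0 \<le> s i" using f by (simp add: singular_frame_def)

lemma frame_ip: "i \<in> {1..CARD('n)} \<Longrightarrow> ip (A *v u i) (A *v w) = (s i)\<^sup>2 * ip (u i) w"
  using f by (simp add: singular_frame_def)

lemma frame_antimono: "i \<in> {1..CARD('n)} \<Longrightarrow> j \<in> {1..CARD('n)} \<Longrightarrow> i \<le> j \<Longrightarrow> s j \<le> s i"
  using f by (simp add: singular_frame_def)

lemma frame_ip_expansion: "ip (A *v v) (A *v w) = (\<Sum>i=1..CARD('n). (s i)\<^sup>2 * ip v (u i) * ip w (u i))"
proof -
  have "ip (A *v v) (A *v w) = ip (A *v v) (A *v (\<Sum>i=1..CARD('n). ip w (u i) *\<^sub>R u i))"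
    by (simp only: orthonormal_expansion[OF frame_orthonormal])
  also have "\<dots> = (\<Sum>i=1..CARD('n). ip w (u i) * ip (A *v v) (A *v u i))"
    by (simp add: linear_sum[OF matrix_vector_mul_linear] o_def matrix_vector_mult_scaleR ip_sum_right)
  also have "\<dots> = (\<Sum>i=1..CARD('n). (s i)\<^sup>2 * ip v (u i) * ip w (u i))"
  proof (intro sum.cong refl)
    fix i assume "i \<in> {1..CARD('n)}"
    then have "ip (A *v v) (A *v u i) = (s i)\<^sup>2 * ip v (u i)"
      using frame_ip[of i v] ip_sym[of "A *v v" "A *v u i"] ip_sym[of v "u i"] by simp
    then show "ip w (u i) * ip (A *v v) (A *v u i) = (s i)\<^sup>2 * ip v (u i) * ip w (u i)" by simp
  qed
  finally show ?thesis .
qed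

lemma frame_nrm_sq: "(nrm (A *v v))\<^sup>2 = (\<Sum>i=1..CARD('n). (s i)\<^sup>2 * (ip v (u i))\<^sup>2)"
  unfolding nrm_sq frame_ip_expansion by (simp add: power2_eq_square mult.assoc)

lemma singular_space_frame:
  assumes t: "0 \<le> t"
  shows "singular_space ip A t = span (u ` {i \<in> {1..CARD('n)}. s i = t})" (is "?L = span (u ` ?I)")
proof
  show "?L \<subseteq> span (u ` ?I)"
  proof
    fix v assume v: "v \<in> ?L"
    have z: "ip v (u i) = 0" if "i \<in> {1..CARD('n)}" "i \<notin> ?I" for i
    proof -
      have "ip (A *v v) (A *v u i) = t\<^sup>2 * ip v (u i)" using v by (simp add: singular_space_def)
      then have "(s i)\<^sup>2 * ip v (u i) = t\<^sup>2 * ip v (u i)"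
        using frame_ip[OF that(1), of v] ip_sym[of "A *v v" "A *v u i"] ip_sym[of v "u i"] by simp
      moreover have "(s i)\<^sup>2 \<noteq> t\<^sup>2" using that t frame_nonneg by auto
      ultimately show ?thesis by simp
    qed
    have "v = (\<Sum>i\<in>?I. ip v (u i) *\<^sub>R u i)"
      by (subst orthonormal_expansion[OF frame_orthonormal, of v, symmetric],
          rule sum.mono_neutral_right) (use z in auto)
    also have "\<dots> \<in> span (u ` ?I)" by (intro span_sum span_scale span_base) auto
    finally show "v \<in> span (u ` ?I)" .
  qed
  have "subspace ?L"
    by (auto simp: subspace_def singular_space_def matrix_vector_right_distrib matrix_vector_mult_scaleR algebra_simps)
  moreover have "u ` ?I \<subseteq> ?L" by (auto simp: singular_space_def frame_ip)
  ultimately show "span (u ` ?I) \<subseteq> ?L" by (rule span_minimal[rotated])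
qed

text \<open>The eigenspace for \<open>t\<close> is spanned by the \<open>u i\<close> with
  \<open>s i = t\<close>, so its dimension is the number of such indices. Every frame thus lists the
  singular values with multiplicity, whatever choices it involves.\<close>

lemma singular_values_frame: "singular_values ip A = map s [1..<Suc CARD('n)]"
proof -
  let ?I = "\<lambda>t. {i \<in> {1..CARD('n)}. s i = t}"
  have dim: "dim (singular_space ip A t) = card (?I t)" if "0 \<le> t" for t
  proof -
    have I: "?I t \<subseteq> {1..CARD('n)}" by blast
    have "dim (span (u ` ?I t)) = card (u ` ?I t)"
      using orthonormal_independent[OF frame_orthonormal I] by (simp add: dim_eq_card_independent)
    also have "\<dots> = card (?I t)"
      using orthonormal_inj[OF frame_orthonormal] I by (intro card_image) (rule inj_on_subset)
    finally show ?thesis by (simp only: singular_space_frame[OF that])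
  qed
  have T: "{t. 0 \<le> t \<and> singular_space ip A t \<noteq> {0}} = s ` {1..CARD('n)}"
  proof -
    have "singular_space ip A t \<noteq> {0} \<longleftrightarrow> ?I t \<noteq> {}" if "0 \<le> t" for t
    proof -
      have "singular_space ip A t = {0} \<longleftrightarrow> dim (singular_space ip A t) = 0"
        unfolding singular_space_frame[OF that] using span_0 by (subst dim_eq_0) blast
      then show ?thesis unfolding dim[OF that] by simp
    qed
    moreover have "t \<in> s ` {1..CARD('n)} \<longleftrightarrow> ?I t \<noteq> {}" for t by auto
    moreover have "0 \<le> t" if "?I t \<noteq> {}" for t using that frame_nonneg by auto
    ultimately show ?thesis unfolding set_eq_iff mem_Collect_eq by blast
  qed
  have "(\<Sum>t\<in>{t. 0 \<le> t \<and> singular_space ip A t \<noteq> {0}}. replicate_mset (dim (singular_space ip A t)) t)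
      = (\<Sum>t\<in>s ` {1..CARD('n)}. replicate_mset (card (?I t)) t)"
    unfolding T using frame_nonneg dim by (intro sum.cong) auto
  also have "\<dots> = mset (map s [1..<Suc CARD('n)])"
  proof (rule multiset_eqI)
    fix x
    have "count (\<Sum>t\<in>s ` {1..CARD('n)}. replicate_mset (card (?I t)) t) x
        = (\<Sum>t\<in>s ` {1..CARD('n)}. if t = x then card (?I x) else 0)"
      unfolding count_sum by (rule sum.cong) auto
    also have "\<dots> = card (?I x)"
    proof (cases "?I x = {}")
      case True
      then show ?thesis by simp
    next
      case False
      then have "x \<in> s ` {1..CARD('n)}" by auto
      then show ?thesis by simp
    qed
    also have "\<dots> = count (image_mset s (mset_set {1..CARD('n)})) x"
      unfolding count_image_mset' card_eq_sum by (rule sum.cong) auto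
    also have "image_mset s (mset_set {1..CARD('n)}) = mset (map s [1..<Suc CARD('n)])"
      by (simp only: mset_map mset_upt atLeastLessThanSuc_atLeastAtMost)
    finally show "count (\<Sum>t\<in>s ` {1..CARD('n)}. replicate_mset (card (?I t)) t) x = count (mset (map s [1..<Suc CARD('n)])) x" .
  qed
  also have "\<dots> = mset (rev (map s [1..<Suc CARD('n)]))" by simp
  finally have "singular_values ip A = rev (sort (rev (map s [1..<Suc CARD('n)])))"
    unfolding singular_values_def by (simp only: sorted_list_of_multiset_mset)
  moreover have "sorted (rev (map s [1..<Suc CARD('n)]))"
    unfolding sorted_rev_iff_nth_mono using frame_antimono by (auto simp del: upt_Suc)
  ultimately show ?thesis by (simp only: sorted_sort_id rev_rev_ident)
qed

lemma singular_values_nth: "i \<in> {1..CARD('n)} \<Longrightarrow> singular_values ip A ! (i - 1) = s i"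
proof -
  assume i: "i \<in> {1..CARD('n)}"
  then have l: "i - 1 < length [1..<Suc CARD('n)]" and e: "1 + (i - 1) = i" "i < Suc CARD('n)"
    unfolding length_upt by auto
  show ?thesis
    unfolding singular_values_frame nth_map[OF l] using nth_upt[of 1 "i - 1" "Suc CARD('n)"] e by simp
qed

lemma nrm_le: "nrm (A *v v) \<le> s 1 * nrm v"
proof -
  have "(nrm (A *v v))\<^sup>2 = (\<Sum>i=1..CARD('n). (s i)\<^sup>2 * (ip v (u i))\<^sup>2)"
    by (rule frame_nrm_sq)
  also have "\<dots> \<le> (\<Sum>i=1..CARD('n). (s 1)\<^sup>2 * (ip v (u i))\<^sup>2)"
    using frame_nonneg frame_antimono[of 1] by (intro sum_mono mult_right_mono power_mono) auto
  also have "\<dots> = (s 1 * nrm v)\<^sup>2"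
    unfolding power_mult_distrib nrm_sq ip_expansion[OF frame_orthonormal, of v v]
    by (simp add: power2_eq_square sum_distrib_left)
  finally show ?thesis by (rule power2_le_imp_le) (simp add: frame_nonneg)
qed

lemma nrm_ge: "s 1 * \<bar>ip v (u 1)\<bar> \<le> nrm (A *v v)"
proof -
  have "(s 1 * \<bar>ip v (u 1)\<bar>)\<^sup>2 = (s 1)\<^sup>2 * (ip v (u 1))\<^sup>2" by (simp add: power_mult_distrib)
  also have "\<dots> \<le> (\<Sum>i=1..CARD('n). (s i)\<^sup>2 * (ip v (u i))\<^sup>2)" by (rule member_le_sum) auto
  also have "\<dots> = (nrm (A *v v))\<^sup>2"
    by (rule frame_nrm_sq[symmetric])
  finally show ?thesis by (rule power2_le_imp_le) simp
qed

lemma nrm_le_orthogonal: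
  assumes "2 \<le> CARD('n)" "ip v (u 1) = 0"
  shows "nrm (A *v v) \<le> s 2 * nrm v"
proof -
  have "(nrm (A *v v))\<^sup>2 = (\<Sum>i=1..CARD('n). (s i)\<^sup>2 * (ip v (u i))\<^sup>2)"
    by (rule frame_nrm_sq)
  also have "\<dots> \<le> (\<Sum>i=1..CARD('n). (s 2)\<^sup>2 * (ip v (u i))\<^sup>2)"
  proof (rule sum_mono)
    fix i assume i: "i \<in> {1..CARD('n)}"
    show "(s i)\<^sup>2 * (ip v (u i))\<^sup>2 \<le> (s 2)\<^sup>2 * (ip v (u i))\<^sup>2"
    proof (cases "i = 1")
      case False
      then have "(s i)\<^sup>2 \<le> (s 2)\<^sup>2" using i assms frame_nonneg frame_antimono[of 2 i] by (intro power_mono) auto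
      then show ?thesis by (simp add: mult_right_mono)
    qed (use assms in simp)
  qed
  also have "\<dots> = (s 2 * nrm v)\<^sup>2"
    unfolding power_mult_distrib nrm_sq ip_expansion[OF frame_orthonormal, of v v]
    by (simp add: power2_eq_square sum_distrib_left)
  finally show ?thesis by (rule power2_le_imp_le) (use frame_nonneg[of 2] assms in simp)
qed

lemma nrm_frame: "i \<in> {1..CARD('n)} \<Longrightarrow> nrm (A *v u i) = s i"
proof -
  assume i: "i \<in> {1..CARD('n)}"
  then have "ip (u i) (u i) = 1" using frame_orthonormal unfolding orthonormal_def by metis
  then show ?thesis using frame_ip[OF i, of "u i"] frame_nonneg[OF i] unfolding nrm_def by simp
qed

text \<open>With \<open>U\<close> the matrix of the frame and \<open>g\<close> the Gram matrix of
  the standard basis, the Gram matrix of the vectors \<open>A *v u i\<close> is diagonal with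
  entries the squares of the \<open>s i\<close>. The factor \<open>g\<close> accounts for
  \<open>ip\<close> being arbitrary; it cancels by the same identity with the unit matrix in place
  of \<open>A\<close>.\<close>

lemma prod_singular_values: "(\<Prod>i=1..CARD('n). s i) = \<bar>det A\<bar>"
proof -
  have "card (UNIV :: 'n set) = card {1..CARD('n)}" by simp
  then obtain e where e: "bij_betw e (UNIV :: 'n set) {1..CARD('n)}"
    using finite_same_card_bij finite_class.finite_UNIV finite_atLeastAtMost by blast
  define U :: "real^'n^'n" where "U = (\<chi> i j. u (e j) $ i)"
  define g :: "real^'n^'n" where "g = (\<chi> i j. ip (axis i 1) (axis j 1))"
  have ax: "x = (\<Sum>i\<in>UNIV. x $ i *\<^sub>R axis i 1)" for x :: "real^'n"
    using basis_expansion[of x] by (simp add: scalar_mult_eq_scaleR)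
  have g: "ip x y = (\<Sum>i\<in>UNIV. \<Sum>j\<in>UNIV. x $ i * g $ i $ j * y $ j)" for x y
  proof -
    have "ip x y = ip (\<Sum>i\<in>UNIV. x $ i *\<^sub>R axis i 1) (\<Sum>j\<in>UNIV. y $ j *\<^sub>R axis j 1)"
      using ax by metis
    then show ?thesis by (simp add: ip_sum_left ip_sum_right g_def sum_distrib_left mult_ac) (rule sum.swap)
  qed
  have gram: "(transpose (B ** U) ** g ** (B ** U)) $ i $ j = ip (B *v u (e i)) (B *v u (e j))" for B i j
  proof -
    have col: "(B ** U) $ k $ j = (B *v u (e j)) $ k" for k j
      by (simp add: matrix_matrix_mult_def matrix_vector_mult_def U_def)
    have mm: "(X ** Y) $ i $ j = (\<Sum>k\<in>UNIV. X $ i $ k * Y $ k $ j)" for X Y :: "real^'n^'n" and i j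
      by (simp add: matrix_matrix_mult_def)
    have tr: "transpose X $ i $ j = X $ j $ i" for X :: "real^'n^'n" and i j by (simp add: transpose_def)
    have "(transpose (B ** U) ** g ** (B ** U)) $ i $ j
        = (\<Sum>l\<in>UNIV. (\<Sum>k\<in>UNIV. (B ** U) $ k $ i * g $ k $ l) * (B ** U) $ l $ j)"
      by (simp only: mm[of "transpose (B ** U) ** g"] mm[of "transpose (B ** U)"] tr)
    also have "\<dots> = (\<Sum>l\<in>UNIV. \<Sum>k\<in>UNIV. (B *v u (e i)) $ k * g $ k $ l * (B *v u (e j)) $ l)"
      by (simp add: col sum_distrib_right)
    also have "\<dots> = ip (B *v u (e i)) (B *v u (e j))" unfolding g by (rule sum.swap)
    finally show ?thesis .
  qed
  have eI: "e i \<in> {1..CARD('n)}" for i using e by (auto simp: bij_betw_def)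
  have einj: "e i = e j \<longleftrightarrow> i = j" for i j using e by (auto simp: bij_betw_def inj_def)
  have oi: "ip (u (e i)) (u (e j)) = (if i = j then 1 else 0)" for i j
    using frame_orthonormal eI[of i] eI[of j] einj[of i j] unfolding orthonormal_def by metis
  have "(transpose (mat 1 ** U) ** g ** (mat 1 ** U)) $ i $ j = mat 1 $ i $ j" for i j
    unfolding gram matrix_vector_mul_lid oi by (simp add: mat_def)
  then have "transpose (mat 1 ** U) ** g ** (mat 1 ** U) = mat 1" by (simp add: vec_eq_iff)
  then have one: "det (transpose U) * det g * det U = 1"
    by (metis det_I det_mul matrix_mul_lid)
  have "det (transpose (A ** U) ** g ** (A ** U)) = (\<Prod>i\<in>UNIV. (transpose (A ** U) ** g ** (A ** U)) $ i $ i)"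
    by (rule det_diagonal) (unfold gram frame_ip[OF eI], simp add: oi)
  also have "\<dots> = (\<Prod>i\<in>UNIV. (s (e i))\<^sup>2)"
    unfolding gram frame_ip[OF eI] by (simp add: oi)
  also have "\<dots> = (\<Prod>i=1..CARD('n). s i)\<^sup>2"
    using prod.reindex_bij_betw[OF e, of "\<lambda>i. (s i)\<^sup>2"] by (simp add: prod_power_distrib)
  finally have "(\<Prod>i=1..CARD('n). s i)\<^sup>2 = (det A)\<^sup>2 * (det (transpose U) * det g * det U)"
    by (simp add: det_mul det_transpose power2_eq_square mult_ac)
  then have "\<bar>\<Prod>i=1..CARD('n). s i\<bar> = \<bar>det A\<bar>" using one by (metis mult.right_neutral power2_eq_iff abs_minus_cancel)
  moreover have "0 \<le> (\<Prod>i=1..CARD('n). s i)" using frame_nonneg by (intro prod_nonneg) auto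
  ultimately show ?thesis by simp
qed

end

end

section \<open>Gram determinants\<close>

text \<open>The Leibniz determinant with variable size and indices from 1 to \<open>p\<close>, in
  the form of the sum inside \<open>wedge_norm\<close>.\<close>

definition ldet :: "nat \<Rightarrow> (nat \<Rightarrow> nat \<Rightarrow> real) \<Rightarrow> real" where
  "ldet p M = (\<Sum>\<pi> | \<pi> permutes {1..p}. of_int (sign \<pi>) * (\<Prod>i=1..p. M i (\<pi> i)))"

text \<open>Shifting the indices by one conjugates the permutations with \<open>Suc\<close>, which
  preserves their signs.\<close>

lemma ldet_eq_det: "ldet p M = Determinant.det (Matrix.mat p p (\<lambda>(i, j). M (Suc i) (Suc j)))"
proof -
  let ?A = "{0..<p}" and ?B = "{1..p}"
  let ?f = "map_permutation ?A Suc" and ?g = "map_permutation ?B (\<lambda>i. i - 1)"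
  have bij: "bij_betw Suc ?A ?B" "bij_betw (\<lambda>i. i - 1) ?B ?A"
    by (rule bij_betw_byWitness[of _ "\<lambda>i. i - 1"], auto simp: One_nat_def)
       (rule bij_betw_byWitness[of _ Suc], auto simp: One_nat_def)
  have "Determinant.det (Matrix.mat p p (\<lambda>(i, j). M (Suc i) (Suc j)))
      = (\<Sum>\<pi> | \<pi> permutes ?A. of_int (sign \<pi>) * (\<Prod>i\<in>?A. M (Suc i) (Suc (\<pi> i))))"
    by (subst det_def'[of _ p]) (auto intro!: sum.cong prod.cong)
  also have "\<dots> = ldet p M" unfolding ldet_def
  proof (rule sum.reindex_bij_witness[of _ ?g ?f])
    fix \<pi> assume "\<pi> \<in> {\<pi>. \<pi> permutes ?A}"
    then have \<pi>: "\<pi> permutes ?A" by simp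
    show "?g (?f \<pi>) = \<pi>"
    proof -
      have "?g (?f \<pi>) = map_permutation ?A ((\<lambda>i. i - 1) \<circ> Suc) \<pi>"
        using bij(1) bij_betw_imp_inj_on[OF bij(2)] by (intro map_permutation_compose) auto
      then show ?thesis using \<pi> by (simp add: o_def)
    qed
    show "?f \<pi> \<in> {\<pi>. \<pi> permutes ?B}" using map_permutation_permutes[OF bij(1) \<pi>] by simp
    have "(\<Prod>i=1..p. M i (?f \<pi> i)) = (\<Prod>i\<in>?A. M (Suc i) (?f \<pi> (Suc i)))"
      using prod.reindex_bij_betw[OF bij(1), of "\<lambda>i. M i (?f \<pi> i)"] by simp
    also have "\<dots> = (\<Prod>i\<in>?A. M (Suc i) (Suc (\<pi> i)))"
      by (intro prod.cong refl) (simp add: map_permutation_apply)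
    finally show "of_int (sign (?f \<pi>)) * (\<Prod>i=1..p. M i (?f \<pi> i))
        = of_int (sign \<pi>) * (\<Prod>i\<in>?A. M (Suc i) (Suc (\<pi> i)))"
      using \<pi> by (simp add: sign_map_permutation)
  next
    fix \<pi> assume "\<pi> \<in> {\<pi>. \<pi> permutes ?B}"
    then have \<pi>: "\<pi> permutes ?B" by simp
    have "?f (?g \<pi>) = map_permutation ?B (Suc \<circ> (\<lambda>i. i - 1)) \<pi>"
      using bij(2) by (intro map_permutation_compose) auto
    also have "\<dots> = map_permutation ?B id \<pi>"
      using \<pi> by (intro map_permutation_cong) (auto simp: One_nat_def inj_on_def)
    finally show "?f (?g \<pi>) = \<pi>" using \<pi> by simp
    show "?g \<pi> \<in> {\<pi>. \<pi> permutes ?A}" using map_permutation_permutes[OF bij(2) \<pi>] by simp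
  qed
  finally show ?thesis ..
qed

lemma ldet_cong: "(\<And>i j. i \<in> {1..p} \<Longrightarrow> j \<in> {1..p} \<Longrightarrow> M i j = N i j) \<Longrightarrow> ldet p M = ldet p N"
  unfolding ldet_def
  by (intro sum.cong refl arg_cong2[of _ _ _ _ "(*)"] prod.cong) (metis mem_Collect_eq permutes_in_image)

lemma sum_from_1: "(\<Sum>k=1..p. g k) = (\<Sum>k=0..<p. g (Suc k))"
  by (simp add: One_nat_def sum.atLeast1_atMost_eq lessThan_atLeast0)

lemma ldet_mult: "ldet p (\<lambda>i j. \<Sum>k=1..p. M i k * N k j) = ldet p M * ldet p N"
proof -
  have "Matrix.mat p p (\<lambda>(i, j). \<Sum>k=1..p. M (Suc i) k * N k (Suc j))
      = Matrix.mat p p (\<lambda>(i, j). M (Suc i) (Suc j)) * Matrix.mat p p (\<lambda>(i, j). N (Suc i) (Suc j))"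
    by (rule eq_matI) (auto simp: scalar_prod_def sum_from_1)
  then show ?thesis unfolding ldet_eq_det by (simp add: det_mult[of _ p])
qed

lemma ldet_transpose: "ldet p (\<lambda>i j. M j i) = ldet p M"
proof -
  have "Matrix.mat p p (\<lambda>(i, j). M (Suc j) (Suc i)) = transpose_mat (Matrix.mat p p (\<lambda>(i, j). M (Suc i) (Suc j)))"
    by (rule eq_matI) auto
  then show ?thesis unfolding ldet_eq_det by (simp add: Determinant.det_transpose[of _ p])
qed

lemma ldet_eq_0:
  assumes "ldet p M = 0"
  shows "\<exists>c. (\<exists>i\<in>{1..p}. c i \<noteq> 0) \<and> (\<forall>i\<in>{1..p}. (\<Sum>j=1..p. M i j * c j) = 0)"
proof -
  let ?M = "Matrix.mat p p (\<lambda>(i, j). M (Suc i) (Suc j))"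
  obtain v where v: "v \<in> carrier_vec p" "v \<noteq> 0\<^sub>v p" "?M *\<^sub>v v = 0\<^sub>v p"
    using assms det_0_iff_vec_prod_zero_field[of ?M p] unfolding ldet_eq_det by auto
  define c where "c j = vec_index v (j - 1)" for j
  have "\<exists>j<p. vec_index v j \<noteq> 0" using v(1,2) by (metis carrier_vecD eq_vecI index_zero_vec)
  then obtain j where j: "j < p" "vec_index v j \<noteq> 0" by blast
  show ?thesis
  proof (intro exI[of _ c] conjI ballI)
    show "\<exists>i\<in>{1..p}. c i \<noteq> 0" using j by (intro bexI[of _ "Suc j"]) (auto simp: c_def)
    fix i assume i: "i \<in> {1..p}"
    then have i': "i - 1 < p" "Suc (i - 1) = i" by auto
    have "0 = vec_index (?M *\<^sub>v v) (i - 1)" using v(3) i' by simp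
    also have "\<dots> = (\<Sum>j = 0..<p. M i (Suc j) * c (Suc j))"
      using v(1) i' by (auto simp: scalar_prod_def c_def)
    also have "\<dots> = (\<Sum>j=1..p. M i j * c j)"
      by (simp only: sum_from_1)
    finally show "(\<Sum>j=1..p. M i j * c j) = 0" ..
  qed
qed

lemma ldet_permute_columns:
  assumes \<tau>: "\<tau> permutes {1..p}"
  shows "ldet p (\<lambda>i j. a i (f (\<tau> j))) = of_int (sign \<tau>) * ldet p (\<lambda>i j. a i (f j))"
proof -
  have perm: "permutation \<tau>" using \<tau> by (auto intro: permutes_imp_permutation)
  have "ldet p (\<lambda>i j. a i (f (\<tau> j))) = (\<Sum>\<pi> | \<pi> permutes {1..p}. of_int (sign \<pi>) * (\<Prod>i=1..p. a i (f ((\<tau> \<circ> \<pi>) i))))"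
    by (simp add: ldet_def)
  also have "\<dots> = (\<Sum>\<pi> | \<pi> permutes {1..p}. of_int (sign \<tau>) * (of_int (sign (\<tau> \<circ> \<pi>)) * (\<Prod>i=1..p. a i (f ((\<tau> \<circ> \<pi>) i)))))"
  proof (intro sum.cong refl)
    fix \<pi> assume "\<pi> \<in> {\<pi>. \<pi> permutes {1..p}}"
    then have "permutation \<pi>" by (auto intro: permutes_imp_permutation)
    then have "sign \<pi> = sign \<tau> * sign (\<tau> \<circ> \<pi>)" using perm by (simp add: sign_compose)
    then show "of_int (sign \<pi>) * (\<Prod>i=1..p. a i (f ((\<tau> \<circ> \<pi>) i)))
      = of_int (sign \<tau>) * (of_int (sign (\<tau> \<circ> \<pi>)) * (\<Prod>i=1..p. a i (f ((\<tau> \<circ> \<pi>) i))))" by simp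
  qed
  also have "\<dots> = of_int (sign \<tau>) * (\<Sum>\<pi> | \<pi> permutes {1..p}. of_int (sign (\<tau> \<circ> \<pi>)) * (\<Prod>i=1..p. a i (f ((\<tau> \<circ> \<pi>) i))))"
    by (simp add: sum_distrib_left)
  also have "\<dots> = of_int (sign \<tau>) * ldet p (\<lambda>i j. a i (f j))"
    unfolding ldet_def
    using setum_permutations_compose_left[OF \<tau>, of "\<lambda>\<pi>. of_int (sign \<pi>) * (\<Prod>i=1..p. a i (f (\<pi> i)))"] by simp
  finally show ?thesis .
qed

text \<open>Exchanging two equal columns changes the sign.\<close>

lemma ldet_not_inj:
  assumes "\<not> inj_on f {1..p}"
  shows "ldet p (\<lambda>i j. a i (f j)) = 0"
proof -
  obtain x y where xy: "x \<in> {1..p}" "y \<in> {1..p}" "x \<noteq> y" "f x = f y"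
    using assms by (auto simp: inj_on_def)
  let ?\<tau> = "Transposition.transpose x y"
  have "?\<tau> permutes {1..p}" using xy by (intro permutes_swap_id) auto
  moreover have "f (?\<tau> j) = f j" for j using xy by (auto simp: Transposition.transpose_def)
  ultimately have "ldet p (\<lambda>i j. a i (f j)) = - ldet p (\<lambda>i j. a i (f j))"
    using ldet_permute_columns[of ?\<tau> p a f] xy by (simp add: sign_swap_id)
  then show ?thesis by simp
qed

text \<open>Cauchy--Binet, with the sum over \<open>p\<close>-subsets replaced by the average over all index functions.\<close>

lemma ldet_sum_squares:
  assumes K: "finite K"
  shows "fact p * ldet p (\<lambda>i j. \<Sum>k\<in>K. t k * a i k * a j k)
    = (\<Sum>f\<in>{1..p} \<rightarrow>\<^sub>E K. (\<Prod>i=1..p. t (f i)) * (ldet p (\<lambda>i j. a i (f j)))\<^sup>2)"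
proof -
  let ?P = "{\<pi>. \<pi> permutes {1..p}}" and ?F = "{1..p} \<rightarrow>\<^sub>E K"
  define D where "D f = ldet p (\<lambda>i j. a i (f j))" for f
  have Da: "D f = (\<Sum>\<pi>\<in>?P. of_int (sign \<pi>) * (\<Prod>i=1..p. a (\<pi> i) (f i)))" for f
    unfolding D_def ldet_transpose[of p "\<lambda>i j. a i (f j)", symmetric] by (simp add: ldet_def)
  \<comment> \<open>The summand that multilinearity produces. It is not symmetric in
    \<open>f\<close>; averaging over the rearrangements of \<open>f\<close> turns the product of the
    \<open>a i (f i)\<close> into a second copy of the determinant.\<close>
  define E where "E f = (\<Prod>i=1..p. t (f i)) * (\<Prod>i=1..p. a i (f i)) * D f" for f
  have L: "ldet p (\<lambda>i j. \<Sum>k\<in>K. t k * a i k * a j k) = (\<Sum>f\<in>?F. E f)"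
  proof -
    have "ldet p (\<lambda>i j. \<Sum>k\<in>K. t k * a i k * a j k)
      = (\<Sum>\<pi>\<in>?P. \<Sum>f\<in>?F. of_int (sign \<pi>) * (\<Prod>i=1..p. t (f i) * a i (f i) * a (\<pi> i) (f i)))"
      unfolding ldet_def using K by (simp add: prod_sum_PiE sum_distrib_left)
    also have "\<dots> = (\<Sum>f\<in>?F. \<Sum>\<pi>\<in>?P. of_int (sign \<pi>) * (\<Prod>i=1..p. t (f i) * a i (f i) * a (\<pi> i) (f i)))"
      by (rule sum.swap)
    also have "\<dots> = (\<Sum>f\<in>?F. E f)"
      by (simp add: E_def Da prod.distrib sum_distrib_left mult_ac)
    finally show ?thesis .
  qed
  have shift: "(\<Sum>f\<in>?F. E f) = (\<Sum>f\<in>?F. E (f \<circ> \<tau>))" if \<tau>: "\<tau> permutes {1..p}" for \<tau>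
  proof (rule sum.reindex_bij_witness[of _ "\<lambda>f. f \<circ> \<tau>" "\<lambda>f. f \<circ> inv_into UNIV \<tau>"])
    have i: "inv_into UNIV \<tau> permutes {1..p}" by (rule permutes_inv[OF \<tau>])
    have mem: "f \<circ> \<rho> \<in> ?F" if f: "f \<in> ?F" and \<rho>: "\<rho> permutes {1..p}" for f \<rho>
    proof (rule PiE_I)
      show "(f \<circ> \<rho>) x \<in> K" if "x \<in> {1..p}" for x
        unfolding o_def using f permutes_in_image[OF \<rho>, of x] that by (intro PiE_mem[of f "{1..p}" "\<lambda>_. K"]) blast+
      show "(f \<circ> \<rho>) x = undefined" if "x \<notin> {1..p}" for x
        unfolding o_def permutes_not_in[OF \<rho> that] by (rule PiE_arb[OF f that])
    qed
    fix f assume f: "f \<in> ?F"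
    show "f \<circ> inv_into UNIV \<tau> \<circ> \<tau> = f" "f \<circ> \<tau> \<circ> inv_into UNIV \<tau> = f"
      using permutes_inv_o[OF \<tau>] by (auto simp: o_assoc[symmetric])
    show "f \<circ> inv_into UNIV \<tau> \<in> ?F" "f \<circ> \<tau> \<in> ?F" using mem f \<tau> i by auto
    show "E (f \<circ> inv_into UNIV \<tau> \<circ> \<tau>) = E f" using permutes_inv_o[OF \<tau>] by (simp add: o_assoc[symmetric])
  qed
  have E\<tau>: "E (f \<circ> \<tau>) = (\<Prod>i=1..p. t (f i)) * D f * (of_int (sign \<tau>) * (\<Prod>i=1..p. a (inv_into UNIV \<tau> i) (f i)))"
    if \<tau>: "\<tau> permutes {1..p}" for f \<tau>
  proof -
    have 1: "(\<Prod>i=1..p. t (f (\<tau> i))) = (\<Prod>i=1..p. t (f i))"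
      using prod.permute[OF \<tau>, of "\<lambda>i. t (f i)"] by (simp add: o_def)
    have 2: "(\<Prod>i=1..p. a i (f (\<tau> i))) = (\<Prod>i=1..p. a (inv_into UNIV \<tau> i) (f i))"
      using prod.permute[OF \<tau>, of "\<lambda>i. a (inv_into UNIV \<tau> i) (f i)"] permutes_inverses[OF \<tau>] by (simp add: o_def)
    have 3: "D (f \<circ> \<tau>) = of_int (sign \<tau>) * D f"
      unfolding D_def using ldet_permute_columns[OF \<tau>, of a f] by simp
    show ?thesis by (simp add: E_def 1 2 3)
  qed
  have "fact p * (\<Sum>f\<in>?F. E f) = (\<Sum>\<tau>\<in>?P. \<Sum>f\<in>?F. E f)"
    by (simp add: card_permutations[of "{1..p}" p])
  also have "\<dots> = (\<Sum>\<tau>\<in>?P. \<Sum>f\<in>?F. E (f \<circ> \<tau>))" by (intro sum.cong refl shift) simp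
  also have "\<dots> = (\<Sum>f\<in>?F. \<Sum>\<tau>\<in>?P. E (f \<circ> \<tau>))" by (rule sum.swap)
  also have "\<dots> = (\<Sum>f\<in>?F. (\<Prod>i=1..p. t (f i)) * D f * (\<Sum>\<tau>\<in>?P. of_int (sign \<tau>) * (\<Prod>i=1..p. a (inv_into UNIV \<tau> i) (f i))))"
    by (simp add: E\<tau> sum_distrib_left)
  also have "\<dots> = (\<Sum>f\<in>?F. (\<Prod>i=1..p. t (f i)) * (D f)\<^sup>2)"
  proof (intro sum.cong refl)
    fix f
    have "D f = (\<Sum>\<tau>\<in>?P. of_int (sign (inv_into UNIV \<tau>)) * (\<Prod>i=1..p. a (inv_into UNIV \<tau> i) (f i)))"
      unfolding Da by (rule sum_permutations_inverse)
    also have "\<dots> = (\<Sum>\<tau>\<in>?P. of_int (sign \<tau>) * (\<Prod>i=1..p. a (inv_into UNIV \<tau> i) (f i)))"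
      by (intro sum.cong refl) (auto simp: sign_inverse permutes_imp_permutation[of "{1..p}"])
    finally show "(\<Prod>i=1..p. t (f i)) * D f * (\<Sum>\<tau>\<in>?P. of_int (sign \<tau>) * (\<Prod>i=1..p. a (inv_into UNIV \<tau> i) (f i)))
        = (\<Prod>i=1..p. t (f i)) * (D f)\<^sup>2" by (simp add: power2_eq_square)
  qed
  finally show ?thesis by (simp add: L D_def)
qed

text \<open>The largest element of \<open>X\<close> is at least the cardinality of \<open>X\<close>,
  so its factor is at most the last factor on the right; remove both and induct.\<close>

lemma prod_le_initial_prod:
  fixes s :: "nat \<Rightarrow> real"
  assumes "finite X" "X \<subseteq> {1..d}" and nonneg: "\<And>i. i \<in> {1..d} \<Longrightarrow> 0 \<le> s i"
    and anti: "\<And>i j. i \<in> {1..d} \<Longrightarrow> j \<in> {1..d} \<Longrightarrow> i \<le> j \<Longrightarrow> s j \<le> s i"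
  shows "prod s X \<le> (\<Prod>i=1..card X. s i)"
  using assms(1,2)
proof (induction "card X" arbitrary: X)
  case (Suc k)
  define m where "m = Max X"
  have ne: "X \<noteq> {}" using Suc by auto
  have m: "m \<in> X" "\<And>x. x \<in> X \<Longrightarrow> x \<le> m" using Suc ne by (auto simp: m_def)
  have "X \<subseteq> {1..m}" using Suc m by auto
  then have "card X \<le> m" using card_mono[of "{1..m}" X] by simp
  then have le: "s m \<le> s (Suc k)" using Suc m by (intro anti) (auto simp: One_nat_def)
  have k: "k = card (X - {m})" using Suc m by simp
  have "prod s (X - {m}) \<le> (\<Prod>i=1..k. s i)"
    using Suc.hyps(1)[OF k] Suc.prems k by auto
  moreover have "0 \<le> prod s (X - {m})" "0 \<le> s m"
    using Suc.prems m nonneg by (auto intro!: prod_nonneg)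
  moreover have "0 \<le> s (Suc k)" using le \<open>0 \<le> s m\<close> by linarith
  ultimately have "s m * prod s (X - {m}) \<le> s (Suc k) * (\<Prod>i=1..k. s i)"
    using le by (intro mult_mono) auto
  moreover have "(\<Prod>i=1..card X. s i) = s (Suc k) * (\<Prod>i=1..k. s i)"
    unfolding Suc.hyps(2)[symmetric] by (simp add: prod.nat_ivl_Suc')
  ultimately show ?case using Suc.prems m prod.remove[of X m s] by simp
qed simp

context scalar_product
begin

definition gram :: "nat \<Rightarrow> (nat \<Rightarrow> real^'n) \<Rightarrow> real" where
  "gram p v = ldet p (\<lambda>i j. ip (v i) (v j))"

lemma wedge_norm_gram: "wedge_norm ip p v = sqrt (gram p v)"
  by (simp add: wedge_norm_def gram_def ldet_def)

lemma gram_change_basis: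
  assumes "\<And>i. i \<in> {1..p} \<Longrightarrow> w i = (\<Sum>j=1..p. c i j *\<^sub>R v j)"
  shows "gram p w = (ldet p c)\<^sup>2 * gram p v"
proof -
  have "gram p w = ldet p (\<lambda>i j. \<Sum>k=1..p. c i k * (\<Sum>l=1..p. ip (v k) (v l) * c j l))"
    unfolding gram_def
  proof (rule ldet_cong)
    fix i j assume "i \<in> {1..p}" "j \<in> {1..p}"
    then show "ip (w i) (w j) = (\<Sum>k=1..p. c i k * (\<Sum>l=1..p. ip (v k) (v l) * c j l))"
      by (simp add: assms ip_sum_left ip_sum_right sum_distrib_left mult_ac) (rule sum.swap)
  qed
  also have "\<dots> = ldet p c * (gram p v * ldet p (\<lambda>i j. c j i))"
    unfolding gram_def by (simp only: ldet_mult[of p c] ldet_mult[of p "\<lambda>k l. ip (v k) (v l)" "\<lambda>l j. c j l"])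
  finally show ?thesis by (simp add: ldet_transpose[of p c] power2_eq_square)
qed

text \<open>The summands are the squared coordinates of the wedge product of the \<open>v i\<close>
  in the basis of the exterior power that \<open>u\<close> induces, each counted once for every
  ordering of its index set.\<close>

lemma gram_expansion:
  assumes u: "orthonormal CARD('n) u"
  shows "fact p * gram p v = (\<Sum>f\<in>{1..p} \<rightarrow>\<^sub>E {1..CARD('n)}. (ldet p (\<lambda>i j. ip (v i) (u (f j))))\<^sup>2)"
proof -
  have "gram p v = ldet p (\<lambda>i j. \<Sum>k=1..CARD('n). 1 * ip (v i) (u k) * ip (v j) (u k))"
    unfolding gram_def mult_1 by (rule ldet_cong) (rule ip_expansion[OF u])
  then have "fact p * gram p v = (\<Sum>f\<in>{1..p} \<rightarrow>\<^sub>E {1..CARD('n)}.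
      (\<Prod>i=1..p. 1) * (ldet p (\<lambda>i j. ip (v i) (u (f j))))\<^sup>2)"
    by (simp only: ldet_sum_squares[OF finite_atLeastAtMost, of p "\<lambda>_. 1" "\<lambda>i k. ip (v i) (u k)"])
  then show ?thesis by (simp only: prod.neutral_const mult_1_left)
qed

lemma orthonormal_exists: "\<exists>u. orthonormal CARD('n) u"
proof -
  obtain u s where "singular_frame (mat 1) u s" using singular_frame_exists[of "mat 1"] by (elim exE)
  then have "orthonormal CARD('n) u" by (rule frame_orthonormal)
  then show ?thesis by (intro exI[of _ u])
qed

lemma gram_nonneg: "0 \<le> gram p v"
proof -
  obtain u where u: "orthonormal CARD('n) u" using orthonormal_exists by blast
  have "0 \<le> fact p * gram p v" unfolding gram_expansion[OF u] by (intro sum_nonneg) auto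
  then show ?thesis using fact_gt_zero[of p, where 'a = real] by (metis mult_pos_neg not_le)
qed

text \<open>A kernel vector of the Gram matrix would give a combination of the \<open>v i\<close>
  that is orthogonal to all of them, hence to itself.\<close>

lemma gram_pos:
  assumes inj: "inj_on v {1..p}" and ind: "independent (v ` {1..p})"
  shows "0 < gram p v"
proof -
  have "gram p v \<noteq> 0"
  proof
    assume "gram p v = 0"
    then obtain c i where c: "i \<in> {1..p}" "c i \<noteq> 0"
      "\<And>i. i \<in> {1..p} \<Longrightarrow> (\<Sum>j=1..p. ip (v i) (v j) * c j) = 0"
      using ldet_eq_0[of p "\<lambda>i j. ip (v i) (v j)"] unfolding gram_def by blast
    define w where "w = (\<Sum>j=1..p. c j *\<^sub>R v j)"
    have z: "ip (v i) w = 0" if "i \<in> {1..p}" for i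
      using c(3)[OF that] by (simp add: w_def ip_sum_right mult.commute)
    have "ip w w = (\<Sum>j=1..p. c j * ip (v j) w)" by (subst (1) w_def) (simp add: ip_sum_left)
    then have "w = 0" using z by simp
    then have z0: "(\<Sum>x\<in>v ` {1..p}. c (inv_into {1..p} v x) *\<^sub>R x) = 0"
      unfolding w_def by (simp add: sum.reindex[OF inj] inv_into_f_f[OF inj])
    have "c (inv_into {1..p} v (v i)) \<noteq> 0" using c(1,2) inv_into_f_f[OF inj c(1)] by simp
    then have "\<exists>u. (\<exists>x\<in>v ` {1..p}. u x \<noteq> 0) \<and> (\<Sum>x\<in>v ` {1..p}. u x *\<^sub>R x) = 0"
      using z0 c(1) by (intro exI[of _ "\<lambda>x. c (inv_into {1..p} v x)"] conjI bexI[of _ "v i"]) auto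
    then have "dependent (v ` {1..p})" using dependent_finite[of "v ` {1..p}"] by simp
    then show False using ind by blast
  qed
  then show ?thesis using gram_nonneg[of p v] by simp
qed

lemma orthonormal_gram:
  assumes "orthonormal k u" "p \<le> k"
  shows "gram p u = 1"
proof -
  have "gram p u = ldet p (\<lambda>i j. if i = j then 1 else 0)"
    unfolding gram_def by (rule ldet_cong) (use assms in \<open>auto simp: orthonormal_def\<close>)
  also have "\<dots> = (\<Sum>\<pi>\<in>{id}. of_int (sign \<pi>) * (\<Prod>i=1..p. if i = \<pi> i then 1 else 0))"
    unfolding ldet_def
  proof (rule sum.mono_neutral_right)
    show "\<forall>\<pi>\<in>{\<pi>. \<pi> permutes {1..p}} - {id}. of_int (sign \<pi>) * (\<Prod>i=1..p. if i = \<pi> i then 1 else (0::real)) = 0"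
    proof
      fix \<pi> assume \<pi>: "\<pi> \<in> {\<pi>. \<pi> permutes {1..p}} - {id}"
      then obtain i where i: "\<pi> i \<noteq> i" by (auto simp: fun_eq_iff)
      then have "i \<in> {1..p}" using \<pi> permutes_not_in by fastforce
      then have "(\<Prod>i=1..p. if i = \<pi> i then 1 else (0::real)) = 0"
        using i by (intro prod_zero) (auto intro!: bexI[of _ i])
      then show "of_int (sign \<pi>) * (\<Prod>i=1..p. if i = \<pi> i then 1 else (0::real)) = 0" by simp
    qed
    show "finite {\<pi>. \<pi> permutes {1..p}}" by (rule finite_permutations) simp
    show "{id} \<subseteq> {\<pi>. \<pi> permutes {1..p}}" using permutes_id by blast
  qed
  finally show ?thesis by simp
qed

context
  fixes A u s assumes f: "singular_frame A u s"
begin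

lemma gram_image_expansion:
  "fact p * gram p (\<lambda>i. A *v v i)
    = (\<Sum>f\<in>{1..p} \<rightarrow>\<^sub>E {1..CARD('n)}. (\<Prod>i=1..p. (s (f i))\<^sup>2) * (ldet p (\<lambda>i j. ip (v i) (u (f j))))\<^sup>2)"
proof -
  have "gram p (\<lambda>i. A *v v i) = ldet p (\<lambda>i j. \<Sum>k=1..CARD('n). (s k)\<^sup>2 * ip (v i) (u k) * ip (v j) (u k))"
    unfolding gram_def by (rule ldet_cong) (rule frame_ip_expansion[OF f])
  then show ?thesis by (simp add: ldet_sum_squares)
qed

text \<open>In the singular frame each squared coordinate of the p-vector is multiplied by the
  square of a product of \<open>p\<close> singular values. For distinct indices the product is at
  most that of the \<open>p\<close> largest; coordinates with a repeated index vanish.\<close>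

lemma gram_image_le:
  assumes p: "p \<le> CARD('n)"
  shows "gram p (\<lambda>i. A *v v i) \<le> (\<Prod>i=1..p. s i)\<^sup>2 * gram p v"
proof -
  have "fact p * gram p (\<lambda>i. A *v v i)
      \<le> (\<Sum>f\<in>{1..p} \<rightarrow>\<^sub>E {1..CARD('n)}. (\<Prod>i=1..p. s i)\<^sup>2 * (ldet p (\<lambda>i j. ip (v i) (u (f j))))\<^sup>2)"
    unfolding gram_image_expansion
  proof (rule sum_mono)
    fix g assume g: "g \<in> {1..p} \<rightarrow>\<^sub>E {1..CARD('n)}"
    show "(\<Prod>i=1..p. (s (g i))\<^sup>2) * (ldet p (\<lambda>i j. ip (v i) (u (g j))))\<^sup>2
        \<le> (\<Prod>i=1..p. s i)\<^sup>2 * (ldet p (\<lambda>i j. ip (v i) (u (g j))))\<^sup>2"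
    proof (cases "inj_on g {1..p}")
      case False
      then show ?thesis using ldet_not_inj[OF False, of "\<lambda>i k. ip (v i) (u k)"] by simp
    next
      case True
      have sub: "g ` {1..p} \<subseteq> {1..CARD('n)}" using g by auto
      have "(\<Prod>i=1..p. s (g i)) = prod s (g ` {1..p})" by (simp add: prod.reindex[OF True])
      also have "\<dots> \<le> (\<Prod>i=1..card (g ` {1..p}). s i)"
        by (rule prod_le_initial_prod[OF _ sub]) (use frame_nonneg[OF f] frame_antimono[OF f] in auto)
      also have "card (g ` {1..p}) = p" using True by (simp add: card_image)
      finally have le: "(\<Prod>i=1..p. s (g i)) \<le> (\<Prod>i=1..p. s i)" .
      have "0 \<le> (\<Prod>i=1..p. s (g i))" using sub frame_nonneg[OF f] by (intro prod_nonneg) blast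
      then have "(\<Prod>i=1..p. s (g i))\<^sup>2 \<le> (\<Prod>i=1..p. s i)\<^sup>2" using le by (intro power_mono)
      then show ?thesis by (intro mult_right_mono) (auto simp: prod_power_distrib)
    qed
  qed
  also have "\<dots> = (\<Prod>i=1..p. s i)\<^sup>2 * (fact p * gram p v)"
    unfolding gram_expansion[OF frame_orthonormal[OF f]] by (simp add: sum_distrib_left)
  finally have "fact p * gram p (\<lambda>i. A *v v i) \<le> fact p * ((\<Prod>i=1..p. s i)\<^sup>2 * gram p v)" by simp
  then show ?thesis by simp
qed

text \<open>Only the coordinate along the first \<open>p\<close> singular vectors is kept. It occurs
  \<open>fact p\<close> times in the expansion, once for every ordering.\<close>

lemma gram_image_ge:
  assumes p: "p \<le> CARD('n)"
  shows "(\<Prod>i=1..p. s i)\<^sup>2 * (ldet p (\<lambda>i j. ip (v i) (u j)))\<^sup>2 \<le> gram p (\<lambda>i. A *v v i)"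
proof -
  let ?P = "{\<pi>. \<pi> permutes {1..p}}"
  let ?t = "\<lambda>g. (\<Prod>i=1..p. (s (g i))\<^sup>2) * (ldet p (\<lambda>i j. ip (v i) (u (g j))))\<^sup>2"
  let ?c = "(\<Prod>i=1..p. s i)\<^sup>2 * (ldet p (\<lambda>i j. ip (v i) (u j)))\<^sup>2"
  have inj: "inj_on (\<lambda>\<pi>. restrict \<pi> {1..p}) ?P"
  proof (rule inj_onI)
    fix \<pi> \<rho> assume *: "\<pi> \<in> ?P" "\<rho> \<in> ?P" "restrict \<pi> {1..p} = restrict \<rho> {1..p}"
    show "\<pi> = \<rho>"
    proof
      fix x
      show "\<pi> x = \<rho> x" using * permutes_not_in[of \<pi> "{1..p}" x] permutes_not_in[of \<rho> "{1..p}" x]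
        by (cases "x \<in> {1..p}") (auto dest: fun_cong[of _ _ x] simp del: atLeastAtMost_iff)
    qed
  qed
  have summand: "?t (restrict \<pi> {1..p}) = ?c" if "\<pi> \<in> ?P" for \<pi>
  proof -
    have \<pi>: "\<pi> permutes {1..p}" using that by simp
    have 1: "(\<Prod>i=1..p. (s (restrict \<pi> {1..p} i))\<^sup>2) = (\<Prod>i=1..p. s i)\<^sup>2"
      using prod.permute[OF \<pi>, of "\<lambda>i. (s i)\<^sup>2"] by (simp add: o_def prod_power_distrib)
    have "ldet p (\<lambda>i j. ip (v i) (u (restrict \<pi> {1..p} j))) = ldet p (\<lambda>i j. ip (v i) (u (\<pi> j)))"
      by (rule ldet_cong) simp
    also have "\<dots> = of_int (sign \<pi>) * ldet p (\<lambda>i j. ip (v i) (u j))"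
      by (rule ldet_permute_columns[OF \<pi>])
    finally have 2: "(ldet p (\<lambda>i j. ip (v i) (u (restrict \<pi> {1..p} j))))\<^sup>2 = (ldet p (\<lambda>i j. ip (v i) (u j)))\<^sup>2"
      by (simp add: power_mult_distrib sign_def)
    show ?thesis by (simp only: 1 2)
  qed
  have "fact p * ?c = (\<Sum>\<pi>\<in>?P. ?c)" by (simp add: card_permutations[of "{1..p}" p])
  also have "\<dots> = (\<Sum>\<pi>\<in>?P. ?t (restrict \<pi> {1..p}))" by (intro sum.cong refl summand[symmetric])
  also have "\<dots> = (\<Sum>g\<in>(\<lambda>\<pi>. restrict \<pi> {1..p}) ` ?P. ?t g)" by (simp only: sum.reindex[OF inj] o_def)
  also have "\<dots> \<le> (\<Sum>g\<in>{1..p} \<rightarrow>\<^sub>E {1..CARD('n)}. ?t g)"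
  proof (rule sum_mono2)
    show "(\<lambda>\<pi>. restrict \<pi> {1..p}) ` ?P \<subseteq> {1..p} \<rightarrow>\<^sub>E {1..CARD('n)}"
    proof
      fix g assume "g \<in> (\<lambda>\<pi>. restrict \<pi> {1..p}) ` ?P"
      then obtain \<pi> where \<pi>: "\<pi> permutes {1..p}" "g = restrict \<pi> {1..p}" by blast
      have "\<pi> x \<in> {1..CARD('n)}" if "x \<in> {1..p}" for x
        using permutes_in_image[OF \<pi>(1), of x] that p by auto
      then show "g \<in> {1..p} \<rightarrow>\<^sub>E {1..CARD('n)}" using \<pi> by (auto simp del: atLeastAtMost_iff)
    qed
    show "finite ({1..p} \<rightarrow>\<^sub>E {1..CARD('n)})" by (intro finite_PiE) simp_all
    show "0 \<le> ?t g" for g by (intro mult_nonneg_nonneg prod_nonneg) simp_all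
  qed
  also have "\<dots> = fact p * gram p (\<lambda>i. A *v v i)" by (rule gram_image_expansion[symmetric])
  finally show ?thesis by simp
qed

end

end

section \<open>Representatives and Cartan projections\<close>

lemma det_scaleR: "det (c *\<^sub>R A :: real^'n^'n) = c ^ CARD('n) * det A"
proof -
  have "c *\<^sub>R (mat 1 :: real^'n^'n) = mat c" by (simp add: Finite_Cartesian_Product.mat_def Finite_Cartesian_Product.vec_eq_iff)
  then have "c *\<^sub>R A = mat c ** A" using scalar_mult_left[of c A] by simp
  then show ?thesis using det_matrix_scaleR[of c, where 'n = 'n] by (simp add: det_mul matrix_scaleR)
qed

lemma PGL_mult_closed:
  "g \<in> carrier PGL \<Longrightarrow> h \<in> carrier PGL \<Longrightarrow> g \<otimes>\<^bsub>PGL\<^esub> h \<in> carrier (PGL :: (real^'n^'n) set monoid)"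
  and PGL_inv_closed: "g \<in> carrier PGL \<Longrightarrow> inv\<^bsub>PGL\<^esub> g \<in> carrier (PGL :: (real^'n^'n) set monoid)"
  and PGL_one_closed: "\<one>\<^bsub>PGL\<^esub> \<in> carrier (PGL :: (real^'n^'n) set monoid)"
proof -
  interpret group "PGL :: (real^'n^'n) set monoid" by (rule group_PGL)
  show "g \<in> carrier PGL \<Longrightarrow> h \<in> carrier PGL \<Longrightarrow> g \<otimes>\<^bsub>PGL\<^esub> h \<in> carrier (PGL :: (real^'n^'n) set monoid)"
    "g \<in> carrier PGL \<Longrightarrow> inv\<^bsub>PGL\<^esub> g \<in> carrier (PGL :: (real^'n^'n) set monoid)"
    "\<one>\<^bsub>PGL\<^esub> \<in> carrier (PGL :: (real^'n^'n) set monoid)" by auto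
qed

lemma PGL_coset:
  assumes "g \<in> carrier (PGL :: (real^'n^'n) set monoid)"
  obtains A where "invertible A" "A \<in> g" "\<And>B. B \<in> g \<longleftrightarrow> (\<exists>c. c \<noteq> 0 \<and> B = c *\<^sub>R A)"
proof -
  obtain A where A: "invertible A" "g = scalars #>\<^bsub>GL\<^esub> A"
    using assms by (auto simp: PGL_def FactGroup_def RCOSETS_def GL_def)
  have iff: "B \<in> g \<longleftrightarrow> (\<exists>c. c \<noteq> 0 \<and> B = c *\<^sub>R A)" for B
    unfolding A(2) by (auto simp: r_coset_def scalars_def GL_def scalar_mult_left)
  then have "A \<in> g" by (metis scaleR_one zero_neq_one)
  then show ?thesis using that A(1) iff by blast
qed

lemma rep_props:
  fixes g :: "(real^'n^'n) set"
  assumes "g \<in> carrier PGL"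
  shows rep_in: "rep g \<in> g" and abs_det_rep: "\<bar>det (rep g)\<bar> = 1"
proof -
  obtain A where A: "invertible A" "A \<in> g" "\<And>B. B \<in> g \<longleftrightarrow> (\<exists>c. c \<noteq> 0 \<and> B = c *\<^sub>R A)"
    using PGL_coset[OF assms] by metis
  have D: "det A \<noteq> 0" using A(1) by (simp add: invertible_det_nz)
  define c where "c = root CARD('n) (1 / \<bar>det A\<bar>)"
  have c: "0 < c" "c ^ CARD('n) = 1 / \<bar>det A\<bar>"
    using D by (auto simp: c_def)
  have "c *\<^sub>R A \<in> g" using A(3)[of "c *\<^sub>R A"] c(1) by (metis less_irrefl)
  moreover have "\<bar>det (c *\<^sub>R A)\<bar> = 1" using c D by (simp add: det_scaleR abs_mult)
  ultimately have "\<exists>A. A \<in> g \<and> \<bar>det A\<bar> = 1" by blast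
  from someI_ex[OF this] show "rep g \<in> g" "\<bar>det (rep g)\<bar> = 1" by (auto simp: rep_def)
qed

lemma PGL_same_coset:
  fixes A B :: "real^'n^'n"
  assumes g: "g \<in> carrier PGL" and "A \<in> g" "B \<in> g" "\<bar>det A\<bar> = 1" "\<bar>det B\<bar> = 1"
  obtains e where "\<bar>e\<bar> = 1" "B = e *\<^sub>R A"
proof -
  obtain X where X: "\<And>B. B \<in> g \<longleftrightarrow> (\<exists>c. c \<noteq> 0 \<and> B = c *\<^sub>R X)"
    using PGL_coset[OF g] by metis
  obtain a b where ab: "a \<noteq> 0" "A = a *\<^sub>R X" "b \<noteq> 0" "B = b *\<^sub>R X" using X assms by metis
  define e where "e = b / a"
  have B: "B = e *\<^sub>R A" using ab by (simp add: e_def)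
  have "\<bar>e\<bar> ^ CARD('n) = 1" using assms(4,5) B by (simp add: det_scaleR abs_mult power_abs)
  then have "\<bar>e\<bar> = 1" using power_eq_iff_eq_base[of "CARD('n)" "\<bar>e\<bar>" 1] by simp
  then show ?thesis using that B by blast
qed

lemma rep_mult:
  fixes g h :: "(real^'n^'n) set"
  assumes "g \<in> carrier PGL" "h \<in> carrier PGL"
  obtains e where "\<bar>e\<bar> = 1" "rep (g \<otimes>\<^bsub>PGL\<^esub> h) = e *\<^sub>R (rep g ** rep h)"
proof -
  have gh: "g \<otimes>\<^bsub>PGL\<^esub> h \<in> carrier PGL" using assms by (rule PGL_mult_closed)
  have "rep g ** rep h \<in> g \<otimes>\<^bsub>PGL\<^esub> h"
    using rep_in[OF assms(1)] rep_in[OF assms(2)] by (auto simp: PGL_def FactGroup_def set_mult_def GL_def)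
  moreover have "\<bar>det (rep g ** rep h)\<bar> = 1"
    using abs_det_rep[OF assms(1)] abs_det_rep[OF assms(2)] by (simp only: det_mul abs_mult mult_1)
  ultimately show ?thesis
    using PGL_same_coset[OF gh, of "rep g ** rep h" "rep (g \<otimes>\<^bsub>PGL\<^esub> h)"] rep_in[OF gh] abs_det_rep[OF gh] that
    by metis
qed

lemma rep_one: obtains e where "\<bar>e\<bar> = 1" "rep \<one>\<^bsub>PGL\<^esub> = e *\<^sub>R (mat 1 :: real^'n^'n)"
proof -
  have o: "\<one>\<^bsub>PGL\<^esub> \<in> carrier (PGL :: (real^'n^'n) set monoid)"
    by (rule PGL_one_closed)
  have "(mat 1 :: real^'n^'n) = 1 *\<^sub>R mat 1" by simp
  then have "(mat 1 :: real^'n^'n) \<in> \<one>\<^bsub>PGL\<^esub>"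
    unfolding PGL_def FactGroup_def scalars_def by (auto intro!: exI[of _ 1])
  then show ?thesis using PGL_same_coset[OF o _ rep_in[OF o] _ abs_det_rep[OF o]] that by (metis abs_one det_I)
qed

lemma invertible_rep: "g \<in> carrier PGL \<Longrightarrow> invertible (rep g)"
  using abs_det_rep[of g] by (auto simp: invertible_det_nz)

lemma rep_mult_vector:
  assumes "g \<in> carrier PGL" "h \<in> carrier PGL"
  obtains e where "\<bar>e\<bar> = 1" "\<And>v. rep (g \<otimes>\<^bsub>PGL\<^esub> h) *v v = e *\<^sub>R (rep g *v (rep h *v v))"
  using rep_mult[OF assms] that
  by (metis matrix_vector_mul_assoc scaleR_matrix_vector_assoc)

lemma rep_inv_vector:
  fixes g :: "(real^'n^'n) set"
  assumes g: "g \<in> carrier PGL"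
  obtains e where "\<bar>e\<bar> = 1" "\<And>v. rep g *v (rep (inv\<^bsub>PGL\<^esub> g) *v v) = e *\<^sub>R v"
proof -
  interpret group "PGL :: (real^'n^'n) set monoid" by (rule group_PGL)
  obtain e where e: "\<bar>e\<bar> = 1" "\<And>v. rep (g \<otimes>\<^bsub>PGL\<^esub> inv\<^bsub>PGL\<^esub> g) *v v = e *\<^sub>R (rep g *v (rep (inv\<^bsub>PGL\<^esub> g) *v v))"
    using rep_mult_vector[OF g inv_closed[OF g]] by metis
  obtain e' where e': "\<bar>e'\<bar> = 1" "rep \<one>\<^bsub>PGL\<^esub> = e' *\<^sub>R (mat 1 :: real^'n^'n)" using rep_one by metis
  have "e' *\<^sub>R v = e *\<^sub>R (rep g *v (rep (inv\<^bsub>PGL\<^esub> g) *v v))" for v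
    using e(2)[of v] e'(2) g by (simp add: scaleR_matrix_vector_assoc[symmetric])
  moreover have "e * e = 1" using e(1) by (metis abs_mult_self_eq mult_1)
  ultimately have "rep g *v (rep (inv\<^bsub>PGL\<^esub> g) *v v) = (e * e') *\<^sub>R v" for v
    by (metis scaleR_one scaleR_scaleR)
  moreover have "\<bar>e * e'\<bar> = 1" using e e' by (simp add: abs_mult)
  ultimately show ?thesis using that by blast
qed

context scalar_product
begin

lemma nrm_unit_scale [simp]: "\<bar>e\<bar> = 1 \<Longrightarrow> nrm (e *\<^sub>R v) = nrm v"
  by (simp add: nrm_scale)

lemma gram_scale: "\<bar>e\<bar> = 1 \<Longrightarrow> gram p (\<lambda>i. e *\<^sub>R v i) = gram p v"
proof -
  assume e: "\<bar>e\<bar> = 1"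
  then have ee: "e * e = 1" by (metis abs_mult_self_eq mult_1)
  have "ip (e *\<^sub>R v i) (e *\<^sub>R v j) = (e * e) * ip (v i) (v j)" for i j by (simp add: mult.assoc)
  then show ?thesis unfolding gram_def by (simp only: ee mult_1_left)
qed

text \<open>Right singular vectors are determined at best up to sign, so this is a choice;
  everything later goes through \<open>frame_rep\<close>.\<close>

definition fr :: "(real^'n^'n) set \<Rightarrow> (nat \<Rightarrow> real^'n)" where
  "fr g = fst (SOME us. singular_frame (rep g) (fst us) (snd us))"

definition sg :: "(real^'n^'n) set \<Rightarrow> nat \<Rightarrow> real" where
  "sg g = snd (SOME us. singular_frame (rep g) (fst us) (snd us))"

lemma frame_rep: "singular_frame (rep g) (fr g) (sg g)"
proof -
  have "\<exists>us. singular_frame (rep g) (fst us) (snd us)"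
    using singular_frame_exists[of "rep g"] by (metis fst_conv snd_conv)
  from someI_ex[OF this] show ?thesis unfolding fr_def sg_def .
qed

lemma sing_val_eq: "i \<in> {1..CARD('n)} \<Longrightarrow> sing_val ip i g = sg g i"
  unfolding sing_val_def by (rule singular_values_nth[OF frame_rep])

lemma prod_sg: "g \<in> carrier PGL \<Longrightarrow> (\<Prod>i=1..CARD('n). sg g i) = 1"
  using prod_singular_values[OF frame_rep, of g] abs_det_rep[of g] by simp

lemma sg_pos:
  assumes g: "g \<in> carrier PGL" and i: "i \<in> {1..CARD('n)}"
  shows "0 < sg g i"
proof -
  have "sg g i \<noteq> 0"
  proof
    assume "sg g i = 0"
    then have "(\<Prod>i=1..CARD('n). sg g i) = 0" using i by (intro prod_zero) auto
    then show False using prod_sg[OF g] by simp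
  qed
  then show ?thesis using frame_nonneg[OF frame_rep i, of g] by simp
qed

abbreviation "cp \<equiv> cartan_projection ip"

lemma cp_cartan: "g \<in> carrier PGL \<Longrightarrow> cp g \<in> cartan CARD('n)"
proof -
  assume g: "g \<in> carrier PGL"
  have "(\<Sum>i=1..CARD('n). cp g i) = (\<Sum>i=1..CARD('n). ln (sg g i))"
    by (intro sum.cong refl) (simp add: cartan_projection_def sing_val_eq)
  also have "\<dots> = ln (\<Prod>i=1..CARD('n). sg g i)"
    using sg_pos[OF g] by (intro ln_prod[symmetric]) (auto simp: less_imp_neq[symmetric])
  also have "\<dots> = 0" by (simp add: prod_sg[OF g])
  finally show ?thesis by (auto simp: cartan_def cartan_projection_def)
qed

lemma prod_sg_pos: "g \<in> carrier PGL \<Longrightarrow> p \<le> CARD('n) \<Longrightarrow> 0 < (\<Prod>i=1..p. sg g i)"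
  using sg_pos by (intro prod_pos) auto

lemma weight_cp:
  assumes g: "g \<in> carrier PGL" and p: "p \<le> CARD('n)"
  shows "weight p (cp g) = ln (\<Prod>i=1..p. sg g i)"
proof -
  have "weight p (cp g) = (\<Sum>i=1..p. ln (sg g i))"
    unfolding weight_def using p by (intro sum.cong refl) (auto simp: cartan_projection_def sing_val_eq)
  also have "\<dots> = ln (\<Prod>i=1..p. sg g i)"
    using sg_pos[OF g] p by (intro ln_prod[symmetric]) (auto simp: less_imp_neq[symmetric])
  finally show ?thesis .
qed

text \<open>\<open>weight p (cp g)\<close> is the logarithm of the operator norm of \<open>g\<close>
  on the \<open>p\<close>-th exterior power, and operator norms are submultiplicative. The norm of
  the product is attained on the first \<open>p\<close> vectors of its own frame.\<close>

lemma weight_cp_mult_le: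
  assumes g: "g \<in> carrier PGL" and h: "h \<in> carrier PGL" and p: "p \<le> CARD('n)"
  shows "weight p (cp (g \<otimes>\<^bsub>PGL\<^esub> h)) \<le> weight p (cp g) + weight p (cp h)"
proof -
  let ?gh = "g \<otimes>\<^bsub>PGL\<^esub> h"
  have gh: "?gh \<in> carrier PGL" using g h by (rule PGL_mult_closed)
  obtain e where e: "\<bar>e\<bar> = 1" "\<And>v. rep ?gh *v v = e *\<^sub>R (rep g *v (rep h *v v))"
    using rep_mult_vector[OF g h] by metis
  have o: "orthonormal CARD('n) (fr ?gh)" by (rule frame_orthonormal[OF frame_rep])
  have "ldet p (\<lambda>i j. ip (fr ?gh i) (fr ?gh j)) = 1" using orthonormal_gram[OF o p] by (simp add: gram_def)
  then have "(\<Prod>i=1..p. sg ?gh i)\<^sup>2 \<le> gram p (\<lambda>i. rep ?gh *v fr ?gh i)"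
    using gram_image_ge[OF frame_rep p, of ?gh "fr ?gh"] by simp
  also have "\<dots> = gram p (\<lambda>i. rep g *v (rep h *v fr ?gh i))"
    unfolding e(2) by (rule gram_scale[OF e(1)])
  also have "\<dots> \<le> (\<Prod>i=1..p. sg g i)\<^sup>2 * gram p (\<lambda>i. rep h *v fr ?gh i)"
    by (rule gram_image_le[OF frame_rep p])
  also have "\<dots> \<le> (\<Prod>i=1..p. sg g i)\<^sup>2 * ((\<Prod>i=1..p. sg h i)\<^sup>2 * gram p (fr ?gh))"
    by (intro mult_left_mono gram_image_le[OF frame_rep p]) simp
  also have "\<dots> = ((\<Prod>i=1..p. sg g i) * (\<Prod>i=1..p. sg h i))\<^sup>2"
    using orthonormal_gram[OF o p] by (simp add: power_mult_distrib)
  finally have "(\<Prod>i=1..p. sg ?gh i) \<le> (\<Prod>i=1..p. sg g i) * (\<Prod>i=1..p. sg h i)"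
    by (rule power2_le_imp_le) (use prod_sg_pos[OF g p] prod_sg_pos[OF h p] in simp)
  then have "ln (\<Prod>i=1..p. sg ?gh i) \<le> ln ((\<Prod>i=1..p. sg g i) * (\<Prod>i=1..p. sg h i))"
    using prod_sg_pos[OF gh p] by (rule ln_mono)
  also have "\<dots> = ln (\<Prod>i=1..p. sg g i) + ln (\<Prod>i=1..p. sg h i)"
    using prod_sg_pos[OF g p] prod_sg_pos[OF h p] by (intro ln_mult_pos)
  finally show ?thesis unfolding weight_cp[OF g p] weight_cp[OF h p] weight_cp[OF gh p] .
qed

text \<open>The singular values have product 1, and all factors after the second are at most
  \<open>sg g 1\<close>. Together with the Anosov estimate this makes \<open>sg g 1\<close> large on
  long elements.\<close>

lemma sg1_large:
  assumes g: "g \<in> carrier PGL" and d: "2 \<le> CARD('n)"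
  shows "sg g 1 \<le> sg g 2 * sg g 1 ^ CARD('n)"
proof -
  have p1: "0 < sg g 1" and p2: "0 < sg g 2" using sg_pos[OF g] d by auto
  have split: "{1..CARD('n)} = insert 1 (insert 2 {3..CARD('n)})" using d by auto
  have "1 = (\<Prod>i=1..CARD('n). sg g i)" by (simp add: prod_sg[OF g])
  also have "\<dots> = sg g 1 * (sg g 2 * (\<Prod>i=3..CARD('n). sg g i))"
    unfolding split by simp
  also have "\<dots> \<le> sg g 1 * (sg g 2 * (\<Prod>i=3..CARD('n). sg g 1))"
    using p1 p2 frame_nonneg[OF frame_rep] frame_antimono[OF frame_rep, of 1]
    by (intro mult_left_mono prod_mono) auto
  also have "(\<Prod>i=3..CARD('n). sg g 1) = sg g 1 ^ (CARD('n) - 2)"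
    by simp
  finally have "1 \<le> sg g 1 * (sg g 2 * sg g 1 ^ (CARD('n) - 2))" .
  then have "sg g 1 * 1 \<le> sg g 1 * (sg g 1 * (sg g 2 * sg g 1 ^ (CARD('n) - 2)))"
    using p1 by (intro mult_left_mono) auto
  also have "\<dots> = sg g 2 * sg g 1 ^ (Suc (Suc (CARD('n) - 2)))" by (simp add: mult_ac)
  also have "Suc (Suc (CARD('n) - 2)) = CARD('n)" using d by simp
  finally show ?thesis by simp
qed

end

section \<open>Recovering a vector of \<open>cartan_sub\<close> from its weights\<close>

lemma discrete_max_principle:
  fixes w :: "nat \<Rightarrow> real"
  assumes "w 0 \<le> 0" "w d \<le> 0" and "\<And>i. 0 < i \<Longrightarrow> i < d \<Longrightarrow> w i \<le> 0 \<or> 2 * w i \<le> w (i - 1) + w (i + 1)"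
    and "i \<le> d"
  shows "w i \<le> 0"
proof (rule ccontr)
  assume neg: "\<not> ?thesis"
  define M where "M = Max (w ` {0..d})"
  have M: "w j \<le> M" if "j \<le> d" for j using that by (auto simp: M_def)
  have M0: "0 < M" using M[OF assms(4)] neg by linarith
  have "M \<in> w ` {0..d}" unfolding M_def by (intro Max_in) auto
  then have ex: "\<exists>j. j \<le> d \<and> w j = M" by auto
  \<comment> \<open>The leftmost maximum: its left neighbour is strictly smaller, which contradicts
    convexity at \<open>k\<close>.\<close>
  define k where "k = (LEAST j. j \<le> d \<and> w j = M)"
  have k: "k \<le> d" "w k = M" using LeastI_ex[OF ex] by (auto simp: k_def)
  have least: "\<not> (j \<le> d \<and> w j = M)" if "j < k" for j using not_less_Least[of j] that by (auto simp: k_def)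
  have "k \<noteq> 0" "k \<noteq> d" using k(2) assms(1,2) M0 by (metis not_less)+
  then have k': "0 < k" "k < d" using k(1) by auto
  then have "2 * w k \<le> w (k - 1) + w (k + 1)" using assms(3)[of k] k(2) M0 by auto
  moreover have "w (k - 1) < M" using M[of "k - 1"] least[of "k - 1"] k' by force
  moreover have "w (k + 1) \<le> M" using M[of "k + 1"] k' by simp
  ultimately show False using k(2) by simp
qed

lemma weight_Suc: "weight (Suc p) a = weight p a + a (Suc p)"
  by (simp add: weight_def One_nat_def)

lemma weight_0 [simp]: "weight 0 a = 0"
  by (simp add: weight_def One_nat_def)

text \<open>Away from \<Theta> consecutive coordinates agree, so the weights are affine in the index
  there; at 0 and \<open>d\<close> they vanish. The difference of the weights of \<open>a\<close>
  and \<open>b\<close> is zero on \<Theta>, and the maximum principle applies to it with both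
  signs.\<close>

lemma cartan_sub_unique:
  assumes \<Theta>: "\<Theta> \<subseteq> {1..d - 1}" and a: "a \<in> cartan_sub d \<Theta>" and b: "b \<in> cartan_sub d \<Theta>"
    and eq: "\<And>p. p \<in> \<Theta> \<Longrightarrow> weight p a = weight p b"
  shows "a = b"
proof -
  have le: "weight i a - weight i b \<le> 0"
    if a: "a \<in> cartan_sub d \<Theta>" and b: "b \<in> cartan_sub d \<Theta>" and eq: "\<And>p. p \<in> \<Theta> \<Longrightarrow> weight p a = weight p b"
      and i: "i \<le> d" for a b i
  proof (rule discrete_max_principle[where d = d, OF _ _ _ i])
    show "weight d a - weight d b \<le> 0" using a b by (simp add: weight_def cartan_sub_def cartan_def)
    fix i assume i: "0 < i" "i < d"
    show "weight i a - weight i b \<le> 0 \<or> 2 * (weight i a - weight i b)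
        \<le> weight (i - 1) a - weight (i - 1) b + (weight (i + 1) a - weight (i + 1) b)"
    proof (cases "i \<in> \<Theta>")
      case False
      have "i \<in> {1..d - 1} - \<Theta>" using i False by auto
      then have "a i = a (i + 1)" "b i = b (i + 1)"
        using a b by (auto simp: cartan_sub_def simple_root_def)
      moreover have "weight (i + 1) c = weight i c + c (i + 1)" "weight i c = weight (i - 1) c + c i" for c
        using weight_Suc[of i c] weight_Suc[of "i - 1" c] i by (simp_all add: Suc_eq_plus1)
      ultimately show ?thesis by simp
    qed (use eq in simp)
  qed simp
  have w: "weight i a = weight i b" if "i \<le> d" for i
    using le[OF a b eq that] le[OF b a eq[symmetric] that] by simp
  show ?thesis
  proof
    fix i
    show "a i = b i"
    proof (cases "i \<in> {1..d}")
      case True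
      then obtain j where "i = Suc j" by (cases i) auto
      then show ?thesis using w[of i] w[of j] True by (simp add: weight_Suc)
    qed (use a b in \<open>simp add: cartan_sub_def cartan_def\<close>)
  qed
qed

text \<open>The weights are prescribed at the nodes 0, \<Theta> and \<open>d\<close>, with value 0
  at both ends, and interpolated linearly in between; \<open>b\<close> is the sequence of
  slopes.\<close>

lemma cartan_sub_interpolation:
  assumes \<Theta>: "\<Theta> \<subseteq> {1..d - 1}"
  shows "\<exists>b\<in>cartan_sub d \<Theta>. \<forall>p\<in>\<Theta>. weight p b = W p"
proof -
  have fin: "finite \<Theta>" using \<Theta> finite_subset by blast
  have \<Theta>': "0 \<notin> \<Theta>" "d \<notin> \<Theta>" "\<And>p. p \<in> \<Theta> \<Longrightarrow> p < d"
  proof -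
    show "0 \<notin> \<Theta>" using \<Theta> by auto
    show "p < d" if "p \<in> \<Theta>" for p
    proof -
      have "1 \<le> p \<and> p \<le> d - 1" using \<Theta> that by auto
      then show ?thesis by linarith
    qed
    then show "d \<notin> \<Theta>" by blast
  qed
  \<comment> \<open>The index \<open>i\<close> stands for the step from \<open>i - 1\<close> to
    \<open>i\<close>: its left node is strictly below \<open>i\<close>, while its right node may be
    \<open>i\<close> itself.\<close>
  define lo where "lo i = Max {q \<in> insert 0 \<Theta>. q < i}" for i
  define hi where "hi i = Min {q \<in> insert d \<Theta>. i \<le> q}" for i
  define V where "V q = (if q \<in> \<Theta> then W q else 0)" for q
  define b where "b i = (if i \<in> {1..d} then (V (hi i) - V (lo i)) / (real (hi i) - real (lo i)) else 0)" for i
  have lo: "lo i \<in> insert 0 \<Theta>" "lo i < i" "\<And>q. q \<in> insert 0 \<Theta> \<Longrightarrow> q < i \<Longrightarrow> q \<le> lo i" if "0 < i" for i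
  proof -
    have "lo i \<in> {q \<in> insert 0 \<Theta>. q < i}" unfolding lo_def using fin that by (intro Max_in) auto
    then show "lo i \<in> insert 0 \<Theta>" "lo i < i" by auto
    show "q \<le> lo i" if "q \<in> insert 0 \<Theta>" "q < i" for q unfolding lo_def using fin that by (intro Max_ge) auto
  qed
  have wt: "q \<le> d \<Longrightarrow> q \<in> insert 0 (insert d \<Theta>) \<Longrightarrow> weight q b = V q" for q
  proof (induction q rule: less_induct)
    case (less q)
    show ?case
    proof (cases "q = 0")
      case True
      then show ?thesis using \<Theta>' by (simp add: V_def)
    next
      case False
      define l where "l = lo q"
      have l: "l \<in> insert 0 \<Theta>" "l < q" "\<And>x. x \<in> insert 0 \<Theta> \<Longrightarrow> x < q \<Longrightarrow> x \<le> l"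
        using lo[of q] False by (auto simp: l_def)
      have wl: "weight l b = V l" using less.IH[OF l(2)] l less.prems by auto
      have qd: "q \<in> insert d \<Theta>" using less.prems False by auto
      have bi: "b i = (V q - V l) / (real q - real l)" if i: "i \<in> {l + 1..q}" for i
      proof -
        have "hi i = q" unfolding hi_def
        proof (rule Min_eqI)
          fix y assume y: "y \<in> {q \<in> insert d \<Theta>. i \<le> q}"
          show "q \<le> y"
          proof (rule ccontr)
            assume "\<not> q \<le> y"
            then have "y < q" by simp
            then have "y \<in> \<Theta>" using y less.prems by auto
            then have "y \<le> l" using l(3) \<open>y < q\<close> by auto
            then show False using y i by auto
          qed
        qed (use fin qd i in auto)
        moreover have "lo i = l" unfolding lo_def
        proof (rule Max_eqI)
          fix y assume y: "y \<in> {q \<in> insert 0 \<Theta>. q < i}"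
          then show "y \<le> l" using l(3)[of y] i by auto
        qed (use fin l i in auto)
        ultimately show ?thesis using i less.prems by (auto simp: b_def)
      qed
      have "weight q b = weight l b + (\<Sum>i=l+1..q. b i)"
        unfolding weight_def using l(2) sum.ub_add_nat[of 1 l b "q - l"] by simp
      also have "(\<Sum>i=l+1..q. b i) = (\<Sum>i=l+1..q. (V q - V l) / (real q - real l))"
        by (intro sum.cong refl bi)
      also have "\<dots> = V q - V l" using l(2) by (simp add: of_nat_diff)
      finally show ?thesis using wl by simp
    qed
  qed
  have "b \<in> cartan_sub d \<Theta>"
    unfolding cartan_sub_def cartan_def
  proof (intro CollectI conjI allI impI ballI)
    show "b i = 0" if "i \<notin> {1..d}" for i using that by (simp only: b_def if_False)
    show "(\<Sum>i=1..d. b i) = 0" using wt[of d] \<Theta>' by (simp add: weight_def V_def)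
    fix p assume p: "p \<in> {1..d - 1} - \<Theta>"
    have ne: "q \<noteq> p" if "q \<in> insert 0 \<Theta> \<or> q \<in> insert d \<Theta>" for q using p that by auto
    have "q \<in> insert 0 \<Theta> \<and> q < p \<longleftrightarrow> q \<in> insert 0 \<Theta> \<and> q < p + 1" for q using ne[of q] by linarith
    moreover have "q \<in> insert d \<Theta> \<and> p \<le> q \<longleftrightarrow> q \<in> insert d \<Theta> \<and> p + 1 \<le> q" for q using ne[of q] by linarith
    ultimately have "lo p = lo (p + 1)" "hi p = hi (p + 1)" unfolding lo_def hi_def by simp_all
    moreover have "p \<in> {1..d}" "p + 1 \<in> {1..d}" using p by auto
    ultimately show "simple_root p b = 0" unfolding simple_root_def b_def by simp
  qed
  moreover have "weight p b = W p" if "p \<in> \<Theta>" for p using wt[of p] \<Theta>'(3)[OF that] that by (simp add: V_def)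
  ultimately show ?thesis by blast
qed

section \<open>Flags and the Iwasawa cocycle\<close>

lemma flag_basis:
  fixes x :: "nat \<Rightarrow> (real^'n) set"
  assumes "x \<in> flags \<Theta>" "p \<in> \<Theta>"
  shows "\<exists>v. is_basis p v (x p)"
proof -
  have x: "subspace (x p)" "dim (x p) = p" using assms by (auto simp: flags_def)
  obtain B where B: "B \<subseteq> x p" "independent B" "x p \<subseteq> span B" "card B = dim (x p)"
    using basis_exists[of "x p"] by metis
  have "finite B" using B(2) by (rule independent_imp_finite)
  then obtain h where h: "bij_betw h {1..card B} B" using ex_bij_betw_nat_finite_1 by blast
  have "span B = x p" using B x(1) by (metis span_subspace)
  then have "is_basis p h (x p)"
    using h B x by (auto simp: is_basis_def bij_betw_def)
  then show ?thesis by blast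
qed

lemma basis_coefficients:
  assumes v: "is_basis p v V" and w: "w ` {1..p} \<subseteq> V"
  shows "\<exists>c. \<forall>i\<in>{1..p}. w i = (\<Sum>j=1..p. c i j *\<^sub>R v j)"
proof -
  have inj: "inj_on v {1..p}" using v by (simp add: is_basis_def)
  have "\<exists>c. w i = (\<Sum>j=1..p. c j *\<^sub>R v j)" if "i \<in> {1..p}" for i
  proof -
    have "w i \<in> span (v ` {1..p})" using v w that by (auto simp: is_basis_def)
    then obtain u where "w i = (\<Sum>x\<in>v ` {1..p}. u x *\<^sub>R x)"
      by (subst (asm) span_finite) auto
    then show ?thesis by (intro exI[of _ "\<lambda>j. u (v j)"]) (simp add: sum.reindex[OF inj])
  qed
  then show ?thesis by metis
qed

lemma is_basis_vimage: "is_basis p w V \<Longrightarrow> w ` {1..p} \<subseteq> V"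
  using span_superset by (fastforce simp: is_basis_def)

lemma is_basis_initial:
  fixes v :: "nat \<Rightarrow> real^'n"
  assumes v: "is_basis CARD('n) v UNIV" and p: "p \<le> CARD('n)"
  shows "is_basis p v (span (v ` {1..p}))"
proof -
  have sub: "{1..p} \<subseteq> {1..CARD('n)}" using p by auto
  have "independent (v ` {1..p})"
    using v sub by (meson independent_mono image_mono is_basis_def)
  moreover have "inj_on v {1..p}" using v sub by (meson inj_on_subset is_basis_def)
  ultimately show ?thesis by (simp add: is_basis_def)
qed

lemma index_le_card: "\<Theta> \<subseteq> {1..CARD('n) - 1} \<Longrightarrow> p \<in> \<Theta> \<Longrightarrow> 1 \<le> p \<and> p < CARD('n::finite)"
proof -
  assume "\<Theta> \<subseteq> {1..CARD('n) - 1}" "p \<in> \<Theta>"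
  then have "1 \<le> p \<and> p \<le> CARD('n) - 1" by auto
  then show ?thesis by linarith
qed

lemma frame_flag_basis:
  fixes v :: "nat \<Rightarrow> real^'n"
  assumes "\<Theta> \<subseteq> {1..CARD('n) - 1}" "p \<in> \<Theta>" "is_basis CARD('n) v UNIV"
  shows "is_basis p v (frame_flag \<Theta> v p)"
  using is_basis_initial[OF assms(3), of p] index_le_card[OF assms(1,2)] assms(2) by (simp add: frame_flag_def)

lemma is_basis_image:
  fixes A :: "real^'n^'n"
  assumes A: "invertible A" and v: "is_basis p v V"
  shows "is_basis p (\<lambda>i. A *v v i) ((\<lambda>x. A *v x) ` V)"
proof -
  have inj: "inj ((*v) A)" using A by (simp add: inj_matrix_vector_mult)
  have im: "(\<lambda>i. A *v v i) ` {1..p} = (*v) A ` (v ` {1..p})" by (simp add: image_image)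
  have "independent ((*v) A ` (v ` {1..p}))"
    using v inj_on_subset[OF inj] by (intro linear_independent_injective_image matrix_vector_mul_linear)
      (auto simp: is_basis_def)
  moreover have "span ((*v) A ` (v ` {1..p})) = (*v) A ` V"
    using v linear_span_image[OF matrix_vector_mul_linear, of A "v ` {1..p}"] by (simp add: is_basis_def)
  moreover have "inj_on (\<lambda>i. A *v v i) {1..p}"
  proof -
    have "inj_on v {1..p}" using v by (simp add: is_basis_def)
    then have "inj_on ((*v) A \<circ> v) {1..p}" by (rule comp_inj_on) (rule inj_on_subset[OF inj subset_UNIV])
    then show ?thesis by (simp add: o_def)
  qed
  ultimately show ?thesis by (simp add: is_basis_def im)
qed

lemma flag_action_frame_flag:
  fixes v :: "nat \<Rightarrow> real^'n"
  shows "flag_action \<Theta> g (frame_flag \<Theta> v) = frame_flag \<Theta> (\<lambda>i. rep g *v v i)"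
proof
  fix p
  have "span ((\<lambda>i. rep g *v v i) ` {1..p}) = (*v) (rep g) ` span (v ` {1..p})"
    using linear_span_image[OF matrix_vector_mul_linear, of "rep g" "v ` {1..p}"] by (simp add: image_image)
  then show "flag_action \<Theta> g (frame_flag \<Theta> v) p = frame_flag \<Theta> (\<lambda>i. rep g *v v i) p"
    by (simp add: flag_action_def frame_flag_def restrict_def)
qed

lemma flag_action_in_flags:
  fixes x :: "nat \<Rightarrow> (real^'n) set"
  assumes g: "g \<in> carrier PGL" and x: "x \<in> flags \<Theta>"
  shows "flag_action \<Theta> g x \<in> flags \<Theta>"
proof -
  have inj: "inj ((*v) (rep g))" using invertible_rep[OF g] by (simp add: inj_matrix_vector_mult)
  show ?thesis unfolding flags_def
  proof (intro CollectI conjI ballI impI)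
    show "flag_action \<Theta> g x \<in> extensional \<Theta>" by (simp add: flag_action_def)
    fix p assume p: "p \<in> \<Theta>"
    have xp: "subspace (x p)" "dim (x p) = p" using x p by (auto simp: flags_def)
    show "subspace (flag_action \<Theta> g x p)"
      using p xp by (simp add: flag_action_def linear_subspace_image[OF matrix_vector_mul_linear])
    show "dim (flag_action \<Theta> g x p) = p"
      using p xp dim_image_eq[OF matrix_vector_mul_linear, of "rep g" "x p"] inj
      by (simp add: flag_action_def inj_on_subset)
    fix q assume q: "q \<in> \<Theta>" "p \<le> q"
    then have "x p \<subseteq> x q" using x p by (auto simp: flags_def)
    then show "flag_action \<Theta> g x p \<subseteq> flag_action \<Theta> g x q"
      using p q by (auto simp: flag_action_def)
  qed
qed

text \<open>The set of bases is itself open, so the preimage of \<open>U\<close> may be described by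
  a condition \<open>S\<close> on arbitrary families of vectors.\<close>

lemma openin_flag_topologyI:
  fixes U :: "(nat \<Rightarrow> (real^'n) set) set"
  assumes "U \<subseteq> flags \<Theta>" "open S"
    and "\<And>v. is_basis CARD('n) v UNIV \<Longrightarrow> frame_flag \<Theta> v \<in> U \<longleftrightarrow> v \<in> S"
  shows "openin (flag_topology \<Theta>) U"
proof -
  have "{v. is_basis CARD('n) v UNIV \<and> frame_flag \<Theta> v \<in> U} = {v. is_basis CARD('n) v UNIV} \<inter> S"
    using assms(3) by blast
  then show ?thesis using assms open_bases by (auto simp: openin_flag_topology)
qed

text \<open>The action lifts to the continuous map that applies \<open>rep g\<close> to every vector
  of a basis.\<close>

lemma openin_flag_action_vimage:
  fixes U :: "(nat \<Rightarrow> (real^'n) set) set"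
  assumes \<Theta>: "\<Theta> \<subseteq> {1..CARD('n) - 1}" and g: "g \<in> carrier PGL" and U: "openin (flag_topology \<Theta>) U"
  shows "openin (flag_topology \<Theta>) {x \<in> flags \<Theta>. flag_action \<Theta> g x \<in> U}"
proof (rule openin_flag_topologyI)
  let ?T = "{v. is_basis CARD('n) v UNIV \<and> frame_flag \<Theta> v \<in> U}"
  let ?m = "\<lambda>(v :: nat \<Rightarrow> real^'n) i. rep g *v v i"
  have cont: "continuous_on UNIV ?m"
  proof (rule continuous_on_coordinatewise_then_product)
    fix i :: nat
    have "continuous_on UNIV (\<lambda>v :: nat \<Rightarrow> real^'n. v i)" by (rule continuous_on_product_coordinates)
    then show "continuous_on UNIV (\<lambda>v :: nat \<Rightarrow> real^'n. rep g *v v i)"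
      by (rule matrix_vector_mult_linear_continuous_on[THEN continuous_on_compose2]) auto
  qed
  have "open ?T" using U by (simp add: openin_flag_topology)
  then show "open (?m -` ?T)" using cont by (rule open_vimage)
  fix v :: "nat \<Rightarrow> real^'n" assume v: "is_basis CARD('n) v UNIV"
  have gv: "is_basis CARD('n) (?m v) UNIV"
  proof -
    have "surj ((*v) (rep g))" using invertible_rep[OF g] by (metis invertible_def matrix_right_invertible_surjective)
    then show ?thesis using is_basis_image[OF invertible_rep[OF g] v] by simp
  qed
  have "\<Theta> \<subseteq> {1..CARD('n)}" using index_le_card[OF \<Theta>] by (auto simp: less_imp_le)
  then have "frame_flag \<Theta> v \<in> flags \<Theta>" using v by (rule frame_flag_in_flags)
  then show "frame_flag \<Theta> v \<in> {x \<in> flags \<Theta>. flag_action \<Theta> g x \<in> U} \<longleftrightarrow> v \<in> ?m -` ?T"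
    using gv by (simp add: flag_action_frame_flag)
qed auto

context scalar_product
begin

lemma basis_gram_pos: "is_basis p v V \<Longrightarrow> 0 < gram p v"
  by (intro gram_pos) (auto simp: is_basis_def)

lemma basis_wedge_pos: "is_basis p v V \<Longrightarrow> 0 < wedge_norm ip p v"
  using basis_gram_pos by (simp add: wedge_norm_gram)

text \<open>All these quantities are multiplied by the determinant of the change of basis or by its
  absolute value. Their quotients depend on the subspace only, which makes the cocycle and the
  basins well defined.\<close>

lemma basis_change:
  assumes v: "is_basis p v V" and w: "is_basis p w V"
  obtains c where "0 < \<bar>ldet p c\<bar>" "wedge_norm ip p w = \<bar>ldet p c\<bar> * wedge_norm ip p v"
    "\<And>A. wedge_norm ip p (\<lambda>i. A *v w i) = \<bar>ldet p c\<bar> * wedge_norm ip p (\<lambda>i. A *v v i)"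
    "\<And>u. ldet p (\<lambda>i j. ip (w i) (u j)) = ldet p c * ldet p (\<lambda>i j. ip (v i) (u j))"
proof -
  obtain c where c: "\<And>i. i \<in> {1..p} \<Longrightarrow> w i = (\<Sum>j=1..p. c i j *\<^sub>R v j)"
    using basis_coefficients[OF v is_basis_vimage[OF w]] by metis
  have g: "gram p w = (ldet p c)\<^sup>2 * gram p v" by (rule gram_change_basis) (rule c)
  show ?thesis
  proof (rule that)
    show "0 < \<bar>ldet p c\<bar>" using g basis_gram_pos[OF w] by auto
    show "wedge_norm ip p w = \<bar>ldet p c\<bar> * wedge_norm ip p v"
      by (simp add: wedge_norm_gram g real_sqrt_mult)
    fix A :: "real^'n^'n"
    have "gram p (\<lambda>i. A *v w i) = (ldet p c)\<^sup>2 * gram p (\<lambda>i. A *v v i)"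
    proof (rule gram_change_basis)
      fix i assume "i \<in> {1..p}"
      then show "A *v w i = (\<Sum>j=1..p. c i j *\<^sub>R (A *v v j))"
        by (simp add: c linear_sum[OF matrix_vector_mul_linear] matrix_vector_mult_scaleR)
    qed
    then show "wedge_norm ip p (\<lambda>i. A *v w i) = \<bar>ldet p c\<bar> * wedge_norm ip p (\<lambda>i. A *v v i)"
      by (simp add: wedge_norm_gram real_sqrt_mult)
  next
    fix u :: "nat \<Rightarrow> real^'n"
    have "ldet p (\<lambda>i j. ip (w i) (u j)) = ldet p (\<lambda>i j. \<Sum>k=1..p. c i k * ip (v k) (u j))"
      by (rule ldet_cong) (simp add: c ip_sum_left)
    then show "ldet p (\<lambda>i j. ip (w i) (u j)) = ldet p c * ldet p (\<lambda>i j. ip (v i) (u j))"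
      by (simp only: ldet_mult[of p c "\<lambda>k j. ip (v k) (u j)"])
  qed
qed

text \<open>Interpolation provides a vector with the required weights, and its uniqueness gives the
  definite description in \<open>iwasawa\<close> its meaning.\<close>

lemma iwasawa_props:
  assumes \<Theta>: "\<Theta> \<subseteq> {1..CARD('n) - 1}" and x: "x \<in> flags \<Theta>"
  shows iwasawa_cartan_sub: "iwasawa ip \<Theta> g x \<in> cartan_sub CARD('n) \<Theta>"
    and weight_iwasawa: "\<And>p v. p \<in> \<Theta> \<Longrightarrow> is_basis p v (x p) \<Longrightarrow>
      weight p (iwasawa ip \<Theta> g x) = ln (wedge_norm ip p (\<lambda>i. rep g *v v i) / wedge_norm ip p v)"
proof -
  let ?r = "\<lambda>p v. ln (wedge_norm ip p (\<lambda>i. rep g *v v i) / wedge_norm ip p v)"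
  let ?P = "\<lambda>b. b \<in> cartan_sub CARD('n) \<Theta> \<and> (\<forall>p\<in>\<Theta>. \<forall>v. is_basis p v (x p) \<longrightarrow> weight p b = ?r p v)"
  obtain B where B: "\<And>p. p \<in> \<Theta> \<Longrightarrow> is_basis p (B p) (x p)" using flag_basis[OF x] by metis
  have eq: "?r p v = ?r p (B p)" if p: "p \<in> \<Theta>" and v: "is_basis p v (x p)" for p v
  proof -
    obtain c where "0 < \<bar>ldet p c\<bar>" "wedge_norm ip p v = \<bar>ldet p c\<bar> * wedge_norm ip p (B p)"
      "wedge_norm ip p (\<lambda>i. rep g *v v i) = \<bar>ldet p c\<bar> * wedge_norm ip p (\<lambda>i. rep g *v B p i)"
      using basis_change[OF B[OF p] v] by metis
    then show ?thesis by simp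
  qed
  have "\<exists>!b. ?P b"
  proof (rule ex_ex1I)
    obtain b where b: "b \<in> cartan_sub CARD('n) \<Theta>" "\<forall>p\<in>\<Theta>. weight p b = ?r p (B p)"
      using cartan_sub_interpolation[OF \<Theta>, of "\<lambda>p. ?r p (B p)"] by blast
    then show "\<exists>b. ?P b" using eq by (intro exI[of _ b]) auto
    fix b b' assume P: "?P b" "?P b'"
    then have "weight p b = weight p b'" if "p \<in> \<Theta>" for p
      using B[OF that] that by metis
    then show "b = b'" using P by (intro cartan_sub_unique[OF \<Theta>]) auto
  qed
  from theI'[OF this] have P: "?P (iwasawa ip \<Theta> g x)" unfolding iwasawa_def by simp
  show "iwasawa ip \<Theta> g x \<in> cartan_sub CARD('n) \<Theta>" using P by blast
  show "weight p (iwasawa ip \<Theta> g x) = ?r p v" if "p \<in> \<Theta>" "is_basis p v (x p)" for p v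
    using P that by blast
qed

text \<open>For an orthonormal basis \<open>u\<close>, the determinant divided by
  \<open>wedge_norm ip p v\<close> is the coordinate of the unit p-vector of \<open>x p\<close>
  along the first \<open>p\<close> vectors. It is nonzero exactly when \<open>x p\<close> is
  transverse to the span of the other vectors; \<alpha> makes this quantitative, and \<alpha> = 0 is
  plain transversality. The strict inequality makes the set open.\<close>

definition basin :: "nat set \<Rightarrow> real \<Rightarrow> (nat \<Rightarrow> real^'n) \<Rightarrow> (nat \<Rightarrow> (real^'n) set) set" where
  "basin \<Theta> \<alpha> u = {x \<in> flags \<Theta>. \<forall>p\<in>\<Theta>. \<forall>v. is_basis p v (x p) \<longrightarrow>
     \<alpha> * wedge_norm ip p v < \<bar>ldet p (\<lambda>i j. ip (v i) (u j))\<bar>}"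

lemma basin_condition_basis:
  assumes "is_basis p v V" "is_basis p w V"
    and "\<alpha> * wedge_norm ip p v < \<bar>ldet p (\<lambda>i j. ip (v i) (u j))\<bar>"
  shows "\<alpha> * wedge_norm ip p w < \<bar>ldet p (\<lambda>i j. ip (w i) (u j))\<bar>"
proof -
  obtain c where c: "0 < \<bar>ldet p c\<bar>" "wedge_norm ip p w = \<bar>ldet p c\<bar> * wedge_norm ip p v"
    "ldet p (\<lambda>i j. ip (w i) (u j)) = ldet p c * ldet p (\<lambda>i j. ip (v i) (u j))"
    using basis_change[OF assms(1,2)] by metis
  have "\<bar>ldet p c\<bar> * (\<alpha> * wedge_norm ip p v) < \<bar>ldet p c\<bar> * \<bar>ldet p (\<lambda>i j. ip (v i) (u j))\<bar>"
    using assms(3) c(1) by (rule mult_strict_left_mono)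
  then show ?thesis by (simp add: c(2,3) abs_mult mult_ac)
qed

lemma continuous_coordinate_ip:
  "continuous_on UNIV (\<lambda>v :: nat \<Rightarrow> real^'n. ip (v i) (v j))"
  "continuous_on UNIV (\<lambda>v :: nat \<Rightarrow> real^'n. ip (v i) w)"
  "continuous_on UNIV (\<lambda>v :: nat \<Rightarrow> real^'n. ip (A *v v i) (A *v v j))"
proof -
  have c: "continuous_on UNIV (\<lambda>v :: nat \<Rightarrow> real^'n. v i)" for i by (rule continuous_on_product_coordinates)
  have m: "continuous_on UNIV (\<lambda>v :: nat \<Rightarrow> real^'n. A *v v i)" for i
    by (rule matrix_vector_mult_linear_continuous_on[THEN continuous_on_compose2, OF c]) auto
  show "continuous_on UNIV (\<lambda>v :: nat \<Rightarrow> real^'n. ip (v i) (v j))"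
    "continuous_on UNIV (\<lambda>v :: nat \<Rightarrow> real^'n. ip (v i) w)"
    "continuous_on UNIV (\<lambda>v :: nat \<Rightarrow> real^'n. ip (A *v v i) (A *v v j))"
    by (intro continuous_on_ip c m continuous_on_const)+
qed

lemma continuous_wedge_norm:
  "continuous_on UNIV (\<lambda>v :: nat \<Rightarrow> real^'n. wedge_norm ip p v)"
  "continuous_on UNIV (\<lambda>v :: nat \<Rightarrow> real^'n. wedge_norm ip p (\<lambda>i. A *v v i))"
  unfolding wedge_norm_def by (intro continuous_intros continuous_coordinate_ip)+

lemma openin_basin:
  assumes \<Theta>: "\<Theta> \<subseteq> {1..CARD('n) - 1}"
  shows "openin (flag_topology \<Theta>) (basin \<Theta> \<alpha> u)"
proof (rule openin_flag_topologyI)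
  let ?S = "\<Inter>p\<in>\<Theta>. {v. \<alpha> * wedge_norm ip p v < \<bar>ldet p (\<lambda>i j. ip (v i) (u j))\<bar>}"
  have fin: "finite \<Theta>" using \<Theta> finite_subset by blast
  have "continuous_on UNIV (\<lambda>v. ldet p (\<lambda>i j. ip (v i) (u j)))" for p
    unfolding ldet_def by (intro continuous_intros continuous_coordinate_ip)
  then show "open ?S"
    by (intro open_INT[OF fin] ballI open_Collect_less continuous_intros continuous_wedge_norm)
  show "basin \<Theta> \<alpha> u \<subseteq> flags \<Theta>" by (auto simp: basin_def)
  fix v :: "nat \<Rightarrow> real^'n" assume v: "is_basis CARD('n) v UNIV"
  have "\<Theta> \<subseteq> {1..CARD('n)}" using index_le_card[OF \<Theta>] by (auto simp: less_imp_le)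
  then have x: "frame_flag \<Theta> v \<in> flags \<Theta>" using v by (rule frame_flag_in_flags)
  show "frame_flag \<Theta> v \<in> basin \<Theta> \<alpha> u \<longleftrightarrow> v \<in> ?S"
    using x frame_flag_basis[OF \<Theta> _ v] basin_condition_basis[OF frame_flag_basis[OF \<Theta> _ v]]
    unfolding basin_def by blast
qed

text \<open>The cocycle measures how much \<open>g\<close> stretches the p-vector of
  \<open>x p\<close>. The stretch is at most the product of the \<open>p\<close> largest singular
  values and, in the basin, at least \<alpha> times that product.\<close>

lemma weight_iwasawa_basin:
  assumes \<Theta>: "\<Theta> \<subseteq> {1..CARD('n) - 1}" and g: "g \<in> carrier PGL" and \<alpha>: "0 < \<alpha>"
    and x: "x \<in> basin \<Theta> \<alpha> (fr g)" and p: "p \<in> \<Theta>"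
  shows "\<bar>weight p (iwasawa ip \<Theta> g x) - weight p (cp g)\<bar> \<le> \<bar>ln \<alpha>\<bar>"
proof -
  have xf: "x \<in> flags \<Theta>" using x by (simp add: basin_def)
  have pd: "p \<le> CARD('n)" using index_le_card[OF \<Theta> p] by simp
  obtain v where v: "is_basis p v (x p)" using flag_basis[OF xf p] by blast
  let ?P = "\<Prod>i=1..p. sg g i" and ?w = "wedge_norm ip p v" and ?wg = "wedge_norm ip p (\<lambda>i. rep g *v v i)"
  have P: "0 < ?P" by (rule prod_sg_pos[OF g pd])
  have w: "0 < ?w" by (rule basis_wedge_pos[OF v])
  have "?wg \<le> sqrt (?P\<^sup>2 * gram p v)"
    unfolding wedge_norm_gram by (intro real_sqrt_le_mono gram_image_le[OF frame_rep pd])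
  also have "\<dots> = ?P * ?w" using P by (simp add: real_sqrt_mult wedge_norm_gram)
  finally have up: "?wg / ?w \<le> ?P" using w by (simp add: pos_divide_le_eq)
  have "?P * (\<alpha> * ?w) \<le> ?P * \<bar>ldet p (\<lambda>i j. ip (v i) (fr g j))\<bar>"
    using x p v P by (intro mult_left_mono) (auto simp: basin_def intro: less_imp_le)
  also have "\<dots> = sqrt (?P\<^sup>2 * (ldet p (\<lambda>i j. ip (v i) (fr g j)))\<^sup>2)"
    using P by (simp add: real_sqrt_mult)
  also have "\<dots> \<le> ?wg"
    unfolding wedge_norm_gram by (intro real_sqrt_le_mono gram_image_ge[OF frame_rep pd])
  finally have lo: "?P * \<alpha> \<le> ?wg / ?w" using w by (simp add: pos_le_divide_eq mult_ac)
  have r: "0 < ?wg / ?w" using lo P \<alpha> by (meson less_le_trans mult_pos_pos)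
  have "ln (?wg / ?w) \<le> ln ?P" using up r by (rule ln_mono)
  moreover have "ln (?P * \<alpha>) \<le> ln (?wg / ?w)" using lo P \<alpha> by (intro ln_mono) auto
  then have "ln ?P + ln \<alpha> \<le> ln (?wg / ?w)" using P \<alpha> by (simp add: ln_mult_pos)
  ultimately show ?thesis
    unfolding weight_iwasawa[OF \<Theta> xf p v] weight_cp[OF g pd] by linarith
qed

text \<open>A vanishing determinant yields a nonzero vector of \<open>V\<close> that is orthogonal
  to the first \<open>p\<close> vectors of \<open>u\<close> and so lies in the span of the
  others.\<close>

lemma transverse_ldet_nonzero:
  assumes u: "orthonormal CARD('n) u" and p: "p \<le> CARD('n)"
    and v: "is_basis p v V" and tr: "V \<inter> span (u ` {p<..CARD('n)}) = {0}"
  shows "ldet p (\<lambda>i j. ip (v i) (u j)) \<noteq> 0"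
proof
  assume "ldet p (\<lambda>i j. ip (v i) (u j)) = 0"
  then have "ldet p (\<lambda>i j. ip (v j) (u i)) = 0"
    using ldet_transpose[of p "\<lambda>i j. ip (v i) (u j)"] by simp
  then obtain c i where c: "i \<in> {1..p}" "c i \<noteq> 0" "\<And>i. i \<in> {1..p} \<Longrightarrow> (\<Sum>j=1..p. ip (v j) (u i) * c j) = 0"
    using ldet_eq_0[of p "\<lambda>i j. ip (v j) (u i)"] by blast
  define w where "w = (\<Sum>j=1..p. c j *\<^sub>R v j)"
  have inj: "inj_on v {1..p}" and ind: "independent (v ` {1..p})" using v by (auto simp: is_basis_def)
  have "w \<in> span (v ` {1..p})" unfolding w_def by (intro span_sum span_scale span_base) auto
  then have wV: "w \<in> V" using v by (simp add: is_basis_def)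
  have z: "ip w (u i) = 0" if "i \<in> {1..p}" for i
    using c(3)[OF that] by (simp add: w_def ip_sum_left mult.commute)
  have "w = (\<Sum>i\<in>{p<..CARD('n)}. ip w (u i) *\<^sub>R u i)"
    by (subst orthonormal_expansion[OF u, of w, symmetric], rule sum.mono_neutral_right) (use z in auto)
  also have "\<dots> \<in> span (u ` {p<..CARD('n)})" by (intro span_sum span_scale span_base) auto
  finally have "w = 0" using wV tr by blast
  then have z0: "(\<Sum>x\<in>v ` {1..p}. c (inv_into {1..p} v x) *\<^sub>R x) = 0"
    unfolding w_def by (simp add: sum.reindex[OF inj] inv_into_f_f[OF inj])
  have "c (inv_into {1..p} v (v i)) \<noteq> 0" using c(1,2) inv_into_f_f[OF inj c(1)] by simp
  then have "\<exists>u. (\<exists>x\<in>v ` {1..p}. u x \<noteq> 0) \<and> (\<Sum>x\<in>v ` {1..p}. u x *\<^sub>R x) = 0"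
    using z0 c(1) by (intro exI[of _ "\<lambda>x. c (inv_into {1..p} v x)"] conjI bexI[of _ "v i"]) auto
  then have "dependent (v ` {1..p})" using dependent_finite[of "v ` {1..p}"] by simp
  then show False using ind by blast
qed

end

section \<open>The measure of shadows\<close>

lemma eventually_less_of_tendsto:
  fixes f g :: "'a \<Rightarrow> real"
  assumes "a < b" "(f \<longlongrightarrow> a) F" "(g \<longlongrightarrow> b) F"
  shows "\<forall>\<^sub>F x in F. f x < g x"
proof -
  have "((\<lambda>x. g x - f x) \<longlongrightarrow> b - a) F" using assms by (intro tendsto_diff)
  then have "\<forall>\<^sub>F x in F. 0 < g x - f x" using assms(1) by (intro order_tendstoD(1)) auto
  then show ?thesis by (rule eventually_mono) simp
qed

lemma radon_space:
  assumes "\<Theta> \<subseteq> {1..CARD('n) - 1}" "finite_radon_measure (flag_topology \<Theta>) \<mu>"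
  shows "space \<mu> = (flags \<Theta> :: (nat \<Rightarrow> (real^'n) set) set)"
    and "topspace (flag_topology \<Theta>) = (flags \<Theta> :: (nat \<Rightarrow> (real^'n) set) set)"
    and "openin (flag_topology \<Theta>) U \<Longrightarrow> U \<in> sets (\<mu> :: (nat \<Rightarrow> (real^'n) set) measure)"
proof -
  have "\<Theta> \<subseteq> {1..CARD('n)}" using index_le_card[OF assms(1)] by (auto simp: less_imp_le)
  then show top: "topspace (flag_topology \<Theta>) = (flags \<Theta> :: (nat \<Rightarrow> (real^'n) set) set)"
    by (rule topspace_flag_topology)
  show "space \<mu> = flags \<Theta>" using assms(2) by (simp add: finite_radon_measure_def top)
  show "openin (flag_topology \<Theta>) U \<Longrightarrow> U \<in> sets \<mu>"
    using assms(2) by (auto simp: finite_radon_measure_def)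
qed

context scalar_product
begin

lemma ldet_tendsto:
  assumes "\<And>i. i \<in> {1..p} \<Longrightarrow> (\<lambda>n. u n i) \<longlonglongrightarrow> l i"
  shows "(\<lambda>n. ldet p (\<lambda>i j. ip (v i) (u n j))) \<longlonglongrightarrow> ldet p (\<lambda>i j. ip (v i) (l j))"
  unfolding ldet_def
proof (intro tendsto_sum tendsto_mult tendsto_const tendsto_prod tendsto_ip)
  fix \<pi> i assume "\<pi> \<in> {\<pi>. \<pi> permutes {1..p}}" "i \<in> {1..p}"
  then have "\<pi> i \<in> {1..p}" using permutes_in_image[of \<pi> "{1..p}" i] by simp
  then show "(\<lambda>n. u n (\<pi> i)) \<longlonglongrightarrow> l (\<pi> i)" by (rule assms)
qed

text \<open>The vectors of the frames are bounded, so the matrices with these rows have a convergent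
  subsequence, and orthonormality is a closed condition.\<close>

lemma orthonormal_compact:
  assumes u: "\<And>n. orthonormal CARD('n) (u n)"
  shows "\<exists>l r. orthonormal CARD('n) l \<and> strict_mono (r :: nat \<Rightarrow> nat) \<and>
    (\<forall>i\<in>{1..CARD('n)}. (\<lambda>n. u (r n) i) \<longlonglongrightarrow> l i)"
proof -
  have "card (UNIV :: 'n set) = card {1..CARD('n)}" by simp
  then obtain e where e: "bij_betw e (UNIV :: 'n set) {1..CARD('n)}"
    using finite_same_card_bij finite_class.finite_UNIV finite_atLeastAtMost by blast
  define U :: "nat \<Rightarrow> real^'n^'n" where "U n = (\<chi> i. u n (e i))" for n
  obtain c where c: "0 < c" "\<And>v. norm v \<le> c * nrm v" using norm_le_nrm by blast
  have "norm (U n) \<le> CARD('n) * c" for n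
  proof -
    have "norm (U n) \<le> (\<Sum>i\<in>UNIV. norm (U n $ i))" unfolding norm_vec_def by (rule L2_set_le_sum) simp
    also have "\<dots> \<le> (\<Sum>i\<in>(UNIV :: 'n set). c)"
    proof (rule sum_mono)
      fix i :: 'n
      have "e i \<in> {1..CARD('n)}" using e by (auto simp: bij_betw_def)
      then have "ip (u n (e i)) (u n (e i)) = 1" using u[of n] unfolding orthonormal_def by metis
      then have "nrm (u n (e i)) = 1" by (simp add: nrm_def)
      then show "norm (U n $ i) \<le> c" using c(2)[of "u n (e i)"] by (simp add: U_def)
    qed
    finally show ?thesis by simp
  qed
  then have "bounded (range U)" unfolding bounded_iff by blast
  then obtain L r where r: "strict_mono (r :: nat \<Rightarrow> nat)" and L: "(U \<circ> r) \<longlonglongrightarrow> L"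
    using bounded_imp_convergent_subsequence by blast
  define l where "l i = L $ (inv_into UNIV e i)" for i
  have lim: "(\<lambda>n. u (r n) i) \<longlonglongrightarrow> l i" if i: "i \<in> {1..CARD('n)}" for i
  proof -
    have "e (inv_into UNIV e i) = i" using e i by (metis bij_betw_imp_surj_on f_inv_into_f)
    then have "(\<lambda>n. (U \<circ> r) n $ (inv_into UNIV e i)) = (\<lambda>n. u (r n) i)" by (simp add: U_def)
    then show ?thesis using tendsto_vec_nth[OF L, of "inv_into UNIV e i"] by (simp add: l_def)
  qed
  have "orthonormal CARD('n) l" unfolding orthonormal_def
  proof (intro ballI)
    fix i j assume ij: "i \<in> {1..CARD('n)}" "j \<in> {1..CARD('n)}"
    have "(\<lambda>n. ip (u (r n) i) (u (r n) j)) \<longlonglongrightarrow> ip (l i) (l j)"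
      by (intro tendsto_ip lim ij)
    moreover have "(\<lambda>n. ip (u (r n) i) (u (r n) j)) = (\<lambda>n. if i = j then 1 else 0)"
      using u ij unfolding orthonormal_def by metis
    ultimately show "ip (l i) (l j) = (if i = j then 1 else 0)"
      using LIMSEQ_unique tendsto_const by metis
  qed
  then show ?thesis using r lim by blast
qed

lemma complementary_flag:
  assumes \<Theta>: "\<Theta> \<subseteq> {1..CARD('n) - 1}" and l: "orthonormal CARD('n) l"
  shows "(\<lambda>q\<in>opp CARD('n) \<Theta>. span (l ` {CARD('n) - q<..CARD('n)})) \<in> flags (opp CARD('n) \<Theta>)"
  unfolding flags_def
proof (intro CollectI conjI ballI impI)
  let ?y = "\<lambda>q\<in>opp CARD('n) \<Theta>. span (l ` {CARD('n) - q<..CARD('n)})"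
  show "?y \<in> extensional (opp CARD('n) \<Theta>)" by simp
  fix q assume q: "q \<in> opp CARD('n) \<Theta>"
  then have qd: "q \<le> CARD('n)" by (auto simp: opp_def)
  show "subspace (?y q)" using q by simp
  have sub: "{CARD('n) - q<..CARD('n)} \<subseteq> {1..CARD('n)}" by auto
  have "dim (l ` {CARD('n) - q<..CARD('n)}) = card (l ` {CARD('n) - q<..CARD('n)})"
    by (rule dim_eq_card_independent[OF orthonormal_independent[OF l sub]])
  also have "\<dots> = q" using inj_on_subset[OF orthonormal_inj[OF l] sub] qd by (simp add: card_image)
  finally show "dim (?y q) = q" using q by simp
  fix q' assume q': "q' \<in> opp CARD('n) \<Theta>" "q \<le> q'"
  have "span (l ` {CARD('n) - q<..CARD('n)}) \<subseteq> span (l ` {CARD('n) - q'<..CARD('n)})"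
    by (intro span_mono image_mono) (use q' in auto)
  then show "?y q \<subseteq> ?y q'" using q q' by simp
qed

text \<open>
  Otherwise a sequence of frames with basins of measure tending to zero subconverges, and the flags
  transverse to the limiting complementary flag, which lie in all but finitely many of the basins,
  form an open null set.
\<close>

lemma basin_measure_lower_bound:
  fixes \<mu> :: "(nat \<Rightarrow> (real^'n) set) measure"
  assumes \<Theta>: "\<Theta> \<subseteq> {1..CARD('n) - 1}" and rad: "finite_radon_measure (flag_topology \<Theta>) \<mu>"
    and supp: "\<not> (\<exists>C. complementary_subspace \<Theta> C \<and> measure_support (flag_topology \<Theta>) \<mu> \<subseteq> C)"
  shows "\<exists>\<alpha>>0. \<exists>\<kappa>>0. \<forall>u. orthonormal CARD('n) u \<longrightarrow> \<kappa> \<le> measure \<mu> (basin \<Theta> \<alpha> u)"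
proof (rule ccontr)
  interpret finite_measure \<mu> using rad by (simp add: finite_radon_measure_def)
  note space = radon_space(1)[OF \<Theta> rad] and opens = radon_space(3)[OF \<Theta> rad]
  assume neg: "\<not> ?thesis"
  \<comment> \<open>The degree of transversality and the bound on the measure tend to zero along the
    same sequence.\<close>
  have "\<exists>u. orthonormal CARD('n) u \<and> measure \<mu> (basin \<Theta> (1 / (real n + 1)) u) < 1 / (real n + 1)" for n :: nat
  proof -
    have p: "0 < 1 / (real n + 1)" by simp
    have "\<not> (\<forall>u. orthonormal CARD('n) u \<longrightarrow> 1 / (real n + 1) \<le> measure \<mu> (basin \<Theta> (1 / (real n + 1)) u))"
      using neg p by blast
    then show ?thesis by (simp add: not_le)
  qed
  then obtain u where u: "\<And>n. orthonormal CARD('n) (u n)"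
    and small: "\<And>n. measure \<mu> (basin \<Theta> (1 / (real n + 1)) (u n)) < 1 / (real n + 1)" by metis
  have "\<exists>l r. orthonormal CARD('n) l \<and> strict_mono (r :: nat \<Rightarrow> nat) \<and>
    (\<forall>i\<in>{1..CARD('n)}. (\<lambda>n. u (r n) i) \<longlonglongrightarrow> l i)"
    by (rule orthonormal_compact) (rule u)
  then obtain l r where lr: "orthonormal CARD('n) l \<and> strict_mono (r :: nat \<Rightarrow> nat) \<and>
    (\<forall>i\<in>{1..CARD('n)}. (\<lambda>n. u (r n) i) \<longlonglongrightarrow> l i)" by (elim exE)
  have l: "orthonormal CARD('n) l" and r: "strict_mono r"
    and lim: "\<And>i. i \<in> {1..CARD('n)} \<Longrightarrow> (\<lambda>n. u (r n) i) \<longlonglongrightarrow> l i"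
    using lr by blast+
  define B where "B n = basin \<Theta> (1 / (real (r n) + 1)) (u (r n))" for n
  have Bs: "B n \<in> sets \<mu>" for n unfolding B_def by (intro opens openin_basin \<Theta>)
  \<comment> \<open>An intersection over a tail lies in basins of arbitrarily small measure, so it
    is a null set.\<close>
  define D where "D N = (\<Inter>n\<in>{N..}. B n)" for N
  have Ds: "D N \<in> sets \<mu>" for N unfolding D_def using Bs by (intro sets.countable_INT') auto
  have D0: "emeasure \<mu> (D N) = 0" for N
  proof -
    have "measure \<mu> (D N) \<le> e" if e: "0 < e" for e
    proof -
      obtain k :: nat where k: "1 / e < real k" using reals_Archimedean2 by blast
      have "0 < 1 / e" using e by simp
      then have kpos: "0 < real k" using k by linarith
      define n where "n = max k N"
      have "measure \<mu> (D N) \<le> measure \<mu> (B n)"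
        by (rule finite_measure_mono[OF _ Bs]) (auto simp: D_def n_def)
      also have "\<dots> < 1 / (real (r n) + 1)" unfolding B_def by (rule small)
      also have "\<dots> \<le> 1 / real k"
      proof -
        have "k \<le> r n" using seq_suble[OF r, of n] by (simp add: n_def)
        then show ?thesis using kpos by (intro divide_left_mono) auto
      qed
      also have "\<dots> \<le> e" using k e kpos by (simp add: pos_divide_less_eq pos_divide_le_eq mult.commute)
      finally show ?thesis by simp
    qed
    then have "measure \<mu> (D N) \<le> 0" by (rule field_le_epsilon) simp
    then show ?thesis using emeasure_eq_measure[of "D N"] measure_nonneg[of \<mu> "D N"] by simp
  qed
  \<comment> \<open>For a fixed flag transverse to the limit the determinants converge to nonzero
    values, while the lower bounds required of them tend to 0. As \<Theta> is finite, one
    \<open>N\<close> serves for all \<open>p\<close>.\<close>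
  have TD: "basin \<Theta> 0 l \<subseteq> (\<Union>N. D N)"
  proof
    fix x assume x: "x \<in> basin \<Theta> 0 l"
    then have xf: "x \<in> flags \<Theta>" by (simp add: basin_def)
    have fin: "finite \<Theta>" using \<Theta> finite_subset by blast
    have "\<forall>\<^sub>F n in sequentially. \<forall>p\<in>\<Theta>. \<forall>v. is_basis p v (x p) \<longrightarrow>
        1 / (real (r n) + 1) * wedge_norm ip p v < \<bar>ldet p (\<lambda>i j. ip (v i) (u (r n) j))\<bar>"
    proof (rule eventually_ball_finite[OF fin], rule ballI)
      fix p assume p: "p \<in> \<Theta>"
      have pd: "{1..p} \<subseteq> {1..CARD('n)}" using index_le_card[OF \<Theta> p] by auto
      obtain v where v: "is_basis p v (x p)" using flag_basis[OF xf p] by blast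
      have "(\<lambda>n. 1 / (real n + 1)) \<longlonglongrightarrow> 0"
        using LIMSEQ_inverse_real_of_nat by (simp add: inverse_eq_divide add.commute)
      then have "(\<lambda>n. 1 / (real (r n) + 1)) \<longlonglongrightarrow> 0"
        using LIMSEQ_subseq_LIMSEQ[OF _ r] by (fastforce simp: o_def)
      then have z: "(\<lambda>n. 1 / (real (r n) + 1) * wedge_norm ip p v) \<longlonglongrightarrow> 0 * wedge_norm ip p v"
        by (intro tendsto_mult tendsto_const)
      have t: "(\<lambda>n. \<bar>ldet p (\<lambda>i j. ip (v i) (u (r n) j))\<bar>) \<longlonglongrightarrow> \<bar>ldet p (\<lambda>i j. ip (v i) (l j))\<bar>"
        using pd by (intro tendsto_rabs ldet_tendsto lim) auto
      have "0 * wedge_norm ip p v < \<bar>ldet p (\<lambda>i j. ip (v i) (l j))\<bar>"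
        using x p v by (auto simp: basin_def)
      then have "\<forall>\<^sub>F n in sequentially. 1 / (real (r n) + 1) * wedge_norm ip p v
          < \<bar>ldet p (\<lambda>i j. ip (v i) (u (r n) j))\<bar>"
        using z t by (rule eventually_less_of_tendsto)
      then show "\<forall>\<^sub>F n in sequentially. \<forall>v. is_basis p v (x p) \<longrightarrow>
          1 / (real (r n) + 1) * wedge_norm ip p v < \<bar>ldet p (\<lambda>i j. ip (v i) (u (r n) j))\<bar>"
        by (rule eventually_mono) (use basin_condition_basis[OF v] in blast)
    qed
    then obtain N where "\<And>n. N \<le> n \<Longrightarrow> x \<in> B n"
      unfolding eventually_sequentially B_def basin_def using xf by blast
    then show "x \<in> (\<Union>N. D N)" by (auto simp: D_def)
  qed
  have "emeasure \<mu> (\<Union>N. D N) = 0"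
    using D0 Ds by (intro emeasure_UN_eq_0) auto
  then have T0: "emeasure \<mu> (basin \<Theta> 0 l) = 0"
    using emeasure_mono[OF TD, of \<mu>] Ds by auto
  define y0 where "y0 = (\<lambda>q\<in>opp CARD('n) \<Theta>. span (l ` {CARD('n) - q<..CARD('n)}))"
  define C where "C = {x \<in> flags \<Theta>. \<not> transverse \<Theta> x y0}"
  have "complementary_subspace \<Theta> C"
    unfolding complementary_subspace_def C_def using complementary_flag[OF \<Theta> l] by (auto simp: y0_def)
  then obtain x where x: "x \<in> measure_support (flag_topology \<Theta>) \<mu>" "x \<notin> C" using supp by blast
  have "x \<in> topspace (flag_topology \<Theta>)" using x by (simp add: measure_support_def)
  then have xf: "x \<in> flags \<Theta>" using radon_space(2)[OF \<Theta> rad] by simp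
  then have tr: "transverse \<Theta> x y0" using x by (simp add: C_def)
  have "x \<in> basin \<Theta> 0 l"
    unfolding basin_def
  proof (intro CollectI conjI ballI allI impI xf)
    fix p v assume p: "p \<in> \<Theta>" and v: "is_basis p v (x p)"
    have pd: "p < CARD('n)" using index_le_card[OF \<Theta> p] by simp
    have "CARD('n) - p \<in> opp CARD('n) \<Theta>" using p by (auto simp: opp_def)
    then have "y0 (CARD('n) - p) = span (l ` {p<..CARD('n)})" using pd by (simp add: y0_def)
    moreover have "x p \<inter> y0 (CARD('n) - p) = {0}" using tr p by (simp add: transverse_def)
    ultimately have "x p \<inter> span (l ` {p<..CARD('n)}) = {0}" by simp
    then have "ldet p (\<lambda>i j. ip (v i) (l j)) \<noteq> 0"
      using transverse_ldet_nonzero[OF l _ v] pd by simp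
    then show "0 * wedge_norm ip p v < \<bar>ldet p (\<lambda>i j. ip (v i) (l j))\<bar>" by simp
  qed
  \<comment> \<open>Every open set around a point of the support has positive measure, and
    \<open>basin \<Theta> 0 l\<close> is one.\<close>
  then have "0 < emeasure \<mu> (basin \<Theta> 0 l)"
    using x(1) openin_basin[OF \<Theta>] by (simp add: measure_support_def)
  then show False using T0 by simp
qed

text \<open>In terms of a basis the density is a continuous function on the open set of bases, so
  its preimages of open sets are open in the flag space.\<close>

lemma iwasawa_density_measurable:
  fixes \<mu> :: "(nat \<Rightarrow> (real^'n) set) measure"
  assumes \<Theta>: "\<Theta> \<subseteq> {1..CARD('n) - 1}" and rad: "finite_radon_measure (flag_topology \<Theta>) \<mu>"
    and c: "\<And>a. a \<in> cartan CARD('n) \<Longrightarrow> \<phi> a = (\<Sum>p\<in>\<Theta>. c p * weight p a)"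
    and g: "g \<in> carrier PGL"
  shows "(\<lambda>x. exp (- \<phi> (iwasawa ip \<Theta> g x))) \<in> borel_measurable \<mu>"
proof (rule borel_measurableI)
  fix S :: "real set" assume S: "open S"
  let ?f = "\<lambda>x. exp (- \<phi> (iwasawa ip \<Theta> g x))"
  let ?F = "\<lambda>v. exp (- (\<Sum>p\<in>\<Theta>. c p * ln (wedge_norm ip p (\<lambda>i. rep g *v v i) / wedge_norm ip p v)))"
  let ?bases = "{v :: nat \<Rightarrow> real^'n. is_basis CARD('n) v UNIV}"
  have fF: "?f (frame_flag \<Theta> v) = ?F v" if v: "is_basis CARD('n) v UNIV" for v
  proof -
    have "\<Theta> \<subseteq> {1..CARD('n)}" using index_le_card[OF \<Theta>] by (auto simp: less_imp_le)
    then have x: "frame_flag \<Theta> v \<in> flags \<Theta>" using v by (rule frame_flag_in_flags)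
    have "iwasawa ip \<Theta> g (frame_flag \<Theta> v) \<in> cartan CARD('n)"
      using iwasawa_cartan_sub[OF \<Theta> x] by (simp add: cartan_sub_def)
    then have "\<phi> (iwasawa ip \<Theta> g (frame_flag \<Theta> v)) = (\<Sum>p\<in>\<Theta>. c p * weight p (iwasawa ip \<Theta> g (frame_flag \<Theta> v)))"
      by (rule c)
    also have "\<dots> = (\<Sum>p\<in>\<Theta>. c p * ln (wedge_norm ip p (\<lambda>i. rep g *v v i) / wedge_norm ip p v))"
      using weight_iwasawa[OF \<Theta> x _ frame_flag_basis[OF \<Theta> _ v]] by (intro sum.cong refl) simp
    finally show ?thesis by simp
  qed
  have cont: "continuous_on ?bases ?F"
  proof (intro continuous_intros continuous_on_subset[OF continuous_wedge_norm(1)] continuous_on_subset[OF continuous_wedge_norm(2)])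
    fix p assume p: "p \<in> \<Theta>"
    have w: "0 < wedge_norm ip p v" "0 < wedge_norm ip p (\<lambda>i. rep g *v v i)" if "v \<in> ?bases" for v
    proof -
      have b: "is_basis p v (frame_flag \<Theta> v p)" using frame_flag_basis[OF \<Theta> p] that by simp
      show "0 < wedge_norm ip p v" by (rule basis_wedge_pos[OF b])
      show "0 < wedge_norm ip p (\<lambda>i. rep g *v v i)"
        by (rule basis_wedge_pos[OF is_basis_image[OF invertible_rep[OF g] b]])
    qed
    show "\<forall>v\<in>?bases. wedge_norm ip p v \<noteq> 0" using w(1) by fastforce
    show "\<forall>v\<in>?bases. wedge_norm ip p (\<lambda>i. rep g *v v i) / wedge_norm ip p v \<noteq> 0" using w by fastforce
  qed auto
  have op: "open (?bases \<inter> ?F -` S)" by (rule continuous_open_preimage[OF cont open_bases S])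
  have "openin (flag_topology \<Theta>) {x \<in> flags \<Theta>. ?f x \<in> S}"
  proof (rule openin_flag_topologyI[OF _ op])
    fix v :: "nat \<Rightarrow> real^'n" assume v: "is_basis CARD('n) v UNIV"
    have "\<Theta> \<subseteq> {1..CARD('n)}" using index_le_card[OF \<Theta>] by (auto simp: less_imp_le)
    then have "frame_flag \<Theta> v \<in> flags \<Theta>" using v by (rule frame_flag_in_flags)
    then show "frame_flag \<Theta> v \<in> {x \<in> flags \<Theta>. ?f x \<in> S} \<longleftrightarrow> v \<in> ?bases \<inter> ?F -` S"
      using v fF[OF v] by simp
  qed auto
  then have "{x \<in> flags \<Theta>. ?f x \<in> S} \<in> sets \<mu>" by (rule radon_space(3)[OF \<Theta> rad])
  moreover have "?f -` S \<inter> space \<mu> = {x \<in> flags \<Theta>. ?f x \<in> S}" using radon_space(1)[OF \<Theta> rad] by auto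
  ultimately show "?f -` S \<inter> space \<mu> \<in> sets \<mu>" by simp
qed

text \<open>The image of the basin under \<open>g\<close>, written as a preimage under the inverse
  so that openness is inherited.\<close>

definition shadow :: "nat set \<Rightarrow> real \<Rightarrow> (real^'n^'n) set \<Rightarrow> (nat \<Rightarrow> (real^'n) set) set" where
  "shadow \<Theta> \<alpha> g = {x \<in> flags \<Theta>. flag_action \<Theta> (inv\<^bsub>PGL\<^esub> g) x \<in> basin \<Theta> \<alpha> (fr g)}"

lemma openin_shadow:
  assumes "\<Theta> \<subseteq> {1..CARD('n) - 1}" "g \<in> carrier PGL"
  shows "openin (flag_topology \<Theta>) (shadow \<Theta> \<alpha> g)"
  unfolding shadow_def using assms by (intro openin_flag_action_vimage PGL_inv_closed openin_basin)

text \<open>The Patterson-Sullivan equation is used for the inverse of \<open>g\<close>: its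
  push-forward gives the basin the measure of the shadow, and its density involves the cocycle of
  \<open>g\<close> itself, which on the basin is the Cartan projection up to a bounded
  error.\<close>

lemma shadow_measure_ge:
  fixes \<mu> :: "(nat \<Rightarrow> (real^'n) set) measure"
  assumes \<Theta>: "\<Theta> \<subseteq> {1..CARD('n) - 1}" and PS: "patterson_sullivan ip \<Theta> \<Gamma> \<phi> \<mu>"
    and \<Gamma>: "subgroup \<Gamma> PGL" and g: "g \<in> \<Gamma>" and \<alpha>: "0 < \<alpha>"
    and c: "\<And>a. a \<in> cartan CARD('n) \<Longrightarrow> \<phi> a = (\<Sum>p\<in>\<Theta>. c p * weight p a)"
  shows "exp (- \<phi> (cp g) - (\<Sum>p\<in>\<Theta>. \<bar>c p\<bar> * \<bar>ln \<alpha>\<bar>)) * measure \<mu> (basin \<Theta> \<alpha> (fr g)) \<le> measure \<mu> (shadow \<Theta> \<alpha> g)"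
proof -
  have rad: "finite_radon_measure (flag_topology \<Theta>) \<mu>" using PS by (simp add: patterson_sullivan_def)
  interpret finite_measure \<mu> using rad by (simp add: finite_radon_measure_def)
  note space = radon_space(1)[OF \<Theta> rad] and opens = radon_space(3)[OF \<Theta> rad]
  interpret P: group "PGL :: (real^'n^'n) set monoid" by (rule group_PGL)
  have gc: "g \<in> carrier PGL" using \<Gamma> g by (rule subgroup.mem_carrier)
  let ?h = "inv\<^bsub>PGL\<^esub> g" and ?B = "basin \<Theta> \<alpha> (fr g)"
  let ?f = "\<lambda>x. exp (- \<phi> (iwasawa ip \<Theta> g x))"
  let ?k = "exp (- \<phi> (cp g) - (\<Sum>p\<in>\<Theta>. \<bar>c p\<bar> * \<bar>ln \<alpha>\<bar>))"
  have hc: "?h \<in> carrier PGL" "inv\<^bsub>PGL\<^esub> ?h = g" using gc by auto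
  have Bs: "?B \<in> sets \<mu>" by (intro opens openin_basin \<Theta>)
  have meas: "flag_action \<Theta> ?h \<in> measurable \<mu> \<mu>"
  proof (rule measurable_sigma_sets)
    show "sets \<mu> = sigma_sets (topspace (flag_topology \<Theta>)) {U. openin (flag_topology \<Theta>) U}"
      using rad by (simp add: finite_radon_measure_def)
    show "{U. openin (flag_topology \<Theta>) U} \<subseteq> Pow (topspace (flag_topology \<Theta>))"
      using openin_subset by blast
    note top = radon_space(2)[OF \<Theta> rad]
    show "flag_action \<Theta> ?h \<in> space \<mu> \<rightarrow> topspace (flag_topology \<Theta>)"
      using flag_action_in_flags[OF hc(1)] by (auto simp: space top)
    fix U :: "(nat \<Rightarrow> (real^'n) set) set" assume "U \<in> {U. openin (flag_topology \<Theta>) U}"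
    then have "openin (flag_topology \<Theta>) {x \<in> flags \<Theta>. flag_action \<Theta> ?h x \<in> U}"
      using openin_flag_action_vimage[OF \<Theta> hc(1)] by simp
    then have "{x \<in> flags \<Theta>. flag_action \<Theta> ?h x \<in> U} \<in> sets \<mu>" by (rule opens)
    moreover have "flag_action \<Theta> ?h -` U \<inter> space \<mu> = {x \<in> flags \<Theta>. flag_action \<Theta> ?h x \<in> U}"
      by (auto simp: space)
    ultimately show "flag_action \<Theta> ?h -` U \<inter> space \<mu> \<in> sets \<mu>" by simp
  qed
  have "?h \<in> \<Gamma>" using \<Gamma> g by (rule subgroup.m_inv_closed)
  then have eq: "distr \<mu> \<mu> (flag_action \<Theta> ?h) = density \<mu> (\<lambda>x. ennreal (?f x))"
    using PS hc(2) unfolding patterson_sullivan_def by metis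
  have sh: "flag_action \<Theta> ?h -` ?B \<inter> space \<mu> = shadow \<Theta> \<alpha> g" by (auto simp: shadow_def space)
  have fm: "(\<lambda>x. ennreal (?f x)) \<in> borel_measurable \<mu>"
    using iwasawa_density_measurable[OF \<Theta> rad c gc] by measurable
  have "ennreal ?k * emeasure \<mu> ?B = (\<integral>\<^sup>+x. ennreal ?k * indicator ?B x \<partial>\<mu>)"
    by (rule nn_integral_cmult_indicator[OF Bs, symmetric])
  also have "\<dots> \<le> (\<integral>\<^sup>+x. ennreal (?f x) * indicator ?B x \<partial>\<mu>)"
  proof (rule nn_integral_mono)
    fix x
    have "?k \<le> ?f x" if x: "x \<in> ?B"
    proof -
      have xf: "x \<in> flags \<Theta>" using x by (simp add: basin_def)
      have "iwasawa ip \<Theta> g x \<in> cartan CARD('n)"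
        using iwasawa_cartan_sub[OF \<Theta> xf] by (simp add: cartan_sub_def)
      then have "\<phi> (iwasawa ip \<Theta> g x) - \<phi> (cp g) = (\<Sum>p\<in>\<Theta>. c p * (weight p (iwasawa ip \<Theta> g x) - weight p (cp g)))"
        using c cp_cartan[OF gc] by (simp add: sum_subtractf right_diff_distrib)
      also have "\<dots> \<le> (\<Sum>p\<in>\<Theta>. \<bar>c p\<bar> * \<bar>ln \<alpha>\<bar>)"
      proof (rule sum_mono)
        fix p assume p: "p \<in> \<Theta>"
        have "c p * (weight p (iwasawa ip \<Theta> g x) - weight p (cp g))
            \<le> \<bar>c p\<bar> * \<bar>weight p (iwasawa ip \<Theta> g x) - weight p (cp g)\<bar>"
          by (metis abs_ge_self abs_mult)
        also have "\<dots> \<le> \<bar>c p\<bar> * \<bar>ln \<alpha>\<bar>"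
          by (intro mult_left_mono weight_iwasawa_basin[OF \<Theta> gc \<alpha> x p]) simp
        finally show "c p * (weight p (iwasawa ip \<Theta> g x) - weight p (cp g)) \<le> \<bar>c p\<bar> * \<bar>ln \<alpha>\<bar>" .
      qed
      finally show ?thesis by simp
    qed
    then show "ennreal ?k * indicator ?B x \<le> ennreal (?f x) * indicator ?B x"
      by (auto simp: indicator_def intro: ennreal_leI)
  qed
  also have "\<dots> = emeasure (density \<mu> (\<lambda>x. ennreal (?f x))) ?B"
    by (rule emeasure_density[OF fm Bs, symmetric])
  also have "\<dots> = emeasure (distr \<mu> \<mu> (flag_action \<Theta> ?h)) ?B" by (simp only: eq)
  also have "\<dots> = emeasure \<mu> (shadow \<Theta> \<alpha> g)"
    using emeasure_distr[OF meas Bs] by (simp only: sh)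
  finally show ?thesis
    by (simp add: emeasure_eq_measure ennreal_mult'[symmetric] measure_nonneg)
qed

end

section \<open>Overlapping shadows\<close>

text \<open>Split off the last step with \<open>prefix\<close> and induct on the length.\<close>

lemma (in hyperbolic_group) geodesic_path:
  assumes zero: "\<And>x. x \<in> \<Gamma> \<Longrightarrow> len x = 0 \<Longrightarrow> x = \<one>" and h: "h \<in> \<Gamma>"
  shows "\<exists>q. q 0 = \<one> \<and> q (len h) = h \<and> (\<forall>i\<le>len h. q i \<in> \<Gamma> \<and> len (q i) = i) \<and>
    (\<forall>i<len h. len (inv (q i) \<otimes> q (Suc i)) = 1)"
  using h
proof (induction "len h" arbitrary: h)
  case 0
  then have "h = \<one>" using zero by simp
  then show ?case using len_one by (intro exI[of _ "\<lambda>_. \<one>"]) auto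
next
  case (Suc n)
  obtain y where y: "y \<in> \<Gamma>" "len y = n" "len (inv y \<otimes> h) = 1"
    using prefix[of h n] Suc by (metis Suc_diff_le diff_self_eq_0 le_SucI order_refl One_nat_def)
  obtain q where q: "q 0 = \<one>" "q n = y" "\<And>i. i \<le> n \<Longrightarrow> q i \<in> \<Gamma> \<and> len (q i) = i"
    "\<And>i. i < n \<Longrightarrow> len (inv (q i) \<otimes> q (Suc i)) = 1"
    using Suc.hyps(1)[of y] y by auto
  show ?case
  proof (intro exI[of _ "\<lambda>i. if i \<le> n then q i else h"] conjI allI impI)
    show "(if len h \<le> n then q (len h) else h) = h" using Suc.hyps(2) by simp
    fix i assume i: "i < len h"
    show "len (inv (if i \<le> n then q i else h) \<otimes> (if Suc i \<le> n then q (Suc i) else h)) = 1"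
      using i Suc.hyps(2) q(2) q(4)[of i] y(3) by (cases "i = n") auto
  next
    fix i assume "i \<le> len h"
    then have "i \<le> n \<or> i = len h" using Suc.hyps(2) by linarith
    then show "(if i \<le> n then q i else h) \<in> \<Gamma>" "len (if i \<le> n then q i else h) = i"
      using q(3)[of i] Suc.hyps(2) Suc.prems by auto
  qed (use q in auto)
qed

text \<open>Splitting at \<open>l\<close> gives two geometric series, so the bound depends neither
  on \<open>n\<close> nor on \<open>l\<close>.\<close>

lemma sum_two_sided_geometric:
  fixes r :: real
  assumes r: "0 < r" "r < 1"
  shows "(\<Sum>i<n. r powr \<bar>real i - real l\<bar>) \<le> 2 / (1 - r)"
proof -
  have geo: "(\<Sum>i<k. r ^ i) \<le> 1 / (1 - r)" for k
    using r by (simp add: sum_gp_strict divide_right_mono)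
  have "(\<Sum>i<n. r powr \<bar>real i - real l\<bar>) \<le> (\<Sum>i\<in>{..<l} \<union> {l..<l + n}. r powr \<bar>real i - real l\<bar>)"
    by (rule sum_mono2) auto
  also have "\<dots> = (\<Sum>i<l. r powr \<bar>real i - real l\<bar>) + (\<Sum>i\<in>{l..<l + n}. r powr \<bar>real i - real l\<bar>)"
    by (rule sum.union_disjoint) auto
  also have "(\<Sum>i<l. r powr \<bar>real i - real l\<bar>) = (\<Sum>i<l. r * r ^ (l - Suc i))"
  proof (intro sum.cong refl)
    fix i assume "i \<in> {..<l}"
    then have "\<bar>real i - real l\<bar> = real (Suc (l - Suc i))" by auto
    then show "r powr \<bar>real i - real l\<bar> = r * r ^ (l - Suc i)" using r powr_realpow[of r "Suc (l - Suc i)"] by simp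
  qed
  also have "\<dots> = r * (\<Sum>i<l. r ^ i)"
    unfolding sum_distrib_left[symmetric] by (simp only: sum.nat_diff_reindex[of "\<lambda>i. r ^ i"])
  also have "\<dots> \<le> 1 * (1 / (1 - r))" using geo[of l] r by (intro mult_mono sum_nonneg) auto
  also have "(\<Sum>i\<in>{l..<l + n}. r powr \<bar>real i - real l\<bar>) = (\<Sum>i\<in>{l..<l + n}. r ^ (i - l))"
  proof (intro sum.cong refl)
    fix i assume "i \<in> {l..<l + n}"
    then have "\<bar>real i - real l\<bar> = real (i - l)" by auto
    then show "r powr \<bar>real i - real l\<bar> = r ^ (i - l)" using r powr_realpow[of r "i - l"] by simp
  qed
  also have "\<dots> = (\<Sum>i<n. r ^ i)"
    using sum.shift_bounds_nat_ivl[of "\<lambda>i. r ^ (i - l)" 0 l n] by (simp add: lessThan_atLeast0 add.commute)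
  also have "\<dots> \<le> 1 / (1 - r)" by (rule geo)
  finally show ?thesis by (simp add: field_simps)
qed

context scalar_product
begin

lemma sg_mult_inv:
  assumes g: "g \<in> carrier PGL" and k: "k \<in> carrier PGL"
  shows "sg g 1 \<le> sg (inv\<^bsub>PGL\<^esub> k) 1 * sg (k \<otimes>\<^bsub>PGL\<^esub> g) 1"
proof -
  interpret P: group "PGL :: (real^'n^'n) set monoid" by (rule group_PGL)
  have "weight 1 (cp (inv\<^bsub>PGL\<^esub> k \<otimes>\<^bsub>PGL\<^esub> (k \<otimes>\<^bsub>PGL\<^esub> g)))
      \<le> weight 1 (cp (inv\<^bsub>PGL\<^esub> k)) + weight 1 (cp (k \<otimes>\<^bsub>PGL\<^esub> g))"
    using g k by (intro weight_cp_mult_le) auto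
  moreover have "inv\<^bsub>PGL\<^esub> k \<otimes>\<^bsub>PGL\<^esub> (k \<otimes>\<^bsub>PGL\<^esub> g) = g"
    using g k by (simp add: P.m_assoc[symmetric])
  ultimately have "ln (sg g 1) \<le> ln (sg (inv\<^bsub>PGL\<^esub> k) 1) + ln (sg (k \<otimes>\<^bsub>PGL\<^esub> g) 1)"
    using g k by (simp add: weight_cp)
  also have "\<dots> = ln (sg (inv\<^bsub>PGL\<^esub> k) 1 * sg (k \<otimes>\<^bsub>PGL\<^esub> g) 1)"
    using sg_pos[of _ 1] g k by (intro ln_mult_pos[symmetric]) auto
  finally show ?thesis using sg_pos[of _ 1] g k by simp
qed

text \<open>Estimates the angle between the top right singular lines of \<open>g\<close> and of
  \<open>k g\<close>. Let \<open>w\<close> be the part of \<open>u'\<close> orthogonal to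
  \<open>u\<close>. On the one hand \<open>g\<close> expands \<open>w\<close> by at most
  \<open>sg g 2\<close>; on the other hand the eigenvector equation of \<open>u'\<close> makes the
  images of \<open>u'\<close> and \<open>w\<close> under \<open>k g\<close> pair to the square of
  \<open>sg ?kg 1\<close> times that of \<open>nrm w\<close>. Comparison by Cauchy-Schwarz makes
  \<open>w\<close> small.\<close>

lemma top_direction_stable:
  assumes d: "2 \<le> CARD('n)" and g: "g \<in> carrier PGL" and k: "k \<in> carrier PGL"
  shows "\<bar>ip z (fr g 1)\<bar> \<le> \<bar>ip z (fr (k \<otimes>\<^bsub>PGL\<^esub> g) 1)\<bar>
    + sg k 1 * sg (inv\<^bsub>PGL\<^esub> k) 1 * (sg g 2 / sg g 1) * nrm z"
proof -
  let ?kg = "k \<otimes>\<^bsub>PGL\<^esub> g"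
  define u where "u = fr g 1"
  define u' where "u' = fr ?kg 1"
  have kg: "?kg \<in> carrier PGL" using k g by (rule PGL_mult_closed)
  have one: "1 \<in> {1..CARD('n)}" by simp
  obtain e where e: "\<bar>e\<bar> = 1" "\<And>v. rep ?kg *v v = e *\<^sub>R (rep k *v (rep g *v v))"
    using rep_mult_vector[OF k g] by metis
  have uu: "ip u u = 1" "ip u' u' = 1"
    using frame_orthonormal[OF frame_rep, of g] frame_orthonormal[OF frame_rep, of ?kg] one
    unfolding u_def u'_def orthonormal_def by metis+
  define t where "t = ip u u'"
  define w where "w = u' - t *\<^sub>R u"
  define w' where "w' = u - t *\<^sub>R u'"
  have wu: "ip w u = 0" by (simp add: w_def t_def uu ip_sym[of u' u])
  have ww: "ip w w = 1 - t\<^sup>2" "ip w' w' = 1 - t\<^sup>2"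
    by (simp_all add: w_def w'_def t_def uu ip_sym[of u' u] power2_eq_square algebra_simps)
  have u'w: "ip u' w = ip w w"
  proof -
    have "u' = w + t *\<^sub>R u" by (simp add: w_def)
    then have "ip u' w = ip w w + t * ip u w" by (metis ip_simps(2) ip_simps(6) real_scaleR_def)
    then show ?thesis using wu ip_sym[of u w] by simp
  qed
  \<comment> \<open>\<open>w'\<close> is the part of \<open>u\<close> orthogonal to
    \<open>u'\<close>; both norms are the sine of the same angle.\<close>
  have nw: "nrm w = nrm w'" by (simp add: nrm_def ww)
  let ?a = "sg ?kg 1"
  have a: "0 < ?a" "0 < sg g 1" "0 < sg k 1" "0 < sg (inv\<^bsub>PGL\<^esub> k) 1"
    using sg_pos[OF kg one] sg_pos[OF g one] sg_pos[OF k one] sg_pos[OF PGL_inv_closed[OF k] one] by auto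
  have s2: "0 \<le> sg g 2" using frame_nonneg[OF frame_rep, of 2 g] d by simp
  have "?a\<^sup>2 * (nrm w)\<^sup>2 = ip (rep ?kg *v u') (rep ?kg *v w)"
    using frame_ip[OF frame_rep one, of ?kg w] by (simp add: u'_def[symmetric] u'w nrm_sq)
  also have "\<dots> \<le> nrm (rep ?kg *v u') * nrm (rep ?kg *v w)"
    using Cauchy_Schwarz abs_le_D1 by blast
  also have "nrm (rep ?kg *v u') = ?a"
    unfolding u'_def by (rule nrm_frame[OF frame_rep one])
  also have "nrm (rep ?kg *v w) = nrm (rep k *v (rep g *v w))"
    unfolding e(2) by (rule nrm_unit_scale[OF e(1)])
  also have "\<dots> \<le> sg k 1 * nrm (rep g *v w)" by (rule nrm_le[OF frame_rep])
  also have "\<dots> \<le> sg k 1 * (sg g 2 * nrm w)"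
    using a wu by (intro mult_left_mono nrm_le_orthogonal[OF frame_rep d]) (auto simp: u_def)
  finally have "?a\<^sup>2 * (nrm w)\<^sup>2 \<le> ?a * (sg k 1 * (sg g 2 * nrm w))" using a by simp
  then have "(?a * nrm w) * (?a * nrm w) \<le> (?a * nrm w) * (sg k 1 * sg g 2)"
    by (simp add: power2_eq_square mult_ac)
  then have b1: "?a * nrm w \<le> sg k 1 * sg g 2"
    using a s2 by (cases "nrm w = 0") (auto simp: mult_le_cancel_left_pos less_le)
  have "sg g 1 * nrm w \<le> (sg (inv\<^bsub>PGL\<^esub> k) 1 * ?a) * nrm w"
    by (intro mult_right_mono sg_mult_inv g k) simp
  also have "\<dots> \<le> sg (inv\<^bsub>PGL\<^esub> k) 1 * (sg k 1 * sg g 2)"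
    using b1 a by (simp add: mult.assoc mult_left_mono)
  finally have b2: "nrm w \<le> sg k 1 * sg (inv\<^bsub>PGL\<^esub> k) 1 * (sg g 2 / sg g 1)"
    using a by (simp add: pos_le_divide_eq mult_ac)
  have "t\<^sup>2 \<le> 1" using ww(1) ip_nonneg[of w] by linarith
  then have t1: "\<bar>t\<bar> \<le> 1" by (simp add: abs_square_le_1)
  have "u = t *\<^sub>R u' + w'" by (simp add: w'_def)
  then have "ip z u = t * ip z u' + ip z w'" by (metis ip_simps(1) ip_simps(5) real_scaleR_def)
  then have "\<bar>ip z u\<bar> \<le> \<bar>t\<bar> * \<bar>ip z u'\<bar> + \<bar>ip z w'\<bar>" by (metis abs_mult abs_triangle_ineq)
  also have "\<dots> \<le> 1 * \<bar>ip z u'\<bar> + nrm z * nrm w'"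
    by (intro add_mono mult_right_mono t1 Cauchy_Schwarz) simp
  also have "nrm z * nrm w' \<le> nrm z * (sg k 1 * sg (inv\<^bsub>PGL\<^esub> k) 1 * (sg g 2 / sg g 1))"
    using b2 nw by (intro mult_left_mono) auto
  finally show ?thesis by (simp add: u_def u'_def mult.commute)
qed

text \<open>
  If \<open>g\<close> were far from the geodesic \<open>[1, h]\<close>, the top right singular line would hardly move along
  the path from \<open>g\<close> to \<open>h\<inverse> g\<close>, and \<open>h\<inverse> g\<close> would expand \<open>z\<close> almost maximally.
\<close>

lemma expansion_along_geodesic:
  assumes d: "2 \<le> CARD('n)" and hyp: "hyperbolic_group PGL \<Gamma> len \<delta>"
    and zero: "\<And>x. x \<in> \<Gamma> \<Longrightarrow> len x = 0 \<Longrightarrow> x = \<one>\<^bsub>PGL\<^esub>"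
    and m: "0 < m" "0 < c" and anosov: "\<And>g. g \<in> \<Gamma> \<Longrightarrow> sg g 2 / sg g 1 \<le> c * exp (- m * real (len g))"
    and \<alpha>: "0 < \<alpha>"
  shows "\<exists>R\<ge>0. \<forall>g\<in>\<Gamma>. \<forall>h\<in>\<Gamma>. \<forall>z. z \<noteq> 0 \<longrightarrow> \<alpha> * nrm z \<le> \<bar>ip z (fr g 1)\<bar> \<longrightarrow>
    \<alpha> * nrm (rep (inv\<^bsub>PGL\<^esub> h \<otimes>\<^bsub>PGL\<^esub> g) *v z) \<le> nrm z \<longrightarrow>
    real (len g) - R \<le> hyperbolic_group.gp PGL len g h"
proof -
  interpret hyperbolic_group PGL \<Gamma> len \<delta> by (rule hyp)
  \<comment> \<open>Bounds the top singular values of a single step of a path and of its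
    inverse.\<close>
  define K where "K = Max (insert 1 ((\<lambda>g. sg g 1) ` {x \<in> \<Gamma>. len x \<le> 1}))"
  have K1: "1 \<le> K" using finite_ball[of 1] by (simp add: K_def)
  have K: "sg g 1 \<le> K" if "g \<in> \<Gamma>" "len g \<le> 1" for g
    using that finite_ball[of 1] unfolding K_def by (intro Max_ge) auto
  \<comment> \<open>Half of the exponential rate is kept for summation along the path; the other
    half yields the small factor \<open>exp (- m * D / 2)\<close>.\<close>
  define r where "r = exp (- m / 2)"
  have r: "0 < r" "r < 1" using m by (auto simp: r_def)
  define Q where "Q = 2 / (1 - r)"
  have Q0: "0 < Q" using r by (simp add: Q_def)
  \<comment> \<open>Distance \<open>D1\<close> makes the total drift of the singular line at most
    \<open>\<alpha> / 2\<close>; \<open>D2\<close> bounds the length of an element whose top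
    singular value is at most \<open>2 / \<alpha>\<^sup>2\<close>.\<close>
  define D1 where "D1 = 2 / m * ln (2 * K\<^sup>2 * c * Q / \<alpha>)"
  define D2 where "D2 = ln (c * (2 / \<alpha>\<^sup>2) ^ CARD('n)) / m"
  define D where "D = nat \<lceil>max D1 (D2 + 1)\<rceil>"
  have D: "D1 \<le> D" "D2 < D" unfolding D_def by linarith+
  have main: "\<exists>i\<le>len h. len (inv\<^bsub>PGL\<^esub> (q i) \<otimes>\<^bsub>PGL\<^esub> g) < D"
    if g: "g \<in> \<Gamma>" and h: "h \<in> \<Gamma>" and z0: "z \<noteq> 0" and z: "\<alpha> * nrm z \<le> \<bar>ip z (fr g 1)\<bar>"
      and hz: "\<alpha> * nrm (rep (inv\<^bsub>PGL\<^esub> h \<otimes>\<^bsub>PGL\<^esub> g) *v z) \<le> nrm z"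
      and q: "q 0 = \<one>\<^bsub>PGL\<^esub>" "q (len h) = h" "\<And>i. i \<le> len h \<Longrightarrow> q i \<in> \<Gamma> \<and> len (q i) = i"
        "\<And>i. i < len h \<Longrightarrow> len (inv\<^bsub>PGL\<^esub> (q i) \<otimes>\<^bsub>PGL\<^esub> q (Suc i)) = 1"
    for g h z q
  proof (rule ccontr)
    assume "\<not> ?thesis"
    then have far: "D \<le> len (inv\<^bsub>PGL\<^esub> (q i) \<otimes>\<^bsub>PGL\<^esub> g)" if "i \<le> len h" for i
      using that by (meson not_le)
    let ?x = "\<lambda>i. inv\<^bsub>PGL\<^esub> (q i) \<otimes>\<^bsub>PGL\<^esub> g"
    have nz: "0 < nrm z" by (rule nrm_pos[OF z0])
    have x\<Gamma>: "?x i \<in> \<Gamma>" if "i \<le> len h" for i using q(3)[OF that] g by auto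
    have step: "\<bar>ip z (fr (?x i) 1)\<bar> \<le> \<bar>ip z (fr (?x (Suc i)) 1)\<bar>
        + K\<^sup>2 * c * exp (- m * D / 2) * r powr \<bar>real i - real (len g)\<bar> * nrm z" if i: "i < len h" for i
    proof -
      have qi: "q i \<in> \<Gamma>" "q (Suc i) \<in> \<Gamma>" "len (q i) = i" using q(3)[of i] q(3)[of "Suc i"] i by auto
      define k where "k = inv\<^bsub>PGL\<^esub> (q (Suc i)) \<otimes>\<^bsub>PGL\<^esub> q i"
      have k: "k \<in> \<Gamma>" "len k = 1" "len (inv\<^bsub>PGL\<^esub> k) = 1"
        using qi q(4)[OF i] len_dist_sym[of "q (Suc i)" "q i"] len_inv[of k] by (auto simp: k_def)
      have kx: "k \<otimes>\<^bsub>PGL\<^esub> ?x i = ?x (Suc i)"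
      proof -
        have "q i \<otimes>\<^bsub>PGL\<^esub> ?x i = g" using qi g by (simp add: m_assoc[symmetric])
        then show ?thesis using qi g by (simp add: k_def m_assoc)
      qed
      have l1: "\<bar>real i - real (len g)\<bar> \<le> len (?x i)"
        using len_diff[of "q i" g] len_diff[of g "q i"] len_dist_sym[of g "q i"] qi g by auto
      \<comment> \<open>The length of \<open>?x i\<close> is at least \<open>D\<close> and at least
        the distance from \<open>i\<close> to \<open>len g\<close>, hence at least the mean of the
        two.\<close>
      have "m * (D / 2) + m / 2 * \<bar>real i - real (len g)\<bar> \<le> m * len (?x i)"
      proof -
        have "D / 2 + \<bar>real i - real (len g)\<bar> / 2 \<le> len (?x i)" using l1 far[of i] i by simp
        then have "m * (D / 2 + \<bar>real i - real (len g)\<bar> / 2) \<le> m * len (?x i)" using m by (intro mult_left_mono) auto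
        then show ?thesis by (simp add: algebra_simps)
      qed
      then have ex: "exp (- m * real (len (?x i))) \<le> exp (- m * D / 2) * r powr \<bar>real i - real (len g)\<bar>"
        by (simp add: r_def powr_def exp_add[symmetric] mult.commute[of m])
      have s0: "0 \<le> sg (?x i) 2 / sg (?x i) 1"
        using frame_nonneg[OF frame_rep, of 2 "?x i"] frame_nonneg[OF frame_rep, of 1 "?x i"] d by simp
      have "sg k 1 * sg (inv\<^bsub>PGL\<^esub> k) 1 * (sg (?x i) 2 / sg (?x i) 1) \<le> K * K * (c * exp (- m * real (len (?x i))))"
        using K[of k] K[of "inv\<^bsub>PGL\<^esub> k"] k anosov[OF x\<Gamma>] i s0 K1 frame_nonneg[OF frame_rep, of 1]
        by (intro mult_mono) auto
      also have "\<dots> \<le> K * K * (c * (exp (- m * D / 2) * r powr \<bar>real i - real (len g)\<bar>))"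
        using ex K1 m by (intro mult_left_mono) auto
      finally have "sg k 1 * sg (inv\<^bsub>PGL\<^esub> k) 1 * (sg (?x i) 2 / sg (?x i) 1) * nrm z
          \<le> K * K * (c * (exp (- m * D / 2) * r powr \<bar>real i - real (len g)\<bar>)) * nrm z"
        by (intro mult_right_mono) auto
      moreover have "\<bar>ip z (fr (?x i) 1)\<bar> \<le> \<bar>ip z (fr (k \<otimes>\<^bsub>PGL\<^esub> ?x i) 1)\<bar>
          + sg k 1 * sg (inv\<^bsub>PGL\<^esub> k) 1 * (sg (?x i) 2 / sg (?x i) 1) * nrm z"
        using k(1) x\<Gamma>[of i] i by (intro top_direction_stable d) auto
      ultimately show ?thesis unfolding kx by (simp add: power2_eq_square mult.assoc)
    qed
    have tele: "\<bar>ip z (fr (?x 0) 1)\<bar> \<le> \<bar>ip z (fr (?x j) 1)\<bar>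
        + (\<Sum>i<j. K\<^sup>2 * c * exp (- m * D / 2) * r powr \<bar>real i - real (len g)\<bar> * nrm z)" if "j \<le> len h" for j
      using that
    proof (induction j)
      case (Suc j)
      then show ?case using step[of j] by simp
    qed simp
    have "(\<Sum>i<len h. K\<^sup>2 * c * exp (- m * D / 2) * r powr \<bar>real i - real (len g)\<bar> * nrm z)
        = K\<^sup>2 * c * exp (- m * D / 2) * nrm z * (\<Sum>i<len h. r powr \<bar>real i - real (len g)\<bar>)"
      by (simp add: sum_distrib_left mult_ac)
    also have "\<dots> \<le> K\<^sup>2 * c * exp (- m * D / 2) * nrm z * Q"
      unfolding Q_def using m by (intro mult_left_mono sum_two_sided_geometric r) auto
    also have "\<dots> = (K\<^sup>2 * c * Q) * exp (- m * D / 2) * nrm z" by simp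
    also have "\<dots> \<le> \<alpha> / 2 * nrm z"
    proof (rule mult_right_mono)
      let ?y = "2 * K\<^sup>2 * c * Q / \<alpha>"
      have y: "0 < ?y" using K1 m Q0 \<alpha> by simp
      have "m * D1 / 2 \<le> m * D / 2" using D(1) m by simp
      then have "ln ?y \<le> m * D / 2" using m by (simp add: D1_def)
      then have "?y \<le> exp (m * D / 2)" using y by (metis exp_le_cancel_iff exp_ln)
      then have "?y / exp (m * D / 2) \<le> 1" by (simp only: pos_divide_le_eq[OF exp_gt_zero] mult_1)
      moreover have "exp (- m * D / 2) = inverse (exp (m * D / 2))" by (simp add: exp_minus[symmetric])
      ultimately have "?y * exp (- m * D / 2) \<le> 1" by (simp only: divide_inverse[symmetric])
      then show "(K\<^sup>2 * c * Q) * exp (- m * D / 2) \<le> \<alpha> / 2" using \<alpha> by (simp add: field_simps)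
    qed simp
    finally have err: "(\<Sum>i<len h. K\<^sup>2 * c * exp (- m * D / 2) * r powr \<bar>real i - real (len g)\<bar> * nrm z) \<le> \<alpha> / 2 * nrm z" .
    let ?k = "inv\<^bsub>PGL\<^esub> h \<otimes>\<^bsub>PGL\<^esub> g"
    have k\<Gamma>: "?k \<in> \<Gamma>" using g h by auto
    have "?x 0 = g" using q(1) g by simp
    \<comment> \<open>Along the whole path the scalar product of \<open>z\<close> with the singular
      line has dropped by at most half of its bound, so the limited expansion of \<open>z\<close>
      limits the top singular value of \<open>?k\<close>.\<close>
    then have "\<alpha> / 2 * nrm z \<le> \<bar>ip z (fr ?k 1)\<bar>"
      using tele[of "len h"] err z q(2) by simp
    then have "sg ?k 1 * (\<alpha> / 2 * nrm z) \<le> sg ?k 1 * \<bar>ip z (fr ?k 1)\<bar>"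
      using frame_nonneg[OF frame_rep, of 1 ?k] by (intro mult_left_mono) auto
    also have "\<dots> \<le> nrm (rep ?k *v z)" by (rule nrm_ge[OF frame_rep])
    finally have "\<alpha> * (sg ?k 1 * (\<alpha> / 2 * nrm z)) \<le> \<alpha> * nrm (rep ?k *v z)" using \<alpha> by (intro mult_left_mono) auto
    then have "(\<alpha>\<^sup>2 * sg ?k 1 / 2) * nrm z \<le> 1 * nrm z" using hz by (simp add: power2_eq_square mult_ac)
    then have "\<alpha>\<^sup>2 * sg ?k 1 / 2 \<le> 1" using nz by (rule mult_right_le_imp_le)
    then have s1: "sg ?k 1 \<le> 2 / \<alpha>\<^sup>2" using \<alpha> by (simp add: field_simps)
    have p1: "0 < sg ?k 1" using sg_pos[of ?k 1] k\<Gamma> by simp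
    \<comment> \<open>A bounded top singular value keeps \<open>sg ?k 2 / sg ?k 1\<close> away from
      0, and the Anosov estimate then bounds the length of \<open>?k\<close>.\<close>
    have "sg ?k 1 \<le> sg ?k 2 * sg ?k 1 ^ CARD('n)" using k\<Gamma> by (intro sg1_large d) auto
    then have "1 \<le> sg ?k 2 / sg ?k 1 * sg ?k 1 ^ CARD('n)" using p1 by (simp add: field_simps)
    also have "\<dots> \<le> (c * exp (- m * real (len ?k))) * (2 / \<alpha>\<^sup>2) ^ CARD('n)"
      using anosov[OF k\<Gamma>] s1 p1 m by (intro mult_mono power_mono) auto
    finally have "exp (m * len ?k) * 1 \<le> exp (m * len ?k) * (c * exp (- m * real (len ?k)) * (2 / \<alpha>\<^sup>2) ^ CARD('n))"
      by (intro mult_left_mono) auto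
    also have "\<dots> = (exp (m * len ?k) * exp (- m * real (len ?k))) * (c * (2 / \<alpha>\<^sup>2) ^ CARD('n))"
      by (simp only: mult_ac)
    also have "exp (m * len ?k) * exp (- m * real (len ?k)) = 1" by (simp add: exp_add[symmetric])
    finally have "exp (m * len ?k) \<le> c * (2 / \<alpha>\<^sup>2) ^ CARD('n)" by simp
    moreover have "0 < c * (2 / \<alpha>\<^sup>2) ^ CARD('n)" using m \<alpha> by simp
    ultimately have "m * len ?k \<le> ln (c * (2 / \<alpha>\<^sup>2) ^ CARD('n))" by (metis exp_le_cancel_iff exp_ln)
    then have "len ?k \<le> D2" using m by (simp add: D2_def pos_le_divide_eq mult.commute)
    moreover have "D \<le> len ?k" using far[of "len h"] q(2) by simp
    ultimately show False using D(2) by linarith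
  qed
  show ?thesis
  proof (intro exI[of _ "real D"] conjI ballI allI impI)
    fix g h z assume *: "g \<in> \<Gamma>" "h \<in> \<Gamma>" "z \<noteq> 0" "\<alpha> * nrm z \<le> \<bar>ip z (fr g 1)\<bar>"
      "\<alpha> * nrm (rep (inv\<^bsub>PGL\<^esub> h \<otimes>\<^bsub>PGL\<^esub> g) *v z) \<le> nrm z"
    obtain q where q: "q 0 = \<one>\<^bsub>PGL\<^esub> \<and> q (len h) = h \<and> (\<forall>i\<le>len h. q i \<in> \<Gamma> \<and> len (q i) = i) \<and>
      (\<forall>i<len h. len (inv\<^bsub>PGL\<^esub> (q i) \<otimes>\<^bsub>PGL\<^esub> q (Suc i)) = 1)"
      using geodesic_path[OF zero *(2)] by blast
    have "\<exists>i\<le>len h. len (inv\<^bsub>PGL\<^esub> (q i) \<otimes>\<^bsub>PGL\<^esub> g) < D"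
      by (rule main[OF *]) (use q in blast)+
    then obtain i where i: "i \<le> len h" "len (inv\<^bsub>PGL\<^esub> (q i) \<otimes>\<^bsub>PGL\<^esub> g) < D" by blast
    have qi: "q i \<in> \<Gamma>" "len (q i) = i" using q i by auto
    have adj: "\<And>j. j < len h \<Longrightarrow> q j \<in> \<Gamma> \<and> q (Suc j) \<in> \<Gamma> \<and> len (inv\<^bsub>PGL\<^esub> (q j) \<otimes>\<^bsub>PGL\<^esub> q (Suc j)) = 1"
      using q by auto
    have "len (inv\<^bsub>PGL\<^esub> (q i) \<otimes>\<^bsub>PGL\<^esub> q (i + j)) \<le> j" if "i + j \<le> len h" for j
      using that
    proof (induction j)
      case 0
      then show ?case using qi len_one by simp
    next
      case (Suc j)
      then show ?case
        using len_dist_tri[of "q i" "q (i + j)" "q (Suc (i + j))"] adj[of "i + j"] qi by auto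
    qed
    \<comment> \<open>\<open>g\<close> is within \<open>D\<close> of the point \<open>q i\<close> on
      a geodesic to \<open>h\<close>; the triangle inequality turns this into a bound on the Gromov
      product.\<close>
    from this[of "len h - i"] have "len (inv\<^bsub>PGL\<^esub> (q i) \<otimes>\<^bsub>PGL\<^esub> h) \<le> len h - i" using i q by simp
    moreover have "len (inv\<^bsub>PGL\<^esub> g \<otimes>\<^bsub>PGL\<^esub> h) \<le> len (inv\<^bsub>PGL\<^esub> g \<otimes>\<^bsub>PGL\<^esub> q i) + len (inv\<^bsub>PGL\<^esub> (q i) \<otimes>\<^bsub>PGL\<^esub> h)"
      by (rule len_dist_tri[OF *(1) qi(1) *(2)])
    moreover have "len (inv\<^bsub>PGL\<^esub> g \<otimes>\<^bsub>PGL\<^esub> q i) = len (inv\<^bsub>PGL\<^esub> (q i) \<otimes>\<^bsub>PGL\<^esub> g)"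
      by (rule len_dist_sym[OF *(1) qi(1)])
    moreover have "len g \<le> len (q i) + len (inv\<^bsub>PGL\<^esub> g \<otimes>\<^bsub>PGL\<^esub> q i)" by (rule len_diff[OF *(1) qi(1)])
    ultimately show "real (len g) - real D \<le> gp g h"
      unfolding gp_def using i qi(2) by simp
  qed simp
qed

end

section \<open>Word metrics\<close>

locale word_metric = group G for G (structure) +
  fixes \<Gamma> S
  assumes gen: "symmetric_generating_set G \<Gamma> S" and sub: "subgroup \<Gamma> G"
begin

abbreviation "wd ws \<equiv> foldr (\<otimes>) ws \<one>"
abbreviation "ln_S \<equiv> word_length G S"

lemma S_props: "finite S" "S \<subseteq> carrier G" "\<And>s. s \<in> S \<Longrightarrow> inv s \<in> S" "generate G S = \<Gamma>"
  using gen by (auto simp: symmetric_generating_set_def)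

lemma wd_carrier [simp]: "set ws \<subseteq> S \<Longrightarrow> wd ws \<in> carrier G"
  using S_props(2) by (induction ws) auto

lemma wd_append: "set ws \<subseteq> S \<Longrightarrow> set vs \<subseteq> S \<Longrightarrow> wd (ws @ vs) = wd ws \<otimes> wd vs"
proof (induction ws)
  case (Cons s ws)
  then have "s \<in> carrier G" using S_props(2) by auto
  then show ?case using Cons by (simp add: m_assoc)
qed simp

lemma wd_mem: "set ws \<subseteq> S \<Longrightarrow> wd ws \<in> \<Gamma>"
proof (induction ws)
  case Nil
  then show ?case using subgroup.one_closed[OF sub] by simp
next
  case (Cons s ws)
  then have "s \<in> \<Gamma>" using S_props(4) generate.incl[of s S G] by auto
  then show ?case using Cons subgroup.m_closed[OF sub] by simp
qed

lemma ex_word: "x \<in> \<Gamma> \<Longrightarrow> \<exists>ws. set ws \<subseteq> S \<and> wd ws = x"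
proof -
  assume "x \<in> \<Gamma>"
  then have "x \<in> generate G S" using S_props(4) by simp
  then show ?thesis
  proof induction
    case one
    show ?case by (rule exI[of _ "[]"]) simp
  next
    case (incl h)
    then show ?case using S_props(2) by (intro exI[of _ "[h]"]) auto
  next
    case (inv h)
    then show ?case using S_props(2,3) by (intro exI[of _ "[inv h]"]) auto
  next
    case (eng h1 h2)
    then obtain ws vs where "set ws \<subseteq> S" "wd ws = h1" "set vs \<subseteq> S" "wd vs = h2" by blast
    then show ?case using wd_append by (intro exI[of _ "ws @ vs"]) auto
  qed
qed

lemma word_length_le: "set ws \<subseteq> S \<Longrightarrow> ln_S (wd ws) \<le> length ws"
  unfolding word_length_def by (rule Least_le) blast

lemma shortest_word: "x \<in> \<Gamma> \<Longrightarrow> \<exists>ws. set ws \<subseteq> S \<and> length ws = ln_S x \<and> wd ws = x"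
  unfolding word_length_def by (rule LeastI_ex) (use ex_word in blast)

lemma inv_wd: "set ws \<subseteq> S \<Longrightarrow> inv (wd ws) = wd (rev (map (\<lambda>s. inv s) ws))"
proof (induction ws)
  case (Cons s ws)
  have s: "s \<in> carrier G" "inv s \<in> S" using Cons.prems S_props by auto
  have ws: "set (rev (map (\<lambda>s. inv s) ws)) \<subseteq> S" using Cons.prems S_props(3) by auto
  have "wd (rev (map (\<lambda>s. inv s) (s # ws))) = wd (rev (map (\<lambda>s. inv s) ws)) \<otimes> wd [inv s]"
    using wd_append[OF ws, of "[inv s]"] s by simp
  then show ?case using Cons s by (simp add: inv_mult_group)
qed simp

lemma word_length_mult: "x \<in> \<Gamma> \<Longrightarrow> y \<in> \<Gamma> \<Longrightarrow> ln_S (x \<otimes> y) \<le> ln_S x + ln_S y"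
proof -
  assume "x \<in> \<Gamma>" "y \<in> \<Gamma>"
  then obtain ws vs where "set ws \<subseteq> S" "length ws = ln_S x" "wd ws = x" "set vs \<subseteq> S" "length vs = ln_S y" "wd vs = y"
    using shortest_word by metis
  then show ?thesis using word_length_le[of "ws @ vs"] wd_append[of ws vs] by simp
qed

lemma word_length_inv_le: "x \<in> \<Gamma> \<Longrightarrow> ln_S (inv x) \<le> ln_S x"
proof -
  assume "x \<in> \<Gamma>"
  then obtain ws where ws: "set ws \<subseteq> S" "length ws = ln_S x" "wd ws = x" using shortest_word by metis
  have "set (rev (map (\<lambda>s. inv s) ws)) \<subseteq> S" using ws S_props(3) by auto
  then show ?thesis using word_length_le[of "rev (map (\<lambda>s. inv s) ws)"] inv_wd[OF ws(1)] ws by simp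
qed

lemma word_length_0: "x \<in> \<Gamma> \<Longrightarrow> ln_S x = 0 \<Longrightarrow> x = \<one>"
  using shortest_word[of x] by auto

lemma word_metric_hyperbolic:
  assumes \<delta>: "\<forall>w\<in>\<Gamma>. \<forall>x\<in>\<Gamma>. \<forall>y\<in>\<Gamma>. \<forall>z\<in>\<Gamma>.
    min (gromov_product G S w x y) (gromov_product G S w y z) - \<delta> \<le> gromov_product G S w x z"
  shows "hyperbolic_group G \<Gamma> ln_S \<delta>"
proof (intro hyperbolic_group.intro hyperbolic_group_axioms.intro)
  show "group G" by (rule is_group)
  have car: "x \<in> carrier G" if "x \<in> \<Gamma>" for x using subgroup.mem_carrier[OF sub that] .
  have closed: "inv x \<in> \<Gamma>" if "x \<in> \<Gamma>" for x using subgroup.m_inv_closed[OF sub that] .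
  have inv: "ln_S (inv x) = ln_S x" if "x \<in> \<Gamma>" for x
    using word_length_inv_le[OF that] word_length_inv_le[OF closed[OF that]] car[OF that] by simp
  have one: "\<one> \<in> \<Gamma>" by (rule subgroup.one_closed[OF sub])
  show "subgroup \<Gamma> G" by (rule sub)
  show "ln_S \<one> = 0" using word_length_le[of "[]"] by simp
  show "ln_S (x \<otimes> y) \<le> ln_S x + ln_S y" if "x \<in> \<Gamma>" "y \<in> \<Gamma>" for x y
    using that by (rule word_length_mult)
  show "ln_S (inv x) = ln_S x" if "x \<in> \<Gamma>" for x using that by (rule inv)
  show "\<exists>y\<in>\<Gamma>. ln_S y = n \<and> ln_S (inv y \<otimes> x) = ln_S x - n" if x: "x \<in> \<Gamma>" and n: "n \<le> ln_S x" for x n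
  proof -
    obtain ws where ws: "set ws \<subseteq> S" "length ws = ln_S x" "wd ws = x" using shortest_word[OF x] by metis
    define y where "y = wd (take n ws)"
    have t: "set (take n ws) \<subseteq> S" "set (drop n ws) \<subseteq> S" using ws(1) set_take_subset[of n ws] set_drop_subset[of n ws] by blast+
    have y: "y \<in> \<Gamma>" "ln_S y \<le> n" unfolding y_def by (rule wd_mem[OF t(1)]) (rule order_trans[OF word_length_le[OF t(1)]], simp)
    have "x = y \<otimes> wd (drop n ws)" unfolding y_def ws(3)[symmetric] using wd_append[OF t] unfolding append_take_drop_id .
    then have d: "inv y \<otimes> x = wd (drop n ws)"
      using y t car by (simp add: m_assoc[symmetric])
    then have l: "ln_S (inv y \<otimes> x) \<le> ln_S x - n" using word_length_le[OF t(2)] ws by simp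
    have "inv y \<otimes> x \<in> \<Gamma>" using d wd_mem[OF t(2)] by simp
    \<comment> \<open>Neither part exceeds its share of the word, and together they must reach
      \<open>ln_S x\<close>, so both lengths are exact.\<close>
    then have "ln_S (y \<otimes> (inv y \<otimes> x)) \<le> ln_S y + ln_S (inv y \<otimes> x)" using y by (intro word_length_mult)
    moreover have "y \<otimes> (inv y \<otimes> x) = x" using y x car by (simp add: m_assoc[symmetric])
    ultimately show ?thesis using y l n by (intro bexI[of _ y]) auto
  qed
  show "finite {x \<in> \<Gamma>. ln_S x \<le> n}" for n
  proof (rule finite_subset)
    show "{x \<in> \<Gamma>. ln_S x \<le> n} \<subseteq> wd ` {ws. set ws \<subseteq> S \<and> length ws \<le> n}"
      using shortest_word by fastforce
    show "finite (wd ` {ws. set ws \<subseteq> S \<and> length ws \<le> n})"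
      using finite_lists_length_le[OF S_props(1)] by blast
  qed
  fix x y z assume xyz: "x \<in> \<Gamma>" "y \<in> \<Gamma>" "z \<in> \<Gamma>"
  have "gromov_product G S \<one> a b = (real (ln_S a) + real (ln_S b) - real (ln_S (inv a \<otimes> b))) / 2"
    if "a \<in> \<Gamma>" "b \<in> \<Gamma>" for a b
    using that car closed inv by (simp add: gromov_product_def word_dist_def)
  then show "min ((real (ln_S x) + real (ln_S y) - real (ln_S (inv x \<otimes> y))) / 2)
            ((real (ln_S y) + real (ln_S z) - real (ln_S (inv y \<otimes> z))) / 2) - \<delta>
        \<le> (real (ln_S x) + real (ln_S z) - real (ln_S (inv x \<otimes> z))) / 2"
    using \<delta> one xyz by metis
qed

text \<open>Hyperbolicity and the Anosov estimate each come with their own generating set; this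
  transfers the exponential rate between them. The constant is the largest length of a generator, or
  1.\<close>

lemma word_length_compare:
  assumes gen': "symmetric_generating_set G \<Gamma> S'"
  shows "\<exists>L>0. \<forall>x\<in>\<Gamma>. real (ln_S x) \<le> L * real (word_length G S' x)"
proof -
  interpret W: word_metric G \<Gamma> S' by (intro word_metric.intro word_metric_axioms.intro is_group gen' sub)
  define L where "L = Max (insert 1 (ln_S ` S'))"
  have L: "1 \<le> L" "\<And>s. s \<in> S' \<Longrightarrow> ln_S s \<le> L" using W.S_props(1) by (auto simp: L_def)
  have le: "set ws \<subseteq> S' \<Longrightarrow> ln_S (wd ws) \<le> L * length ws" for ws
  proof (induction ws)
    case Nil
    then show ?case using word_length_le[of "[]"] by simp
  next
    case (Cons s ws)
    have "s \<in> \<Gamma>" using Cons.prems W.S_props(4) generate.incl[of s S' G] by auto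
    then have "ln_S (wd (s # ws)) \<le> ln_S s + ln_S (wd ws)"
      using word_length_mult[of s "wd ws"] W.wd_mem[of ws] Cons.prems by simp
    then show ?case using Cons L(2)[of s] by simp
  qed
  show ?thesis
  proof (intro exI[of _ "real L"] conjI ballI)
    show "0 < real L" using L(1) by simp
    fix x assume "x \<in> \<Gamma>"
    then obtain ws where "set ws \<subseteq> S'" "length ws = word_length G S' x" "wd ws = x"
      using W.shortest_word by metis
    then have "ln_S x \<le> L * word_length G S' x" using le by metis
    then show "real (ln_S x) \<le> real L * real (word_length G S' x)" by (metis of_nat_le_iff of_nat_mult)
  qed
qed

end

section \<open>The critical exponent\<close>

lemma ldet_1: "ldet 1 M = M 1 1"
proof -
  have "{1..1::nat} = {1}" by simp
  then have "ldet 1 M = (\<Sum>\<pi>\<in>{id}. of_int (sign \<pi>) * M 1 (\<pi> 1))"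
    unfolding ldet_def by (intro sum.cong) (auto simp: permutes_sing)
  then show ?thesis by simp
qed

context scalar_product
begin

text \<open>The case \<open>p = 1\<close> of the basin inequality, where the determinant is a single
  scalar product.\<close>

lemma shadow_direction:
  assumes x: "x \<in> shadow \<Theta> \<alpha> g" and g: "g \<in> carrier PGL" and one: "1 \<in> \<Theta>" and v: "is_basis 1 v (x 1)"
  shows "\<alpha> * nrm (rep (inv\<^bsub>PGL\<^esub> g) *v v 1) \<le> \<bar>ip (rep (inv\<^bsub>PGL\<^esub> g) *v v 1) (fr g 1)\<bar>"
proof -
  let ?h = "inv\<^bsub>PGL\<^esub> g"
  have "is_basis 1 (\<lambda>i. rep ?h *v v i) (flag_action \<Theta> ?h x 1)"
    using is_basis_image[OF invertible_rep[OF PGL_inv_closed[OF g]] v] one by (simp add: flag_action_def)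
  then have "\<alpha> * wedge_norm ip 1 (\<lambda>i. rep ?h *v v i) < \<bar>ldet 1 (\<lambda>i j. ip (rep ?h *v v i) (fr g j))\<bar>"
    using x one unfolding shadow_def basin_def by blast
  then show ?thesis by (simp add: wedge_norm_gram gram_def ldet_1 nrm_def[symmetric])
qed

text \<open>Take a vector spanning the line of a common flag, and let \<open>z\<close> and
  \<open>w\<close> be its images under the inverses of \<open>g\<close> and \<open>h\<close>, where
  \<open>g\<close> has the smaller top singular value. As \<open>h\<close> expands \<open>w\<close>
  almost maximally and \<open>g\<close> expands \<open>z\<close> by at most \<open>sg g 1\<close>,
  \<open>\<alpha> * nrm w \<le> nrm z\<close>. Since the inverse of \<open>h\<close> times
  \<open>g\<close> maps \<open>z\<close> to \<open>w\<close> up to sign,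
  \<open>expansion_along_geodesic\<close> applies.\<close>

lemma shadows_meet:
  assumes d: "2 \<le> CARD('n)" and hg: "hyperbolic_group PGL \<Gamma> len \<delta>"
    and zero: "\<And>x. x \<in> \<Gamma> \<Longrightarrow> len x = 0 \<Longrightarrow> x = \<one>\<^bsub>PGL\<^esub>"
    and m: "0 < m" "0 < c" and anosov: "\<And>g. g \<in> \<Gamma> \<Longrightarrow> sg g 2 / sg g 1 \<le> c * exp (- m * real (len g))"
    and \<alpha>: "0 < \<alpha>" and one: "1 \<in> \<Theta>"
  shows "\<exists>R\<ge>0. \<forall>g\<in>\<Gamma>. \<forall>h\<in>\<Gamma>. shadow \<Theta> \<alpha> g \<inter> shadow \<Theta> \<alpha> h \<noteq> {} \<longrightarrow>
    min (real (len g)) (real (len h)) - R \<le> hyperbolic_group.gp PGL len g h"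
proof -
  interpret hyperbolic_group PGL \<Gamma> len \<delta> by (rule hg)
  have "\<exists>R\<ge>0. \<forall>g\<in>\<Gamma>. \<forall>h\<in>\<Gamma>. \<forall>z. z \<noteq> 0 \<longrightarrow> \<alpha> * nrm z \<le> \<bar>ip z (fr g 1)\<bar> \<longrightarrow>
    \<alpha> * nrm (rep (inv\<^bsub>PGL\<^esub> h \<otimes>\<^bsub>PGL\<^esub> g) *v z) \<le> nrm z \<longrightarrow> real (len g) - R \<le> gp g h"
    by (rule expansion_along_geodesic[OF d hg zero m anosov \<alpha>])
  then obtain R where R: "0 \<le> R" "\<And>g h z. g \<in> \<Gamma> \<Longrightarrow> h \<in> \<Gamma> \<Longrightarrow> z \<noteq> 0 \<Longrightarrow> \<alpha> * nrm z \<le> \<bar>ip z (fr g 1)\<bar> \<Longrightarrow>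
    \<alpha> * nrm (rep (inv\<^bsub>PGL\<^esub> h \<otimes>\<^bsub>PGL\<^esub> g) *v z) \<le> nrm z \<Longrightarrow> real (len g) - R \<le> gp g h"
    by blast
  have main: "real (len g) - R \<le> gp g h"
    if g: "g \<in> \<Gamma>" and h: "h \<in> \<Gamma>" and xg: "x \<in> shadow \<Theta> \<alpha> g" and xh: "x \<in> shadow \<Theta> \<alpha> h"
      and le: "sg g 1 \<le> sg h 1" for g h x
  proof -
    have xf: "x \<in> flags \<Theta>" using xg by (simp add: shadow_def)
    obtain v where v: "is_basis 1 v (x 1)" using flag_basis[OF xf one] by blast
    have v0: "v 1 \<noteq> 0"
    proof
      assume "v 1 = 0"
      then have "0 \<in> v ` {1..1}" by (auto intro: image_eqI[of _ _ 1])
      then show False using v dependent_zero by (auto simp: is_basis_def)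
    qed
    let ?z = "rep (inv\<^bsub>PGL\<^esub> g) *v v 1" and ?w = "rep (inv\<^bsub>PGL\<^esub> h) *v v 1"
    have gc: "g \<in> carrier PGL" "h \<in> carrier PGL" using g h by auto
    obtain e where e: "\<bar>e\<bar> = 1" "\<And>v. rep g *v (rep (inv\<^bsub>PGL\<^esub> g) *v v) = e *\<^sub>R v" using rep_inv_vector[OF gc(1)] by metis
    obtain e' where e': "\<bar>e'\<bar> = 1" "\<And>v. rep h *v (rep (inv\<^bsub>PGL\<^esub> h) *v v) = e' *\<^sub>R v" using rep_inv_vector[OF gc(2)] by metis
    obtain e'' where e'': "\<bar>e''\<bar> = 1" "\<And>v. rep (inv\<^bsub>PGL\<^esub> h \<otimes>\<^bsub>PGL\<^esub> g) *v v = e'' *\<^sub>R (rep (inv\<^bsub>PGL\<^esub> h) *v (rep g *v v))"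
      using rep_mult_vector[OF PGL_inv_closed[OF gc(2)] gc(1)] by metis
    have z0: "?z \<noteq> 0"
    proof
      assume "?z = 0"
      then have "e *\<^sub>R v 1 = 0" using e(2)[of "v 1"] by simp
      then show False using e(1) v0 by auto
    qed
    have p: "0 < sg g 1" "0 < sg h 1" using sg_pos[OF gc(1), of 1] sg_pos[OF gc(2), of 1] by auto
    have kz: "nrm (rep (inv\<^bsub>PGL\<^esub> h \<otimes>\<^bsub>PGL\<^esub> g) *v ?z) = nrm ?w"
      using e(1) e''(1) unfolding e''(2) e(2) matrix_vector_mult_scaleR by (simp add: abs_mult)
    have "sg h 1 * (\<alpha> * nrm ?w) \<le> sg h 1 * \<bar>ip ?w (fr h 1)\<bar>"
      using shadow_direction[OF xh gc(2) one v] p by (intro mult_left_mono) auto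
    also have "\<dots> \<le> nrm (rep h *v ?w)" by (rule nrm_ge[OF frame_rep])
    also have "\<dots> = nrm (rep g *v ?z)" unfolding e(2) e'(2) using e(1) e'(1) by simp
    also have "\<dots> \<le> sg g 1 * nrm ?z" by (rule nrm_le[OF frame_rep])
    also have "\<dots> \<le> sg h 1 * nrm ?z" using le by (intro mult_right_mono) auto
    finally have "\<alpha> * nrm ?w \<le> nrm ?z" using p by simp
    then show ?thesis
      using R(2)[OF g h z0 shadow_direction[OF xg gc(1) one v]] kz by simp
  qed
  show ?thesis
  proof (intro exI[of _ R] conjI ballI impI R(1))
    fix g h assume g: "g \<in> \<Gamma>" and h: "h \<in> \<Gamma>" and "shadow \<Theta> \<alpha> g \<inter> shadow \<Theta> \<alpha> h \<noteq> {}"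
    then obtain x where x: "x \<in> shadow \<Theta> \<alpha> g" "x \<in> shadow \<Theta> \<alpha> h" by blast
    show "min (real (len g)) (real (len h)) - R \<le> gp g h"
    \<comment> \<open>The roles are assigned by the top singular value and not by the length; the
      minimum in the claim covers both outcomes.\<close>
    proof (cases "sg g 1 \<le> sg h 1")
      case True
      then show ?thesis using main[OF g h x True] by simp
    next
      case False
      then show ?thesis using main[OF h g x(2,1)] gp_sym[OF g h] by simp
    qed
  qed
qed

text \<open>Subadditivity of the weights for \<open>g k\<close> and for
  \<open>g = (g k) (inv k)\<close> controls their change in both directions. Both are used because
  the coefficients \<open>c p\<close> may have either sign.\<close>

lemma functional_cp_mult:
  assumes \<Theta>: "\<Theta> \<subseteq> {1..CARD('n) - 1}"
    and c: "\<And>a. a \<in> cartan CARD('n) \<Longrightarrow> \<phi> a = (\<Sum>p\<in>\<Theta>. c p * weight p a)"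
    and g: "g \<in> carrier PGL" and k: "k \<in> carrier PGL"
  shows "\<phi> (cp (g \<otimes>\<^bsub>PGL\<^esub> k)) \<le> \<phi> (cp g)
    + (\<Sum>p\<in>\<Theta>. \<bar>c p\<bar> * (\<bar>weight p (cp k)\<bar> + \<bar>weight p (cp (inv\<^bsub>PGL\<^esub> k))\<bar>))"
proof -
  interpret P: group "PGL :: (real^'n^'n) set monoid" by (rule group_PGL)
  let ?gk = "g \<otimes>\<^bsub>PGL\<^esub> k"
  have gk: "?gk \<in> carrier PGL" "inv\<^bsub>PGL\<^esub> k \<in> carrier PGL" using g k by auto
  have ret: "?gk \<otimes>\<^bsub>PGL\<^esub> inv\<^bsub>PGL\<^esub> k = g" using g k by (simp add: P.m_assoc)
  have "\<phi> (cp ?gk) - \<phi> (cp g) = (\<Sum>p\<in>\<Theta>. c p * (weight p (cp ?gk) - weight p (cp g)))"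
    using c cp_cartan[OF g] cp_cartan[OF gk(1)] by (simp add: sum_subtractf right_diff_distrib)
  also have "\<dots> \<le> (\<Sum>p\<in>\<Theta>. \<bar>c p\<bar> * (\<bar>weight p (cp k)\<bar> + \<bar>weight p (cp (inv\<^bsub>PGL\<^esub> k))\<bar>))"
  proof (rule sum_mono)
    fix p assume p: "p \<in> \<Theta>"
    have pd: "p \<le> CARD('n)" using index_le_card[OF \<Theta> p] by simp
    have "weight p (cp ?gk) \<le> weight p (cp g) + weight p (cp k)" by (rule weight_cp_mult_le[OF g k pd])
    moreover have "weight p (cp g) \<le> weight p (cp ?gk) + weight p (cp (inv\<^bsub>PGL\<^esub> k))"
      using weight_cp_mult_le[OF gk pd] by (simp add: ret)
    ultimately have "\<bar>weight p (cp ?gk) - weight p (cp g)\<bar> \<le> \<bar>weight p (cp k)\<bar> + \<bar>weight p (cp (inv\<^bsub>PGL\<^esub> k))\<bar>"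
      by linarith
    then have "\<bar>c p\<bar> * \<bar>weight p (cp ?gk) - weight p (cp g)\<bar> \<le> \<bar>c p\<bar> * (\<bar>weight p (cp k)\<bar> + \<bar>weight p (cp (inv\<^bsub>PGL\<^esub> k))\<bar>)"
      by (intro mult_left_mono) auto
    then show "c p * (weight p (cp ?gk) - weight p (cp g)) \<le> \<bar>c p\<bar> * (\<bar>weight p (cp k)\<bar> + \<bar>weight p (cp (inv\<^bsub>PGL\<^esub> k))\<bar>)"
      using abs_ge_self[of "c p * (weight p (cp ?gk) - weight p (cp g))"] unfolding abs_mult by linarith
  qed
  finally show ?thesis by simp
qed

end

text \<open>The logarithm of the linear factor \<open>1 + T\<close> becomes negligible after
  division by \<open>T\<close>.\<close>

lemma critical_exponent_le_1:
  assumes fin: "\<And>T. 0 \<le> T \<Longrightarrow> finite {g \<in> \<Gamma>. \<phi> (cartan_projection ip g) < T}"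
    and card: "\<And>T. 0 \<le> T \<Longrightarrow> real (card {g \<in> \<Gamma>. \<phi> (cartan_projection ip g) < T}) \<le> A * (1 + T) * exp T"
  shows "critical_exponent ip \<Gamma> \<phi> \<le> 1"
proof -
  define B where "B = max A 1"
  let ?N = "\<lambda>T. {g \<in> \<Gamma>. \<phi> (cartan_projection ip g) < T}"
  let ?b = "\<lambda>T::real. ln (2 * B) / T + ln T / T + 1"
  have le: "log_card (?N T) / ereal T \<le> ereal (?b T)" if T: "1 \<le> T" for T
  proof (cases "?N T = {}")
    case True
    show ?thesis unfolding True log_card_def using T by simp
  next
    case False
    have f: "finite (?N T)" using fin T by simp
    have pos: "0 < real (card (?N T))" using False f by (simp add: card_gt_0_iff)
    have "real (card (?N T)) \<le> A * (1 + T) * exp T" using card T by simp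
    also have "\<dots> \<le> B * (2 * T) * exp T"
      using T by (intro mult_right_mono mult_mono) (auto simp: B_def)
    finally have "ln (real (card (?N T))) \<le> ln (2 * B * T * exp T)"
      using pos by (intro ln_mono) (simp_all add: mult_ac)
    also have "\<dots> = ln (2 * B) + ln T + T"
      using T by (simp add: ln_mult_pos B_def)
    finally have "ln (real (card (?N T))) / T \<le> (ln (2 * B) + ln T + T) / T"
      using T by (intro divide_right_mono) auto
    also have "\<dots> = ?b T" using T by (simp add: add_divide_distrib)
    finally show ?thesis unfolding log_card_def using f False T by simp
  qed
  have "((\<lambda>T::real. ln (2 * B) / T) \<longlongrightarrow> 0) at_top"
    by (intro real_tendsto_divide_at_top[of _ "ln (2 * B)"] tendsto_const filterlim_ident)
  then have "(?b \<longlongrightarrow> 0 + 0 + 1) at_top"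
    by (intro tendsto_add tendsto_const ln_x_over_x_tendsto_0)
  then have lim: "((\<lambda>T. ereal (?b T)) \<longlongrightarrow> 1) at_top" by (simp add: one_ereal_def)
  have "critical_exponent ip \<Gamma> \<phi> \<le> Limsup at_top (\<lambda>T. ereal (?b T))"
    unfolding critical_exponent_def
    by (rule Limsup_mono) (use le in \<open>auto simp: eventually_at_top_linorder\<close>)
  also have "\<dots> = 1" by (rule lim_imp_Limsup[OF _ lim]) simp
  finally show ?thesis .
qed

theorem theorem3:
  fixes ip :: "real^'n \<Rightarrow> real^'n \<Rightarrow> real"
    and \<Gamma> :: "(real^'n^'n) set set"
    and \<Theta> :: "nat set"
    and \<phi> :: "(nat \<Rightarrow> real) \<Rightarrow> real"
  assumes "is_scalar_product ip"
    and "projective_anosov ip \<Gamma>"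
    and "\<not> virtually_infinite_cyclic PGL \<Gamma>"
    and "\<Theta> \<subseteq> {1..CARD('n) - 1}" and "1 \<in> \<Theta>"
    and "\<phi> \<in> cartan_sub_dual CARD('n) \<Theta>"
    and "\<exists>\<mu>. patterson_sullivan ip \<Theta> \<Gamma> \<phi> \<mu> \<and>
           \<not> (\<exists>C. complementary_subspace \<Theta> C \<and>
                measure_support (flag_topology \<Theta>) \<mu> \<subseteq> C)"
  shows "critical_exponent ip \<Gamma> \<phi> \<le> 1"
proof -
  interpret scalar_product ip by unfold_locales (rule assms(1))
  have sub: "subgroup \<Gamma> PGL" using assms(2) by (simp add: projective_anosov_def)
  have car: "g \<in> carrier PGL" if "g \<in> \<Gamma>" for g using subgroup.mem_carrier[OF sub that] .
  have d: "2 \<le> CARD('n)" using index_le_card[OF assms(4,5)] by simp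
  obtain c where c: "\<And>a. a \<in> cartan CARD('n) \<Longrightarrow> \<phi> a = (\<Sum>p\<in>\<Theta>. c p * weight p a)"
    using assms(6) by (auto simp: cartan_sub_dual_def)
  obtain \<mu> where PS: "patterson_sullivan ip \<Theta> \<Gamma> \<phi> \<mu>"
    and supp: "\<not> (\<exists>C. complementary_subspace \<Theta> C \<and> measure_support (flag_topology \<Theta>) \<mu> \<subseteq> C)"
    using assms(7) by blast
  have rad: "finite_radon_measure (flag_topology \<Theta>) \<mu>" using PS by (simp add: patterson_sullivan_def)
  have fm: "finite_measure \<mu>" using rad by (simp add: finite_radon_measure_def)
  obtain S \<delta> where S: "symmetric_generating_set PGL \<Gamma> S"
    and \<delta>: "\<forall>w\<in>\<Gamma>. \<forall>x\<in>\<Gamma>. \<forall>y\<in>\<Gamma>. \<forall>z\<in>\<Gamma>.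
      min (gromov_product PGL S w x y) (gromov_product PGL S w y z) - \<delta> \<le> gromov_product PGL S w x z"
    using assms(2) unfolding projective_anosov_def word_hyperbolic_def by blast
  have wm: "word_metric PGL \<Gamma> S"
    by (intro word_metric.intro word_metric_axioms.intro group_PGL S sub)
  let ?len = "word_length PGL S"
  have hyp: "hyperbolic_group PGL \<Gamma> ?len \<delta>" by (rule word_metric.word_metric_hyperbolic[OF wm \<delta>])
  have zero: "\<And>x. x \<in> \<Gamma> \<Longrightarrow> ?len x = 0 \<Longrightarrow> x = \<one>\<^bsub>PGL\<^esub>" by (rule word_metric.word_length_0[OF wm])
  obtain S' c0 m0 where S': "symmetric_generating_set PGL \<Gamma> S'" "0 < c0" "0 < m0"
    and an: "\<And>g. g \<in> \<Gamma> \<Longrightarrow> sing_val ip 2 g / sing_val ip 1 g \<le> c0 * exp (- m0 * real (word_length PGL S' g))"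
    using assms(2) unfolding projective_anosov_def by blast
  obtain L where L: "0 < L" "\<And>g. g \<in> \<Gamma> \<Longrightarrow> real (?len g) \<le> L * real (word_length PGL S' g)"
    using word_metric.word_length_compare[OF wm S'(1)] by blast
  \<comment> \<open>The Anosov rate is divided by the comparison constant of the two word
    lengths.\<close>
  define m where "m = m0 / L"
  have m: "0 < m" using S' L by (simp add: m_def)
  have anosov: "sg g 2 / sg g 1 \<le> c0 * exp (- m * real (?len g))" if g: "g \<in> \<Gamma>" for g
  proof -
    have "m * real (?len g) \<le> m * (L * real (word_length PGL S' g))"
      using L(2)[OF g] m by (intro mult_left_mono) auto
    then have "- m0 * real (word_length PGL S' g) \<le> - m * real (?len g)" using L(1) by (simp add: m_def)
    then have "c0 * exp (- m0 * real (word_length PGL S' g)) \<le> c0 * exp (- m * real (?len g))"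
      using S'(2) by simp
    moreover have "sing_val ip 2 g = sg g 2" "sing_val ip 1 g = sg g 1" using d by (simp_all add: sing_val_eq)
    ultimately show ?thesis using an[OF g] by simp
  qed
  obtain \<alpha> \<kappa> where \<alpha>: "0 < \<alpha>" and \<kappa>: "0 < \<kappa>" "\<And>u. orthonormal CARD('n) u \<Longrightarrow> \<kappa> \<le> measure \<mu> (basin \<Theta> \<alpha> u)"
    using basin_measure_lower_bound[OF assms(4) rad supp] by blast
  have "\<exists>R\<ge>0. \<forall>g\<in>\<Gamma>. \<forall>h\<in>\<Gamma>. shadow \<Theta> \<alpha> g \<inter> shadow \<Theta> \<alpha> h \<noteq> {} \<longrightarrow>
    min (real (?len g)) (real (?len h)) - R \<le> hyperbolic_group.gp PGL ?len g h"
    by (rule shadows_meet[OF d hyp zero m S'(2) anosov \<alpha> assms(5)])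
  then obtain R where R: "0 \<le> R" and meet: "\<And>g h. g \<in> \<Gamma> \<Longrightarrow> h \<in> \<Gamma> \<Longrightarrow> shadow \<Theta> \<alpha> g \<inter> shadow \<Theta> \<alpha> h \<noteq> {} \<Longrightarrow>
    min (real (?len g)) (real (?len h)) - R \<le> hyperbolic_group.gp PGL ?len g h"
    by blast
  let ?N = "\<lambda>T. {g \<in> \<Gamma>. \<phi> (cp g) < T}"
  have "\<exists>A. \<forall>T\<ge>0. finite (?N T) \<and> real (card (?N T)) \<le> A * (1 + T) * exp T"
  \<comment> \<open>Finite groups are not excluded by the assumption on virtually cyclic groups;
    their counting bound is trivial.\<close>
  proof (cases "finite \<Gamma>")
    case True
    have "finite (?N T) \<and> real (card (?N T)) \<le> real (card \<Gamma>) * (1 + T) * exp T" if "0 \<le> T" for T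
    proof -
      have "1 * 1 \<le> (1 + T) * exp T" using that by (intro mult_mono) auto
      then have "real (card \<Gamma>) * 1 \<le> real (card \<Gamma>) * ((1 + T) * exp T)" by (intro mult_left_mono) auto
      moreover have "card (?N T) \<le> card \<Gamma>" using True by (intro card_mono) auto
      ultimately show ?thesis using True by (simp add: mult.assoc)
    qed
    then show ?thesis by blast
  next
    case False
    define K where "K = (\<Sum>p\<in>\<Theta>. \<bar>c p\<bar> * \<bar>ln \<alpha>\<bar>)"
    define w where "w g = exp (- \<phi> (cp g))" for g
    have sets: "shadow \<Theta> \<alpha> g \<in> sets \<mu>" if "g \<in> \<Gamma>" for g
      by (intro radon_space(3)[OF assms(4) rad] openin_shadow assms(4) car that)
    have C: "w g \<le> exp K / \<kappa> * measure \<mu> (shadow \<Theta> \<alpha> g)" if g: "g \<in> \<Gamma>" for g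
    proof -
      have "w g * \<kappa> \<le> w g * measure \<mu> (basin \<Theta> \<alpha> (fr g))"
        by (intro mult_left_mono \<kappa>(2) frame_orthonormal[OF frame_rep]) (simp add: w_def)
      also have "\<dots> = exp K * (exp (- \<phi> (cp g) - K) * measure \<mu> (basin \<Theta> \<alpha> (fr g)))"
        by (simp add: w_def exp_diff)
      also have "\<dots> \<le> exp K * measure \<mu> (shadow \<Theta> \<alpha> g)"
        using shadow_measure_ge[OF assms(4) PS sub g \<alpha> c] by (intro mult_left_mono) (auto simp: K_def)
      finally show ?thesis using \<kappa>(1) by (simp add: pos_le_divide_eq)
    qed
    have wk: "\<exists>c'. \<forall>g\<in>\<Gamma>. w g \<le> c' * w (g \<otimes>\<^bsub>PGL\<^esub> k)" if k: "k \<in> \<Gamma>" for k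
    proof -
      define b where "b = (\<Sum>p\<in>\<Theta>. \<bar>c p\<bar> * (\<bar>weight p (cp k)\<bar> + \<bar>weight p (cp (inv\<^bsub>PGL\<^esub> k))\<bar>))"
      have "w g \<le> exp b * w (g \<otimes>\<^bsub>PGL\<^esub> k)" if g: "g \<in> \<Gamma>" for g
        using functional_cp_mult[OF assms(4) c car[OF g] car[OF k]]
        by (simp add: w_def b_def exp_add[symmetric])
      then show ?thesis by blast
    qed
    show ?thesis
    proof (rule hyperbolic_group.orbit_counting[OF hyp False assms(3) fm,
        where sh = "shadow \<Theta> \<alpha>" and w = w and C = "exp K / \<kappa>" and R = R])
      show "0 < w g" for g by (simp add: w_def)
      show "0 < exp K / \<kappa>" using \<kappa>(1) by simp
      fix A
      assume "\<And>T. 0 \<le> T \<Longrightarrow> finite {g \<in> \<Gamma>. exp (- T) < w g}"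
        "\<And>T. 0 \<le> T \<Longrightarrow> card {g \<in> \<Gamma>. exp (- T) < w g} \<le> A * (1 + T) * exp T"
      \<comment> \<open>\<open>exp (- T) < w g\<close> is the condition
        \<open>\<phi> (cp g) < T\<close>.\<close>
      then show ?thesis by (intro exI[of _ A]) (simp add: w_def)
    qed (use sets R meet C wk in \<open>assumption | blast\<close>)+
  qed
  then obtain A where "\<And>T. 0 \<le> T \<Longrightarrow> finite (?N T)"
    "\<And>T. 0 \<le> T \<Longrightarrow> real (card (?N T)) \<le> A * (1 + T) * exp T" by blast
  then show ?thesis by (rule critical_exponent_le_1)
qed

end
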